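(* Let $0<p<\infty$ with $p\notin 2\mathbb N$. Then for every symmetric measurable set $E\subset\mathbb T$ with $|E|>0$ and every $0<q<p$, there exists $f$ in the Hardy space $H^q(\mathbb T)$ with nonnegative Fourier coefficients such that its pointwise boundary value $f^*$ belongs to $L^p(\mathbb T\setminus E)$ while $f^*\notin L^p(\mathbb T)$. Moreover, $f$ can be chosen with gaps tending to $\infty$ in its Fourier series.
   Context: $\mathbb T=\mathbb R/\mathbb Z$ with Lebesgue measure $|\cdot|$; $E$ symmetric means $E=-E$. For $q>0$, $H^q(\mathbb T)$ is the space of periodic distributions $f$ with $\hat f(n)=0$ for $n<0$ such that the functions $f_r(t)=\sum_n \hat f(n)r^{|n|}e^{2\pi i nt}$, $0<r<1$, are uniformly bounded in $L^q(\mathbb T)$, with $\|f\|_{H^q}^q=\sup_{0<r<1}\int_0^1|f_r|^q$. For $f\in H^q(\mathbb T)$, $f_r$ converges a.e. as $r\to1$ to a function $f^*\in L^q(\mathbb T)$, the pointwise boundary value. $f$ has gaps tending to $\infty$ if its Fourier series is $\sum_{k\ge0}a_k e^{2\pi i n_k x}$ with $n_k$ increasing and $n_{k+1}-n_k\to\infty$. *)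

theory Defs
  imports "HOL-Analysis.Analysis"
begin

text \<open>The circle T = R/Z is modelled by the parameter interval [0,1] with
  Lebesgue measure; subsets of T are 1-periodic subsets of R.
  A periodic distribution f with spectrum in the nonnegative integers is
  represented by its Fourier coefficient sequence c (c n = hat f n, n \<ge> 0),
  which has polynomial growth.\<close>

definition poly_growth :: "(nat \<Rightarrow> complex) \<Rightarrow> bool" where
  "poly_growth c \<longleftrightarrow> (\<exists>C k. \<forall>n. norm (c n) \<le> C * (real n + 1) ^ k)"

definition abel_mean :: "(nat \<Rightarrow> complex) \<Rightarrow> real \<Rightarrow> real \<Rightarrow> complex" where
  "abel_mean c r t = (\<Sum>n. c n * of_real (r ^ n) * cis (2 * pi * real n * t))"

definition hardy :: "real \<Rightarrow> (nat \<Rightarrow> complex) \<Rightarrow> bool" where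
  "hardy q c \<longleftrightarrow> poly_growth c \<and>
     (\<forall>r\<in>{0<..<1}. \<forall>t. summable (\<lambda>n. c n * of_real (r ^ n) * cis (2 * pi * real n * t))) \<and>
     (\<forall>r\<in>{0<..<1}. abel_mean c r \<in> borel_measurable lebesgue) \<and>
     (\<exists>M::real. \<forall>r\<in>{0<..<1}.
        (\<integral>\<^sup>+ t\<in>{0..1}. ennreal (norm (abel_mean c r t) powr q) \<partial>lebesgue) \<le> ennreal M)"

definition boundary_value :: "(nat \<Rightarrow> complex) \<Rightarrow> (real \<Rightarrow> complex) \<Rightarrow> bool" where
  "boundary_value c g \<longleftrightarrow> g \<in> borel_measurable lebesgue \<and>
     (AE t in lebesgue. t \<in> {0..1} \<longrightarrow> ((\<lambda>r. abel_mean c r t) \<longlongrightarrow> g t) (at_left 1))"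

definition gaps_to_infinity :: "(nat \<Rightarrow> complex) \<Rightarrow> bool" where
  "gaps_to_infinity c \<longleftrightarrow> infinite {n. c n \<noteq> 0} \<and>
     filterlim (\<lambda>k. enumerate {n. c n \<noteq> 0} (Suc k) - enumerate {n. c n \<noteq> 0} k) at_top sequentially"

definition circle_set :: "real set \<Rightarrow> bool" where
  "circle_set E \<longleftrightarrow> E \<in> sets lebesgue \<and> (\<forall>x. x \<in> E \<longleftrightarrow> x + 1 \<in> E)"

definition symmetric_set :: "real set \<Rightarrow> bool" where
  "symmetric_set E \<longleftrightarrow> (\<forall>x. x \<in> E \<longleftrightarrow> - x \<in> E)"

end

theory Submission
  imports Defs "HOL-Computational_Algebra.Polynomial"
begin

text \<open>
  Write e(t) for exp(2 pi i t) and s = p/2. A factor 1 + a e(y) + a^(k+1) e(nt + ky) with small a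
  has p-th mean over y equal to A(a) + p C(s,k) a^(2k+1) cos(2 pi n t) + O(a^(2k+2)). As s is not a
  natural number, the binomial coefficient C(s,k) takes both signs for k at least 2, so products
  of many such factors in independent variables y realise, up to a constant, the p-th mean
  exp(T(t)) for every even trigonometric polynomial T, and hence any continuous positive even
  weight. Replacing the independent variables by rapidly growing multiples of t gives polynomials
  with nonnegative coefficients and arbitrarily large gaps whose p-th power concentrates on a
  prescribed symmetric set K; if K is small, their L^q norm is small for q < p.

  Now choose disjoint sets K_k in E and such polynomials f_k concentrating on K_k, and sum the
  shifted blocks z^(N_k) f_k(z). If N_k grows fast enough, the factor r^(N_k) makes the radial
  maximal function of a block comparable to its boundary modulus, which gives both membership in
  H^q and the boundary value. The L^p mass over each K_k is bounded below, so it is infinite on E,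
  while it is summable off E.
\<close>

section \<open>Fourier analysis on the unit interval\<close>

text \<open>Nonnegative coefficients leave no freedom of sign, so the signs in the exponent T have
  to come from the binomial coefficients. Write |1 + w + h|^p as the squared modulus of (1 + w +
  h)^s, with w = a e(y) and h = a^(k+1) e(nt + ky). Averaging over y removes every harmonic of y. In
  the part linear in h, what survives to leading order is the constant s of the derivative of (1 +
  w)^s, paired with the k-th harmonic of the conjugate of (1 + w)^s; this gives 2 s C(s,k) a^k
  a^(k+1) cos(2 pi n t). For an even integer p no C(s,k) is negative, and only cosines with
  nonnegative weight could be reached in this way: here the exclusion of even integers enters.
  Symmetry is forced by real coefficients, which give |f(-t)| = |f(t)|. The condition that k is at
  least 2 serves the gaps: after y = mt it keeps the shift n + km of the third term at distance at
  least m from the shift m of the second. The undetermined constant in the exponent disappears when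
  the polynomial is scaled.\<close>

definition ex :: "real \<Rightarrow> complex" where
  "ex t = cis (2 * pi * t)"

lemma norm_ex [simp]: "norm (ex t) = 1"
  by (simp add: ex_def)

lemma ex_0 [simp]: "ex 0 = 1"
  by (simp add: ex_def)

lemma ex_add: "ex (a + b) = ex a * ex b"
  by (simp add: ex_def cis_mult distrib_left)

lemma ex_of_nat_mult: "ex (real n * t) = ex t ^ n"
  by (induction n) (simp_all add: distrib_right ex_add)

lemma cnj_ex: "cnj (ex t) = ex (- t)"
  by (simp add: ex_def cis_cnj)

lemma ex_minus_mult: "ex (- t) * ex t = 1" "ex t * ex (- t) = 1"
  by (simp_all add: ex_def cis_mult)

lemma ex_of_int [simp]: "ex (of_int n) = 1"
  by (simp add: ex_def cis_multiple_2pi)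

lemma Re_ex: "Re (ex t) = cos (2 * pi * t)"
  by (simp add: ex_def)

lemma continuous_on_ex [continuous_intros]: "continuous_on S f \<Longrightarrow> continuous_on S (\<lambda>x. ex (f x))"
  unfolding ex_def by (intro continuous_intros)

abbreviation unit_meas :: "real measure" where
  "unit_meas \<equiv> lebesgue_on {0..1}"


interpretation unit_meas: finite_measure unit_meas
  by (rule finite_measureI) (simp add: emeasure_restrict_space)

lemma measure_unit_meas: "measure unit_meas {0..1} = 1"
  by (simp add: measure_restrict_space)

text \<open>The test weights. They are bounded at every point, so closure under products only
  multiplies bounds, and they include indicators of measurable sets next to continuous functions;
  this is what allows a weak limit to be evaluated on a set.\<close>

definition bdd_meas :: "(real \<Rightarrow> 'b::{real_normed_algebra, banach, second_countable_topology}) \<Rightarrow> bool" where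
  "bdd_meas w \<longleftrightarrow> w \<in> borel_measurable unit_meas \<and> (\<exists>B. \<forall>t\<in>{0..1}. norm (w t) \<le> B)"

lemma bdd_meas_measurable: "bdd_meas w \<Longrightarrow> w \<in> borel_measurable unit_meas"
  by (simp add: bdd_meas_def)

lemma bdd_meas_integrable: "bdd_meas w \<Longrightarrow> integrable unit_meas w"
  unfolding bdd_meas_def
  by (auto intro!: unit_meas.integrable_const_bound AE_I2)

lemma bdd_meas_continuous: "continuous_on {0..1} w \<Longrightarrow> bdd_meas w"
  unfolding bdd_meas_def
  using compact_imp_bounded[OF compact_continuous_image[of "{0..1::real}" w]]
  by (auto simp: continuous_imp_measurable_on_sets_lebesgue bounded_iff)

lemma bdd_meas_const: "bdd_meas (\<lambda>_. c)"
  by (rule bdd_meas_continuous) simp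

lemma bdd_meas_mult:
  assumes "bdd_meas v" "bdd_meas w" shows "bdd_meas (\<lambda>t. v t * w t)"
proof -
  obtain A B where "\<forall>t\<in>{0..1}. norm (v t) \<le> A" "\<forall>t\<in>{0..1}. norm (w t) \<le> B"
    using assms by (auto simp: bdd_meas_def)
  then have "\<forall>t\<in>{0..1}. norm (v t * w t) \<le> \<bar>A\<bar> * \<bar>B\<bar>"
    by (smt (verit) norm_mult_ineq mult_mono norm_ge_zero abs_ge_zero)
  then show ?thesis
    using assms unfolding bdd_meas_def by (auto intro!: borel_measurable_times)
qed

lemma bdd_meas_diff:
  assumes "bdd_meas v" "bdd_meas w" shows "bdd_meas (\<lambda>t. v t - w t)"
proof -
  obtain A B where "\<forall>t\<in>{0..1}. norm (v t) \<le> A" "\<forall>t\<in>{0..1}. norm (w t) \<le> B"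
    using assms by (auto simp: bdd_meas_def)
  then have "\<forall>t\<in>{0..1}. norm (v t - w t) \<le> A + B"
    by (smt (verit) norm_triangle_ineq4)
  then show ?thesis
    using assms unfolding bdd_meas_def by (auto intro!: borel_measurable_diff)
qed

lemma bdd_meas_of_real:
  fixes w :: "real \<Rightarrow> real"
  assumes "bdd_meas w" shows "bdd_meas (\<lambda>t. complex_of_real (w t))"
  using assms unfolding bdd_meas_def by auto

lemma norm_integral_unit_meas_le:
  fixes w :: "real \<Rightarrow> 'b::{banach, second_countable_topology}"
  assumes "w \<in> borel_measurable unit_meas" "\<And>t. t \<in> {0..1} \<Longrightarrow> norm (w t) \<le> B"
  shows "norm (LINT t|unit_meas. w t) \<le> B"
proof -
  have B: "0 \<le> B" using order_trans[OF norm_ge_zero assms(2)[of 0]] by simp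
  have "norm (LINT t|unit_meas. w t) \<le> (LINT t|unit_meas. norm (w t))"
    by simp
  also have "\<dots> \<le> (LINT t|unit_meas. B)"
    using assms B
    by (intro integral_mono unit_meas.integrable_const_bound[where B=B]) (auto intro!: AE_I2)
  also have "\<dots> = B"
    by (simp add: measure_unit_meas)
  finally show ?thesis .
qed

lemma integral_ex:
  "(LINT y|unit_meas. ex (of_int l * y)) = (if l = 0 then 1 else 0)"
proof (cases "l = 0")
  case True
  then show ?thesis by (simp add: measure_unit_meas)
next
  case False
  define F where "F y = ex (of_int l * y) / (2 * pi * \<i> * of_int l)" for y
  have "((\<lambda>y. ex (of_int l * y)) has_integral (F 1 - F 0)) {0..1}"
  proof (rule fundamental_theorem_of_calculus)
    fix x :: real assume "x \<in> {0..1}"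
    show "(F has_vector_derivative ex (of_int l * x)) (at x within {0..1})"
    proof -
      define g where "g z = exp (2 * pi * \<i> * of_int l * z) / (2 * pi * \<i> * of_int l)" for z
      have "(g has_field_derivative exp (2 * pi * \<i> * of_int l * of_real x)) (at (of_real x))"
        unfolding g_def using False by (auto intro!: derivative_eq_intros)
      from has_vector_derivative_real_field[OF this] show ?thesis
        unfolding F_def g_def ex_def cis_conv_exp by (simp add: mult_ac)
    qed
  qed simp
  moreover have "F 1 = F 0" using ex_of_int[of l] by (simp add: F_def)
  ultimately have "integral {0..1} (\<lambda>y. ex (of_int l * y)) = 0"
    by (simp add: integral_unique)
  moreover have "integrable unit_meas (\<lambda>y. ex (of_int l * y))"
    by (intro bdd_meas_integrable bdd_meas_continuous continuous_intros)
  ultimately show ?thesis using False by (simp add: lebesgue_integral_eq_integral)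
qed

text \<open>Mean value property. In \<open>factor_mean_expansion\<close> it reads off the one
  coefficient that survives averaging over y.\<close>

lemma integral_poly_ex: "(LINT y|unit_meas. poly r (ex y)) = poly r 0"
proof -
  have "(LINT y|unit_meas. poly r (ex y)) = (LINT y|unit_meas. (\<Sum>i\<le>degree r. coeff r i * ex (of_int (int i) * y)))"
    by (simp add: poly_altdef ex_of_nat_mult)
  also have "\<dots> = (\<Sum>i\<le>degree r. coeff r i * (LINT y|unit_meas. ex (of_int (int i) * y)))"
    by (subst Bochner_Integration.integral_sum)
       (auto intro!: bdd_meas_integrable bdd_meas_continuous continuous_intros)
  also have "\<dots> = (\<Sum>i\<le>degree r. if i = 0 then coeff r 0 else 0)"
    unfolding integral_ex by (intro sum.cong) auto
  finally show ?thesis by (simp add: poly_0_coeff_0)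
qed

text \<open>Bessel's inequality: each removal of a Fourier component lowers the squared L^2 norm by
  exactly the squared modulus of its coefficient, so the coefficients are square summable and tend
  to 0.\<close>

lemma Riemann_Lebesgue_bdd_meas:
  assumes w: "bdd_meas w"
  shows "(\<lambda>m. LINT t|unit_meas. w t * ex (real m * t)) \<longlonglongrightarrow> 0"
proof -
  define c where "c m = (LINT t|unit_meas. w t * ex (real m * t))" for m
  define v where "v N t = w t - (\<Sum>m<N. c m * ex (- (real m * t)))" for N t
  have bmv: "bdd_meas (v N)" for N
    unfolding v_def[abs_def]
    by (intro bdd_meas_diff w bdd_meas_continuous continuous_intros)
  \<comment> \<open>The components already removed have frequencies m < N and are orthogonal to
    frequency N, so the remainder still has coefficient \<open>c N\<close>.\<close>
  have coef: "(LINT t|unit_meas. v N t * ex (real N * t)) = c N" for N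
  proof -
    have "(LINT t|unit_meas. v N t * ex (real N * t)) =
        (LINT t|unit_meas. w t * ex (real N * t) - (\<Sum>m<N. c m * ex (of_int (int N - int m) * t)))"
    proof -
      have "ex (- (real m * t)) * ex (real N * t) = ex (of_int (int N - int m) * t)" for m t
        by (simp add: left_diff_distrib flip: ex_add)
      then show ?thesis
        by (simp add: v_def left_diff_distrib sum_distrib_right mult.assoc del: of_int_diff)
    qed
    also have "\<dots> = c N - (\<Sum>m<N. c m * (LINT t|unit_meas. ex (of_int (int N - int m) * t)))"
    proof -
      have "integrable unit_meas (\<lambda>t. w t * ex (real N * t))"
        by (intro bdd_meas_integrable bdd_meas_mult w) (intro bdd_meas_continuous continuous_intros)
      moreover have "integrable unit_meas (\<lambda>t. c m * ex (of_int (int N - int m) * t))" for m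
        by (intro bdd_meas_integrable bdd_meas_continuous continuous_intros)
      ultimately show ?thesis
        unfolding c_def[of N] by (simp add: Bochner_Integration.integral_sum del: of_int_diff)
    qed
    also have "\<dots> = c N" by (simp add: integral_ex del: of_int_diff)
    finally show ?thesis .
  qed
  have step: "(LINT t|unit_meas. (norm (v (Suc N) t))\<^sup>2) =
      (LINT t|unit_meas. (norm (v N t))\<^sup>2) - (norm (c N))\<^sup>2" for N
  proof -
    have eq: "(norm (v (Suc N) t))\<^sup>2 = (norm (v N t))\<^sup>2 -
        2 * Re (cnj (c N) * (v N t * ex (real N * t))) + (norm (c N))\<^sup>2" for t
    proof -
      have "v (Suc N) t = v N t - c N * ex (- (real N * t))" by (simp add: v_def)
      then have "(norm (v (Suc N) t))\<^sup>2 = (norm (v N t - c N * ex (- (real N * t))))\<^sup>2" by simp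
      also have "\<dots> = (norm (v N t))\<^sup>2 + (norm (c N * ex (- (real N * t))))\<^sup>2
          - 2 * Re (v N t * cnj (c N * ex (- (real N * t))))"
        unfolding cmod_power2 by (simp add: power2_eq_square algebra_simps)
      finally show ?thesis by (simp add: norm_mult cnj_ex mult_ac)
    qed
    have i1: "integrable unit_meas (\<lambda>t. (norm (v N t))\<^sup>2)"
    proof -
      have "bdd_meas (\<lambda>t. norm (v N t))" using bmv[of N] by (auto simp: bdd_meas_def)
      from bdd_meas_mult[OF this this] show ?thesis unfolding power2_eq_square by (rule bdd_meas_integrable)
    qed
    have i2: "integrable unit_meas (\<lambda>t. cnj (c N) * (v N t * ex (real N * t)))"
      by (intro bdd_meas_integrable bdd_meas_mult bmv bdd_meas_const bdd_meas_continuous continuous_intros)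
    have "(LINT t|unit_meas. 2 * Re (cnj (c N) * (v N t * ex (real N * t)))) =
       2 * Re (cnj (c N) * c N)"
      using i2 by (simp add: integral_Re coef del: times_complex.sel)
    moreover have "cnj (c N) * c N = of_real ((norm (c N))\<^sup>2)"
      by (simp add: complex_norm_square mult.commute del: of_real_power)
    ultimately show ?thesis
      unfolding eq using i1 i2
      by (simp add: integrable_Re measure_unit_meas del: times_complex.sel complex_Re_numeral)
  qed
  have "(\<Sum>m<N. (norm (c m))\<^sup>2) \<le> (LINT t|unit_meas. (norm (w t))\<^sup>2)" for N
  proof -
    have "(LINT t|unit_meas. (norm (v N t))\<^sup>2) =
      (LINT t|unit_meas. (norm (w t))\<^sup>2) - (\<Sum>m<N. (norm (c m))\<^sup>2)"
      by (induction N) (auto simp: step, simp add: v_def)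
    moreover have "(LINT t|unit_meas. (norm (v N t))\<^sup>2) \<ge> 0" by simp
    ultimately show ?thesis by linarith
  qed
  then have "summable (\<lambda>m. (norm (c m))\<^sup>2)"
    by (intro summableI_nonneg_bounded) auto
  then have "(\<lambda>m. (norm (c m))\<^sup>2) \<longlonglongrightarrow> 0" by (rule summable_LIMSEQ_zero)
  then have "(\<lambda>m. sqrt ((norm (c m))\<^sup>2)) \<longlonglongrightarrow> sqrt 0" by (rule tendsto_real_sqrt)
  then have "(\<lambda>m. norm (c m)) \<longlonglongrightarrow> 0" by simp
  then show ?thesis unfolding c_def by (rule tendsto_norm_zero_cancel)
qed

section \<open>Equidistribution along t, mt\<close>

lemma continuous_on_section:
  fixes G :: "real \<Rightarrow> real \<Rightarrow> 'a::topological_space"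
  assumes "continuous_on UNIV (\<lambda>x. G (fst x) (snd x))"
    and "continuous_on S f" "continuous_on S g"
  shows "continuous_on S (\<lambda>x. G (f x) (g x))"
  using continuous_on_compose2[OF assms(1) continuous_on_Pair[OF assms(2,3)]] by simp

lemma continuous_on_mean:
  fixes G :: "real \<Rightarrow> real \<Rightarrow> 'a::euclidean_space"
  assumes G: "continuous_on UNIV (\<lambda>x. G (fst x) (snd x))"
  shows "continuous_on S (\<lambda>t. LINT y|unit_meas. G t y)"
proof -
  have "continuous_on {0..1} (G t)" for t
    using continuous_on_section[OF G, of "{0..1}" "\<lambda>_. t" "\<lambda>y. y"] by simp
  then have eq: "(LINT y|unit_meas. G t y) = integral (cbox 0 1) (G t)" for t
    by (simp add: lebesgue_integral_eq_integral continuous_imp_integrable_real)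
  show ?thesis unfolding eq
    by (rule integral_continuous_on_param)
       (use continuous_on_subset[OF G] in \<open>simp add: case_prod_unfold\<close>)
qed

text \<open>In the limit t and mt behave like independent variables. Quantifying over all weights w
  lets an induction over factors hide the other factors in w.\<close>

definition equidistributed :: "(real \<Rightarrow> real \<Rightarrow> complex) \<Rightarrow> bool" where
  "equidistributed G \<longleftrightarrow> (\<forall>w. bdd_meas w \<longrightarrow>
     (\<lambda>m. LINT t|unit_meas. w t * G t (real m * t)) \<longlonglongrightarrow>
     (LINT t|unit_meas. w t * (LINT y|unit_meas. G t y)))"

inductive_set trig_span :: "(real \<Rightarrow> real \<Rightarrow> complex) set" where
  monomial: "(\<lambda>t y. ex (of_int i * t + of_int j * y)) \<in> trig_span"
| scale: "f \<in> trig_span \<Longrightarrow> (\<lambda>t y. c * f t y) \<in> trig_span"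
| add: "f \<in> trig_span \<Longrightarrow> g \<in> trig_span \<Longrightarrow> (\<lambda>t y. f t y + g t y) \<in> trig_span"

lemma trig_span_const: "(\<lambda>t y. c) \<in> trig_span"
  using trig_span.scale[OF trig_span.monomial[of 0 0], of c] by simp

lemma trig_span_mult:
  assumes "f \<in> trig_span" "g \<in> trig_span"
  shows "(\<lambda>t y. f t y * g t y) \<in> trig_span"
  using assms(1)
proof induction
  case (monomial i j)
  from assms(2) show ?case
  proof induction
    case (monomial k l)
    have "(\<lambda>t y. ex (of_int i * t + of_int j * y) * ex (of_int k * t + of_int l * y)) =
       (\<lambda>t y. ex (of_int (i + k) * t + of_int (j + l) * y))"
      by (intro ext) (simp add: algebra_simps flip: ex_add)
    then show ?case by (simp only: trig_span.monomial)
  next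
    case (scale f c)
    from trig_span.scale[OF this(2), of c] show ?case by (simp add: mult.left_commute)
  next
    case (add f g)
    from trig_span.add[OF this(3,4)] show ?case by (simp add: distrib_left)
  qed
next
  case (scale f c)
  from trig_span.scale[OF this(2), of c] show ?case by (simp add: mult.assoc)
next
  case (add f g)
  from trig_span.add[OF this(3,4)] show ?case by (simp add: distrib_right)
qed

lemma trig_span_cnj:
  assumes "f \<in> trig_span"
  shows "(\<lambda>t y. cnj (f t y)) \<in> trig_span"
  using assms
proof induction
  case (monomial i j)
  have "(\<lambda>t y. cnj (ex (of_int i * t + of_int j * y))) =
     (\<lambda>t y. ex (of_int (- i) * t + of_int (- j) * y))"
    by (intro ext) (simp add: cnj_ex)
  then show ?case by (simp only: trig_span.monomial)
next
  case (scale f c)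
  from trig_span.scale[OF this(2), of "cnj c"] show ?case by simp
next
  case (add f g)
  from trig_span.add[OF this(3,4)] show ?case by simp
qed

lemma trig_span_poly:
  assumes "f \<in> trig_span"
  shows "(\<lambda>t y. poly r (f t y)) \<in> trig_span"
proof (induction r)
  case 0
  then show ?case using trig_span_const[of 0] by simp
next
  case (pCons a r)
  from trig_span.add[OF trig_span_const trig_span_mult[OF assms pCons(2)]]
  show ?case by simp
qed

lemma trig_span_continuous:
  assumes "f \<in> trig_span"
  shows "continuous_on UNIV (\<lambda>x. f (fst x) (snd x))"
  using assms by induction (auto intro!: continuous_intros)

text \<open>Setting y = mt in a monomial gives the frequency i + jm. For j nonzero it tends to
  infinity in modulus, and Riemann-Lebesgue applies with e(it) absorbed in the weight; for j = 0 the
  monomial does not depend on y.\<close>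

lemma trig_span_equidistributed:
  assumes "f \<in> trig_span"
  shows "equidistributed f"
  using assms
proof induction
  case (monomial i j)
  show ?case unfolding equidistributed_def
  proof (intro allI impI)
    fix w :: "real \<Rightarrow> complex" assume w: "bdd_meas w"
    define v where "v t = w t * ex (of_int i * t)" for t
    have v: "bdd_meas v" unfolding v_def by (intro bdd_meas_mult w bdd_meas_continuous continuous_intros)
    have mean: "(LINT y|unit_meas. ex (of_int i * t + of_int j * y)) = (if j = 0 then ex (of_int i * t) else 0)" for t
      by (simp add: ex_add integral_ex)
    have int_eq: "(LINT t|unit_meas. w t * ex (of_int i * t + of_int j * (real m * t))) =
       (LINT t|unit_meas. v t * ex (of_int (j * int m) * t))" for m
      by (simp add: v_def ex_add mult_ac)
    consider "j = 0" | "j > 0" | "j < 0" by linarith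
    then show "(\<lambda>m. LINT t|unit_meas. w t * ex (of_int i * t + of_int j * (real m * t)))
      \<longlonglongrightarrow> (LINT t|unit_meas. w t * (LINT y|unit_meas. ex (of_int i * t + of_int j * y)))"
    proof cases
      case 1
      then show ?thesis unfolding mean int_eq by (simp add: v_def)
    next
      case 2
      have "filterlim (\<lambda>m. nat j * m) at_top sequentially"
        using 2 by (intro filterlim_subseq) (auto simp: strict_mono_def)
      from filterlim_compose[OF Riemann_Lebesgue_bdd_meas[OF v] this]
      show ?thesis unfolding mean int_eq using 2 by simp
    next
      case 3
      \<comment> \<open>\<open>Riemann_Lebesgue_bdd_meas\<close> concerns frequencies of one sign,
        so negative j is reduced to it by conjugation.\<close>
      have cv: "bdd_meas (\<lambda>t. cnj (v t))" 
        using v measurable_compose[OF bdd_meas_measurable[OF v] borel_measurable_continuous_onI[of cnj]]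
        by (simp add: bdd_meas_def continuous_on_cnj)
      have "filterlim (\<lambda>m. nat (- j) * m) at_top sequentially"
        using 3 by (intro filterlim_subseq) (auto simp: strict_mono_def)
      from tendsto_cnj[OF filterlim_compose[OF Riemann_Lebesgue_bdd_meas[OF cv] this]]
      have "(\<lambda>m. cnj (LINT t|unit_meas. cnj (v t) * ex (real (nat (- j) * m) * t))) \<longlonglongrightarrow> 0"
        by simp
      moreover have "cnj (LINT t|unit_meas. cnj (v t) * ex (real (nat (- j) * m) * t)) =
         (LINT t|unit_meas. v t * ex (of_int (j * int m) * t))" for m
      proof -
        have "cnj (LINT t|unit_meas. cnj (v t) * ex (real (nat (- j) * m) * t)) =
          (LINT t|unit_meas. cnj (cnj (v t) * ex (real (nat (- j) * m) * t)))"
          by (rule Bochner_Integration.integral_cnj[symmetric])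
        then show ?thesis using 3 by (simp add: cnj_ex)
      qed
      ultimately show ?thesis unfolding mean int_eq using 3 by simp
    qed
  qed
next
  case (scale f c)
  show ?case unfolding equidistributed_def
  proof (intro allI impI)
    fix w :: "real \<Rightarrow> complex" assume w: "bdd_meas w"
    from tendsto_mult_left[OF scale(2)[unfolded equidistributed_def, rule_format, OF w], of c]
    show "(\<lambda>m. LINT t|unit_meas. w t * (c * f t (real m * t)))
         \<longlonglongrightarrow> (LINT t|unit_meas. w t * (LINT y|unit_meas. c * f t y))"
      by (simp add: mult.left_commute)
  qed
next
  case (add f g)
  show ?case unfolding equidistributed_def
  proof (intro allI impI)
    fix w :: "real \<Rightarrow> complex" assume w: "bdd_meas w"
    note cont = trig_span_continuous[OF add(1)] trig_span_continuous[OF add(2)]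
    have i1: "integrable unit_meas (\<lambda>t. w t * f t (real m * t))"
             "integrable unit_meas (\<lambda>t. w t * g t (real m * t))" for m
      by (intro bdd_meas_integrable bdd_meas_mult w bdd_meas_continuous continuous_on_section[OF cont(1)]
          continuous_on_section[OF cont(2)] continuous_intros)+
    have i2: "integrable unit_meas (\<lambda>t. w t * (LINT y|unit_meas. f t y))"
             "integrable unit_meas (\<lambda>t. w t * (LINT y|unit_meas. g t y))"
      by (intro bdd_meas_integrable bdd_meas_mult w bdd_meas_continuous continuous_on_mean cont)+
    have i3: "integrable unit_meas (f t)" "integrable unit_meas (g t)" for t
      using continuous_on_section[OF cont(1), of "{0..1}" "\<lambda>_. t" "\<lambda>y. y"]
        continuous_on_section[OF cont(2), of "{0..1}" "\<lambda>_. t" "\<lambda>y. y"]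
      by (auto intro!: bdd_meas_integrable bdd_meas_continuous)
    from tendsto_add[OF add(3)[unfolded equidistributed_def, rule_format, OF w]
        add(4)[unfolded equidistributed_def, rule_format, OF w]]
    show "(\<lambda>m. LINT t|unit_meas. w t * (f t (real m * t) + g t (real m * t)))
         \<longlonglongrightarrow> (LINT t|unit_meas. w t * (LINT y|unit_meas. f t y + g t y))"
      using i1 i2 i3 by (simp add: distrib_left)
  qed
qed

lemma equidistributed_uniform_limit:
  fixes G :: "real \<Rightarrow> real \<Rightarrow> complex"
  assumes G: "continuous_on UNIV (\<lambda>x. G (fst x) (snd x))"
    and approx: "\<And>\<eta>. \<eta> > 0 \<Longrightarrow> \<exists>f\<in>trig_span. \<forall>t y. norm (G t y - f t y) \<le> \<eta>"
  shows "equidistributed G"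
  unfolding equidistributed_def
proof (intro allI impI)
  fix w :: "real \<Rightarrow> complex" assume w: "bdd_meas w"
  obtain B where B: "B > 0" "\<And>t. t \<in> {0..1} \<Longrightarrow> norm (w t) \<le> B"
  proof -
    obtain B where "\<forall>t\<in>{0..1}. norm (w t) \<le> B" using w by (auto simp: bdd_meas_def)
    then show thesis by (intro that[of "max B 1"]) force+
  qed
  show "(\<lambda>m. LINT t|unit_meas. w t * G t (real m * t)) \<longlonglongrightarrow>
     (LINT t|unit_meas. w t * (LINT y|unit_meas. G t y))"
  proof (rule LIMSEQ_I)
    fix e :: real assume e: "e > 0"
    \<comment> \<open>Replacing G by f costs B \<eta> = e/4 in the integral along (t, mt) and again
      in the integral of the means; e/2 is left for the convergence for f.\<close>
    define \<eta> where "\<eta> = e / (4 * B)"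
    have \<eta>: "\<eta> > 0" using e B by (simp add: \<eta>_def)
    from approx[OF this] obtain f where f: "f \<in> trig_span" and fG: "\<And>t y. norm (G t y - f t y) \<le> \<eta>" by blast
    note cont = trig_span_continuous[OF f]
    have sec: "integrable unit_meas (\<lambda>y. G t y)" "integrable unit_meas (\<lambda>y. f t y)" for t
      by (intro bdd_meas_integrable bdd_meas_continuous continuous_on_section[OF cont]
          continuous_on_section[OF G] continuous_intros)+
    have bmG: "bdd_meas (\<lambda>t. G t (real m * t))" "bdd_meas (\<lambda>t. f t (real m * t))" for m
      by (intro bdd_meas_continuous continuous_on_section[OF cont]
          continuous_on_section[OF G] continuous_intros)+
    have bmM: "bdd_meas (\<lambda>t. LINT y|unit_meas. G t y)" "bdd_meas (\<lambda>t. LINT y|unit_meas. f t y)"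
      by (intro bdd_meas_continuous continuous_on_mean cont G)+
    have key: "norm ((LINT t|unit_meas. w t * u t) - (LINT t|unit_meas. w t * v t)) \<le> B * \<eta>"
      if "bdd_meas u" "bdd_meas v" "\<And>t. norm (u t - v t) \<le> \<eta>" for u v :: "real \<Rightarrow> complex"
    proof -
      have "(LINT t|unit_meas. w t * u t) - (LINT t|unit_meas. w t * v t) =
         (LINT t|unit_meas. w t * (u t - v t))"
        using bdd_meas_integrable[OF bdd_meas_mult[OF w that(1)]] bdd_meas_integrable[OF bdd_meas_mult[OF w that(2)]]
        by (simp add: right_diff_distrib)
      also have "norm \<dots> \<le> B * \<eta>"
        using B that(3) \<eta>
        by (intro norm_integral_unit_meas_le bdd_meas_measurable bdd_meas_mult w bdd_meas_diff that(1,2))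
           (auto simp: norm_mult intro!: mult_mono)
      finally show ?thesis .
    qed
    have mean: "norm ((LINT y|unit_meas. G t y) - (LINT y|unit_meas. f t y)) \<le> \<eta>" for t
    proof -
      have "(LINT y|unit_meas. G t y) - (LINT y|unit_meas. f t y) = (LINT y|unit_meas. G t y - f t y)"
        using sec by simp
      also have "norm \<dots> \<le> \<eta>"
        by (intro norm_integral_unit_meas_le fG borel_measurable_diff)
           (use sec in \<open>auto intro: borel_measurable_integrable\<close>)
      finally show ?thesis .
    qed
    have "(\<lambda>m. LINT t|unit_meas. w t * f t (real m * t)) \<longlonglongrightarrow>
       (LINT t|unit_meas. w t * (LINT y|unit_meas. f t y))"
      using trig_span_equidistributed[OF f] w by (simp add: equidistributed_def)
    from LIMSEQ_D[OF this, of "e / 2"] e obtain N where N: "\<And>m. m \<ge> N \<Longrightarrow>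
       norm ((LINT t|unit_meas. w t * f t (real m * t)) - (LINT t|unit_meas. w t * (LINT y|unit_meas. f t y))) < e / 2"
      by auto
    show "\<exists>N. \<forall>m\<ge>N. norm ((LINT t|unit_meas. w t * G t (real m * t)) -
        (LINT t|unit_meas. w t * (LINT y|unit_meas. G t y))) < e"
    proof (intro exI allI impI)
      fix m assume "m \<ge> N"
      have e4: "B * \<eta> = e / 4" using B by (simp add: \<eta>_def)
      note N[OF \<open>m \<ge> N\<close>] key[OF bmG(1)[of m] bmG(2)[of m] fG, unfolded e4] key[OF bmM mean, unfolded e4]
      then show "norm ((LINT t|unit_meas. w t * G t (real m * t)) -
        (LINT t|unit_meas. w t * (LINT y|unit_meas. G t y))) < e"
        by norm
    qed
  qed
qed

section \<open>Polynomial approximation of complex powers\<close>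

definition binom_poly :: "real \<Rightarrow> nat \<Rightarrow> complex poly" where
  "binom_poly s K = (\<Sum>j\<le>K. monom (of_real (s gchoose j)) j)"

lemma poly_binom_poly: "poly (binom_poly s K) z = (\<Sum>j\<le>K. of_real (s gchoose j) * z ^ j)"
  by (simp add: binom_poly_def poly_sum poly_monom)

lemma of_real_gbinomial: "(of_real a gchoose n :: complex) = of_real (a gchoose n)"
  by (simp add: gbinomial_prod_rev)

text \<open>One constant, the sum of |C(s,n)| 2^(-n), serves every degree K: |z|^n is 2^(-n)
  (2|z|)^n, and 2|z| is at most 1, so the tail gains the factor (2|z|)^(K+1). Independence of K
  matters in \<open>equidistributed_perturbation\<close>, where K is chosen after C.\<close>

lemma binom_poly_approx:
  obtains C where "C \<ge> 0"
    "\<And>K z. norm z \<le> 1/2 \<Longrightarrow>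
       norm ((1 + z) powr of_real s - poly (binom_poly s K) z) \<le> C * (2 * norm z) ^ Suc K"
    "\<And>K z. norm z \<le> 1/2 \<Longrightarrow> norm (poly (binom_poly s K) z) \<le> C"
    "\<And>z :: complex. norm z \<le> 1/2 \<Longrightarrow> norm ((1 + z) powr of_real s) \<le> C"
proof -
  define b where "b j = (complex_of_real s gchoose j)" for j
  have b: "b j = of_real (s gchoose j)" for j
    by (simp add: b_def of_real_gbinomial)
  have sums: "(\<lambda>n. b n * z ^ n) sums (1 + z) powr of_real s" if "norm z < 1" for z
    unfolding b_def by (rule gen_binomial_complex[OF that])
  have sn: "summable (\<lambda>n. norm (b n * (1/2) ^ n))"
    by (rule powser_insidea[of _ "3/4"]) (use sums[of "3/4"] in \<open>auto simp: sums_iff\<close>)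
  define C where "C = (\<Sum>n. norm (b n * (1/2) ^ n))"
  have C: "C \<ge> 0" unfolding C_def by (intro suminf_nonneg sn) simp
  have term_le: "norm (b n * z ^ n) \<le> norm (b n * (1/2) ^ n)" if "norm z \<le> 1/2" for z n
    using that by (auto simp: norm_mult norm_power intro!: mult_left_mono power_mono)
  have full: "norm (suminf (\<lambda>n. b n * z ^ n)) \<le> C" if "norm z \<le> 1/2" for z
    unfolding C_def by (rule norm_suminf_le[OF term_le[OF that] sn])
  show thesis
  proof
    show "C \<ge> 0" by fact
    fix K :: nat and z :: complex assume z: "norm z \<le> 1/2"
    have P: "poly (binom_poly s K) z = (\<Sum>n<Suc K. b n * z ^ n)"
      by (simp add: poly_binom_poly b lessThan_Suc_atMost)
    have "(1 + z) powr of_real s - poly (binom_poly s K) z = (\<Sum>n. b (n + Suc K) * z ^ (n + Suc K))"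
      using sums[of z] z unfolding P by (subst suminf_minus_initial_segment) (auto simp: sums_iff)
    also have "norm \<dots> \<le> (\<Sum>n. norm (b (n + Suc K) * (1/2) ^ (n + Suc K)) * (2 * norm z) ^ Suc K)"
    proof (rule norm_suminf_le)
      fix n
      have "norm (b (n + Suc K) * z ^ (n + Suc K)) =
         norm (b (n + Suc K) * (1/2) ^ (n + Suc K)) * (2 * norm z) ^ (n + Suc K)"
        by (simp only: norm_mult norm_power power_mult_distrib) (simp add: power_one_over)
      also have "\<dots> \<le> norm (b (n + Suc K) * (1/2) ^ (n + Suc K)) * (2 * norm z) ^ Suc K"
        using z by (intro mult_left_mono power_decreasing) auto
      finally show "norm (b (n + Suc K) * z ^ (n + Suc K)) \<le> \<dots>" .
    next
      show "summable (\<lambda>n. norm (b (n + Suc K) * (1/2) ^ (n + Suc K)) * (2 * norm z) ^ Suc K)"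
        using summable_ignore_initial_segment[OF sn, of "Suc K"] by (intro summable_mult2) simp
    qed
    also have "\<dots> = (\<Sum>n. norm (b (n + Suc K) * (1/2) ^ (n + Suc K))) * (2 * norm z) ^ Suc K"
      using summable_ignore_initial_segment[OF sn, of "Suc K"] by (intro suminf_mult2[symmetric]) simp
    also have "\<dots> \<le> C * (2 * norm z) ^ Suc K"
    proof (rule mult_right_mono)
      have "0 \<le> (\<Sum>n<Suc K. norm (b n * (1/2) ^ n))" by (rule sum_nonneg) simp
      then show "(\<Sum>n. norm (b (n + Suc K) * (1/2) ^ (n + Suc K))) \<le> C"
        unfolding C_def suminf_split_initial_segment[OF sn, of "Suc K"] by linarith
    qed simp
    finally show "norm ((1 + z) powr of_real s - poly (binom_poly s K) z) \<le> C * (2 * norm z) ^ Suc K" .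
    have "norm (poly (binom_poly s K) z) \<le> (\<Sum>n<Suc K. norm (b n * (1/2) ^ n))"
      unfolding P by (intro sum_norm_le term_le z)
    also have "\<dots> \<le> C" unfolding C_def by (rule sum_le_suminf[OF sn]) auto
    finally show "norm (poly (binom_poly s K) z) \<le> C" .
  next
    fix z :: complex assume z: "norm z \<le> 1/2"
    show "norm ((1 + z) powr of_real s) \<le> C"
      using full[OF z] sums[of z] z by (simp add: sums_iff)
  qed
qed

text \<open>This is where s = p/2 comes from: the p-th power of a modulus becomes a holomorphic
  function times its conjugate, and each of them has a power series.\<close>

lemma norm_powr_eq_square:
  "norm (1 + z) powr p = (norm ((1 + z) powr complex_of_real (p / 2)))\<^sup>2"
  by (simp add: norm_powr_real_powr' powr_half_sqrt_powr power2_eq_square flip: powr_add)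

lemma norm_square_diff_le:
  fixes x y :: complex
  assumes "norm x \<le> C" "norm y \<le> C"
  shows "\<bar>(norm x)\<^sup>2 - (norm y)\<^sup>2\<bar> \<le> 2 * C * norm (x - y)"
proof -
  have "\<bar>(norm x)\<^sup>2 - (norm y)\<^sup>2\<bar> = \<bar>norm x - norm y\<bar> * (norm x + norm y)"
    by (simp add: power2_eq_square square_diff_square_factored abs_mult mult.commute)
  also have "\<dots> \<le> norm (x - y) * (2 * C)"
    using assms by (intro mult_mono norm_triangle_ineq3) auto
  finally show ?thesis by (simp add: mult.commute)
qed

section \<open>The p-th mean of a single factor\<close>

text \<open>The coefficient a^(k+1) is tuned so that the square of the second term has order
  a^(2k+2), one power of a below the resonance of order a^k a^(k+1).\<close>

definition perturbation :: "nat \<Rightarrow> nat \<Rightarrow> real \<Rightarrow> real \<Rightarrow> real \<Rightarrow> complex" where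
  "perturbation n k a t y = of_real a * ex y + of_real (a ^ Suc k) * ex (real n * t + real k * y)"

definition factor_mean :: "real \<Rightarrow> nat \<Rightarrow> nat \<Rightarrow> real \<Rightarrow> real \<Rightarrow> real" where
  "factor_mean p n k a t = (LINT y|unit_meas. norm (1 + perturbation n k a t y) powr p)"

lemma norm_perturbation_le:
  assumes "0 < a" "a \<le> 1/8"
  shows "norm (perturbation n k a t y) \<le> 2 * a"
proof -
  have "norm (perturbation n k a t y) \<le> a + a ^ Suc k"
    unfolding perturbation_def using assms by (intro norm_triangle_le) (simp add: norm_mult norm_power)
  also have "a ^ Suc k \<le> a" using assms power_decreasing[of 1 "Suc k" a] by simp
  finally show ?thesis by simp
qed

lemma one_plus_perturbation_nonzero:
  assumes "0 < a" "a \<le> 1/8"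
  shows "1 + perturbation n k a t y \<noteq> 0"
proof
  assume "1 + perturbation n k a t y = 0"
  then have "norm (perturbation n k a t y) = 1" by (metis add_eq_0_iff norm_minus_cancel norm_one)
  then show False using norm_perturbation_le[OF assms, of n k t y] assms by simp
qed

lemma continuous_on_perturbation: "continuous_on S (\<lambda>x. perturbation n k a (fst x) (snd x))"
  unfolding perturbation_def by (intro continuous_intros)

lemma continuous_on_perturbation_powr:
  assumes "0 < a" "a \<le> 1/8"
  shows "continuous_on UNIV (\<lambda>x. norm (1 + perturbation n k a (fst x) (snd x)) powr p)"
  by (intro continuous_intros continuous_on_perturbation) (simp_all add: one_plus_perturbation_nonzero[OF assms])

lemma perturbation_in_trig_span: "perturbation n k a \<in> trig_span"
proof -
  have "(\<lambda>t y. of_real a * ex (of_int 0 * t + of_int 1 * y) +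
     of_real (a ^ Suc k) * ex (of_int (int n) * t + of_int (int k) * y)) \<in> trig_span"
    by (intro trig_span.add trig_span.scale trig_span.monomial)
  also have "(\<lambda>t y. of_real a * ex (of_int 0 * t + of_int 1 * y) +
     of_real (a ^ Suc k) * ex (of_int (int n) * t + of_int (int k) * y)) = perturbation n k a"
    by (intro ext) (simp add: perturbation_def)
  finally show ?thesis .
qed

text \<open>|1 + z|^p is a uniform limit of P(z) times its conjugate with P a truncated binomial
  series, and such products of trigonometric polynomials stay in \<open>trig_span\<close>. Since |z|
  is at most 1/4, the truncation error decays like 2^(-K).\<close>

lemma equidistributed_perturbation:
  assumes a: "0 < a" "a \<le> 1/8"
  shows "equidistributed (\<lambda>t y. of_real (norm (1 + perturbation n k a t y) powr p))"
proof (rule equidistributed_uniform_limit)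
  show "continuous_on UNIV (\<lambda>x. complex_of_real (norm (1 + perturbation n k a (fst x) (snd x)) powr p))"
    by (intro continuous_on_of_real continuous_on_perturbation_powr a)
next
  fix \<eta> :: real assume \<eta>: "\<eta> > 0"
  from binom_poly_approx[of "p/2"] obtain C where C: "C \<ge> 0"
    "\<And>K z. norm z \<le> 1/2 \<Longrightarrow>
       norm ((1 + z) powr of_real (p/2) - poly (binom_poly (p/2) K) z) \<le> C * (2 * norm z) ^ Suc K"
    "\<And>K z. norm z \<le> 1/2 \<Longrightarrow> norm (poly (binom_poly (p/2) K) z) \<le> C"
    "\<And>z :: complex. norm z \<le> 1/2 \<Longrightarrow> norm ((1 + z) powr of_real (p/2)) \<le> C" by blast
  have "(\<lambda>K. 2 * C * (C * (1/2) ^ Suc K)) \<longlonglongrightarrow> 2 * C * (C * 0)"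
    by (intro tendsto_intros LIMSEQ_Suc LIMSEQ_power_zero) simp
  then have "\<forall>\<^sub>F K in sequentially. 2 * C * (C * (1/2) ^ Suc K) < \<eta>"
    using \<eta> by (intro order_tendstoD(2)) auto
  then obtain K where K: "2 * C * (C * (1/2) ^ Suc K) < \<eta>"
    by (auto simp: eventually_sequentially)
  define P where "P = binom_poly (p/2) K"
  show "\<exists>f\<in>trig_span. \<forall>t y. norm (complex_of_real (norm (1 + perturbation n k a t y) powr p) - f t y) \<le> \<eta>"
  proof (intro bexI allI)
    show "(\<lambda>t y. poly P (perturbation n k a t y) * cnj (poly P (perturbation n k a t y))) \<in> trig_span"
      by (intro trig_span_mult trig_span_cnj trig_span_poly perturbation_in_trig_span)
    fix t y
    define z where "z = perturbation n k a t y"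
    have z: "norm z \<le> 1/4" using norm_perturbation_le[OF a, of n k t y] a by (simp add: z_def)
    have "norm (complex_of_real (norm (1 + z) powr p) - poly P z * cnj (poly P z)) =
       \<bar>(norm ((1 + z) powr complex_of_real (p / 2)))\<^sup>2 - (norm (poly P z))\<^sup>2\<bar>"
      unfolding norm_powr_eq_square complex_norm_square[symmetric]
      by (metis norm_of_real of_real_diff of_real_power)
    also have "\<dots> \<le> 2 * C * norm ((1 + z) powr complex_of_real (p / 2) - poly P z)"
      using z by (intro norm_square_diff_le C) (auto simp: P_def C)
    also have "\<dots> \<le> 2 * C * (C * (2 * norm z) ^ Suc K)"
      using z C(1) unfolding P_def by (intro mult_left_mono C) auto
    also have "\<dots> \<le> 2 * C * (C * (1/2) ^ Suc K)"
      using z C(1) by (intro mult_left_mono power_mono) auto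
    finally show "norm (complex_of_real (norm (1 + perturbation n k a t y) powr p) -
         poly P (perturbation n k a t y) * cnj (poly P (perturbation n k a t y))) \<le> \<eta>"
      using K unfolding z_def by linarith
  qed
qed

lemma poly_bounded_unit_disc:
  fixes q :: "complex poly"
  obtains E where "E \<ge> 0" "\<And>z. norm z \<le> 1 \<Longrightarrow> norm (poly q z) \<le> E"
proof -
  have "norm (poly q z) \<le> (\<Sum>i\<le>degree q. norm (coeff q i))" if "norm z \<le> 1" for z
    unfolding poly_altdef
    using that by (intro sum_norm_le) (auto simp: norm_mult norm_power power_le_one mult_left_le)
  then show thesis by (intro that[of "\<Sum>i\<le>degree q. norm (coeff q i)"]) (auto intro: sum_nonneg)
qed

text \<open>Taylor's formula by Horner recursion: the second-order remainder of a + z q(z) is (z +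
  h) times that of q plus h^2 q'(z), and |z + h| is at most 2.\<close>

lemma poly_second_order_bound:
  fixes q :: "complex poly"
  shows "\<exists>D\<ge>0. \<forall>z h. norm z \<le> 1 \<longrightarrow> norm h \<le> 1 \<longrightarrow>
    norm (poly q (z + h) - poly q z - h * poly (pderiv q) z) \<le> D * (norm h)\<^sup>2"
proof (induction q)
  case 0
  then show ?case by (auto intro!: exI[of _ 0])
next
  case (pCons a q)
  then obtain D where D: "D \<ge> 0" "\<And>z h. norm z \<le> 1 \<Longrightarrow> norm h \<le> 1 \<Longrightarrow>
    norm (poly q (z + h) - poly q z - h * poly (pderiv q) z) \<le> D * (norm h)\<^sup>2" by blast
  obtain E where E: "E \<ge> 0" "\<And>z. norm z \<le> 1 \<Longrightarrow> norm (poly (pderiv q) z) \<le> E"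
    using poly_bounded_unit_disc by blast
  show ?case
  proof (intro exI[of _ "2 * D + E"] conjI allI impI)
    show "2 * D + E \<ge> 0" using D E by simp
    fix z h :: complex assume zh: "norm z \<le> 1" "norm h \<le> 1"
    have "poly (pCons a q) (z + h) - poly (pCons a q) z - h * poly (pderiv (pCons a q)) z =
       (z + h) * (poly q (z + h) - poly q z - h * poly (pderiv q) z) + h\<^sup>2 * poly (pderiv q) z"
      by (simp add: pderiv_pCons algebra_simps power2_eq_square)
    also have "norm \<dots> \<le> 2 * (D * (norm h)\<^sup>2) + (norm h)\<^sup>2 * E"
    proof (intro norm_triangle_le add_mono)
      show "norm ((z + h) * (poly q (z + h) - poly q z - h * poly (pderiv q) z)) \<le> 2 * (D * (norm h)\<^sup>2)"
        unfolding norm_mult using zh norm_triangle_ineq[of z h]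
        by (intro mult_mono D) auto
      show "norm (h\<^sup>2 * poly (pderiv q) z) \<le> (norm h)\<^sup>2 * E"
        unfolding norm_mult norm_power using zh by (intro mult_left_mono E) auto
    qed
    finally show "norm (poly (pCons a q) (z + h) - poly (pCons a q) z - h * poly (pderiv (pCons a q)) z)
      \<le> (2 * D + E) * (norm h)\<^sup>2" by (simp add: algebra_simps)
  qed
qed

text \<open>Both powers are replaced by |P|^2 and P(w + h) is expanded to first order in h. The
  first-order term is then turned into an analytic polynomial in e(y), so that its mean is a value
  at 0; everything else is of order a^(2k+2), uniformly in n and t.\<close>

lemma factor_mean_expansion:
  fixes p :: real and k :: nat
  obtains C where "C \<ge> 0" "\<And>a n t. 0 < a \<Longrightarrow> a \<le> 1/8 \<Longrightarrow>
    \<bar>factor_mean p n k a t - (LINT y|unit_meas. norm (1 + of_real a * ex y) powr p) -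
      p * (p/2 gchoose k) * a ^ (2 * k + 1) * cos (2 * pi * real n * t)\<bar> \<le> C * a ^ (2 * k + 2)"
proof -
  define s where "s = p / 2"
  \<comment> \<open>Degree 2k + 1 leaves a remainder of order a^(2k+2). \<open>Q\<close> stops at
    degree k so that e(ky) times the conjugate of Q(a e(y)) has no negative power of e(y); the
    omitted terms have order a^(k+1) and are multiplied by h, which has the same order.\<close>
  define P where "P = binom_poly s (2 * k + 1)"
  define Q where "Q = binom_poly s k"
  from binom_poly_approx[of s] obtain C where C: "C \<ge> 0"
    "\<And>K z. norm z \<le> 1/2 \<Longrightarrow>
       norm ((1 + z) powr of_real s - poly (binom_poly s K) z) \<le> C * (2 * norm z) ^ Suc K"
    "\<And>K z. norm z \<le> 1/2 \<Longrightarrow> norm (poly (binom_poly s K) z) \<le> C"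
    "\<And>z :: complex. norm z \<le> 1/2 \<Longrightarrow> norm ((1 + z) powr of_real s) \<le> C" by blast
  obtain D where D: "D \<ge> 0" "\<And>z h. norm z \<le> 1 \<Longrightarrow> norm h \<le> 1 \<Longrightarrow>
    norm (poly P (z + h) - poly P z - h * poly (pderiv P) z) \<le> D * (norm h)\<^sup>2"
    using poly_second_order_bound by blast
  obtain E where E: "E \<ge> 0" "\<And>z. norm z \<le> 1 \<Longrightarrow> norm (poly (pderiv P) z) \<le> E"
    using poly_bounded_unit_disc by blast
  \<comment> \<open>The sum of the bounds 1 to 5 below: passing to |P|^2 at w + h and at w (together
    the factor 4), the Taylor remainder against P(w), the square of the whole increment, and the
    exchange of P for Q under the conjugate.\<close>
  define F where "F = 4 * C\<^sup>2 * 4 ^ (2 * k + 2) + 2 * C * D + (E + D)\<^sup>2 + 4 * C * 2 ^ Suc k * E"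
  have PH: "\<bar>norm (1 + z) powr p - (norm (poly P z))\<^sup>2\<bar> \<le> 2 * C\<^sup>2 * 4 ^ (2 * k + 2) * a ^ (2 * k + 2)"
    if "norm z \<le> 2 * a" "0 < a" "a \<le> 1/8" for z a
  proof -
    have z: "norm z \<le> 1/2" using that by simp
    have "\<bar>norm (1 + z) powr p - (norm (poly P z))\<^sup>2\<bar> \<le>
       2 * C * norm ((1 + z) powr complex_of_real s - poly P z)"
      unfolding norm_powr_eq_square s_def[symmetric] using z by (intro norm_square_diff_le) (auto simp: P_def C)
    also have "\<dots> \<le> 2 * C * (C * (2 * norm z) ^ Suc (2 * k + 1))"
      using z C(1) unfolding P_def by (intro mult_left_mono C) auto
    also have "\<dots> \<le> 2 * C * (C * (4 * a) ^ Suc (2 * k + 1))"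
      using that C(1) by (intro mult_left_mono power_mono) auto
    finally show ?thesis by (simp add: power2_eq_square power_mult_distrib mult_ac)
  qed
  have PQ: "norm (poly P z - poly Q z) \<le> 2 * C * (2 * norm z) ^ Suc k" if "norm z \<le> 1/2" for z
  proof -
    have "norm (poly P z - poly Q z) \<le> norm ((1 + z) powr of_real s - poly P z) + norm ((1 + z) powr of_real s - poly Q z)"
      by norm
    also have "\<dots> \<le> C * (2 * norm z) ^ Suc (2 * k + 1) + C * (2 * norm z) ^ Suc k"
      unfolding P_def Q_def by (intro add_mono C that)
    also have "C * (2 * norm z) ^ Suc (2 * k + 1) \<le> C * (2 * norm z) ^ Suc k"
      using that C(1) by (intro mult_left_mono power_decreasing) auto
    finally show ?thesis by linarith
  qed
  show thesis
  proof (rule that[of F])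
    show "F \<ge> 0" unfolding F_def using C(1) D(1) E(1) by (intro add_nonneg_nonneg mult_nonneg_nonneg) auto
    fix a :: real and n :: nat and t :: real
    assume a: "0 < a" "a \<le> 1/8"
    \<comment> \<open>On the circle the conjugate of z is 1/z, so the sum equals z^k times the
      conjugate of Q(a z); the second factor is P'(a z).\<close>
    define r where "r = (\<Sum>j\<le>k. monom (of_real ((s gchoose j) * a ^ j)) (k - j)) *
        pcompose (pderiv P) [:0, of_real a:]"
    define v where "v = ex (real n * t)"
    have r_ex: "poly r (ex y) = cnj (poly Q (of_real a * ex y)) * ex y ^ k * poly (pderiv P) (of_real a * ex y)" for y
    proof -
      have "cnj (ex y) ^ j * ex y ^ k = ex y ^ (k - j)" if "j \<le> k" for j
      proof -
        have "ex y ^ k = ex y ^ j * ex y ^ (k - j)" using that by (simp flip: power_add)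
        then show ?thesis by (simp add: cnj_ex ex_minus_mult flip: power_mult_distrib mult.assoc)
      qed
      then have "(\<Sum>j\<le>k. of_real ((s gchoose j) * a ^ j) * ex y ^ (k - j)) =
         cnj (poly Q (of_real a * ex y)) * ex y ^ k"
        by (simp add: Q_def poly_binom_poly sum_distrib_right power_mult_distrib mult.assoc)
      then show ?thesis
        by (simp add: r_def poly_sum poly_monom poly_pcompose mult_ac del: of_real_mult of_real_power)
    qed
    \<comment> \<open>At 0 only j = k survives in the sum, and P'(0) is the linear coefficient
      s.\<close>
    have r0: "poly r 0 = of_real (s * (s gchoose k) * a ^ k)"
    proof -
      have "(\<Sum>j\<le>k. of_real ((s gchoose j) * a ^ j) * 0 ^ (k - j)) =
         (\<Sum>j\<le>k. if j = k then complex_of_real ((s gchoose k) * a ^ k) else 0)"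
        by (intro sum.cong) auto
      also have "\<dots> = of_real ((s gchoose k) * a ^ k)" by simp
      finally have 1: "(\<Sum>j\<le>k. of_real ((s gchoose j) * a ^ j) * 0 ^ (k - j)) = complex_of_real ((s gchoose k) * a ^ k)" .
      have "poly (pderiv P) 0 = coeff P 1" by (simp add: poly_0_coeff_0 coeff_pderiv)
      also have "\<dots> = (\<Sum>j\<le>2 * k + 1. if j = 1 then of_real (s gchoose 1) else 0)"
        unfolding P_def binom_poly_def coeff_sum coeff_monom by (intro sum.cong) auto
      also have "\<dots> = of_real s" by simp
      finally show ?thesis using 1
        by (simp add: r_def poly_sum poly_monom poly_pcompose mult_ac)
    qed
    \<comment> \<open>The integral of \<open>g\<close> is the quantity to be bounded: the mean of
      the subtracted first-order term is exactly the cosine term of the claim.\<close>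
    define g where "g y = norm (1 + perturbation n k a t y) powr p - norm (1 + of_real a * ex y) powr p -
       2 * Re (of_real (a ^ Suc k) * v * poly r (ex y))" for y
    have g_le: "\<bar>g y\<bar> \<le> F * a ^ (2 * k + 2)" for y
    proof -
      define w where "w = of_real a * ex y"
      define h where "h = of_real (a ^ Suc k) * v * ex y ^ k"
      define \<rho> where "\<rho> = poly P (w + h) - poly P w - h * poly (pderiv P) w"
      have perturbation: "perturbation n k a t y = w + h"
        by (simp add: perturbation_def w_def h_def v_def ex_add ex_of_nat_mult)
      have nw: "norm w = a" using a by (simp add: w_def norm_mult)
      have nh: "norm h = a ^ Suc k" using a by (simp add: h_def v_def norm_mult norm_power)
      have h1: "norm h \<le> 1" unfolding nh using a by (intro power_le_one) auto
      have h2: "(norm h)\<^sup>2 = a ^ (2 * k + 2)" unfolding nh by (simp add: power2_eq_square mult_2 flip: power_add)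
      have w1: "norm w \<le> 1/2" "norm w \<le> 1" using a nw by auto
      have \<rho>: "norm \<rho> \<le> D * (norm h)\<^sup>2" unfolding \<rho>_def by (intro D w1 h1)
      have E1: "norm (poly (pderiv P) w) \<le> E" by (intro E w1)
      have Pw: "norm (poly P w) \<le> C" unfolding P_def by (intro C w1)
      have 1: "\<bar>norm (1 + (w + h)) powr p - (norm (poly P (w + h)))\<^sup>2\<bar> \<le> 2 * C\<^sup>2 * 4 ^ (2 * k + 2) * a ^ (2 * k + 2)"
        by (intro PH a) (use norm_perturbation_le[OF a, of n k t y] perturbation in simp)
      have 2: "\<bar>norm (1 + w) powr p - (norm (poly P w))\<^sup>2\<bar> \<le> 2 * C\<^sup>2 * 4 ^ (2 * k + 2) * a ^ (2 * k + 2)"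
        by (intro PH a) (use nw a in simp)
      have eq: "(norm (poly P (w + h)))\<^sup>2 = (norm (poly P w))\<^sup>2 + 2 * Re (cnj (poly P w) * (h * poly (pderiv P) w))
          + 2 * Re (cnj (poly P w) * \<rho>) + (norm (h * poly (pderiv P) w + \<rho>))\<^sup>2"
      proof -
        have sq: "(norm (x + y))\<^sup>2 = (norm x)\<^sup>2 + 2 * Re (cnj x * y) + (norm y)\<^sup>2" for x y :: complex
          unfolding cmod_power2 by (simp add: power2_eq_square algebra_simps)
        have "poly P (w + h) = poly P w + (h * poly (pderiv P) w + \<rho>)" by (simp add: \<rho>_def)
        then show ?thesis by (simp only: sq distrib_left plus_complex.sel)
      qed
      have 3: "\<bar>2 * Re (cnj (poly P w) * \<rho>)\<bar> \<le> 2 * C * D * a ^ (2 * k + 2)"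
      proof -
        have "\<bar>Re (cnj (poly P w) * \<rho>)\<bar> \<le> norm (cnj (poly P w) * \<rho>)" by (rule abs_Re_le_cmod)
        also have "\<dots> \<le> C * (D * (norm h)\<^sup>2)"
          unfolding norm_mult complex_mod_cnj by (intro mult_mono Pw \<rho>) (auto simp: C)
        finally show ?thesis by (simp add: h2 abs_mult)
      qed
      have 4: "(norm (h * poly (pderiv P) w + \<rho>))\<^sup>2 \<le> (E + D)\<^sup>2 * a ^ (2 * k + 2)"
      proof -
        have "norm (h * poly (pderiv P) w + \<rho>) \<le> norm h * E + D * (norm h)\<^sup>2"
          unfolding norm_mult by (intro norm_triangle_le add_mono \<rho>)
             (auto simp: norm_mult intro!: mult_left_mono E1)
        moreover have "D * (norm h)\<^sup>2 \<le> D * norm h"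
          using h1 D(1) by (intro mult_left_mono) (simp_all add: power2_eq_square mult_left_le)
        ultimately have "norm (h * poly (pderiv P) w + \<rho>) \<le> (E + D) * norm h"
          by (simp add: algebra_simps)
        then have "(norm (h * poly (pderiv P) w + \<rho>))\<^sup>2 \<le> ((E + D) * norm h)\<^sup>2" by (intro power_mono) auto
        then show ?thesis by (simp only: power_mult_distrib h2)
      qed
      have 5: "\<bar>2 * Re (cnj (poly P w) * (h * poly (pderiv P) w)) - 2 * Re (of_real (a ^ Suc k) * v * poly r (ex y))\<bar>
          \<le> 4 * C * 2 ^ Suc k * E * a ^ (2 * k + 2)"
      proof -
        have "of_real (a ^ Suc k) * v * poly r (ex y) = cnj (poly Q w) * (h * poly (pderiv P) w)"
          by (simp add: r_ex h_def w_def mult_ac)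
        then have "2 * Re (cnj (poly P w) * (h * poly (pderiv P) w)) - 2 * Re (of_real (a ^ Suc k) * v * poly r (ex y))
          = 2 * Re (cnj (poly P w - poly Q w) * (h * poly (pderiv P) w))"
          by (simp only: complex_cnj_diff left_diff_distrib minus_complex.sel) simp
        also have "\<bar>\<dots>\<bar> \<le> 2 * norm (cnj (poly P w - poly Q w) * (h * poly (pderiv P) w))"
          using abs_Re_le_cmod[of "cnj (poly P w - poly Q w) * (h * poly (pderiv P) w)"] by (simp only: abs_mult)
        also have "\<dots> \<le> 2 * ((2 * C * (2 * norm w) ^ Suc k) * (norm h * E))"
          unfolding norm_mult complex_mod_cnj using C(1)
          by (intro mult_left_mono mult_mono PQ w1 E1) auto
        also have "\<dots> = 4 * C * 2 ^ Suc k * E * a ^ (2 * k + 2)"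
        proof -
          have "(2 * norm w) ^ Suc k = 2 ^ Suc k * norm h" unfolding nw nh by (rule power_mult_distrib)
          then show ?thesis using h2 by (simp add: power2_eq_square del: power_Suc)
        qed
        finally show ?thesis .
      qed
      show ?thesis
        unfolding g_def perturbation w_def[symmetric] F_def
        using 1 2 3 4 5 eq zero_le_power2[of "norm (h * poly (pderiv P) w + \<rho>)"]
        unfolding distrib_right by linarith
    qed
    have cont: "continuous_on {0..1} (\<lambda>y. norm (1 + perturbation n k a t y) powr p)"
      by (rule continuous_on_section[OF continuous_on_perturbation_powr[OF a]]) (intro continuous_intros)+
    have ne: "1 + of_real a * ex y \<noteq> 0" for y
    proof
      assume "1 + of_real a * ex y = 0"
      then have "norm (of_real a * ex y) = 1" by (metis add_eq_0_iff norm_minus_cancel norm_one)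
      then show False using a by (simp add: norm_mult)
    qed
    have cont2: "continuous_on {0..1} (\<lambda>y. norm (1 + of_real a * ex y) powr p)"
      by (intro continuous_intros) (simp_all add: ne)
    have cont3: "continuous_on {0..1} (\<lambda>y. of_real (a ^ Suc k) * v * poly r (ex y))"
      by (intro continuous_intros)
    have "(LINT y|unit_meas. g y) = factor_mean p n k a t - (LINT y|unit_meas. norm (1 + of_real a * ex y) powr p) -
      (LINT y|unit_meas. 2 * Re (of_real (a ^ Suc k) * v * poly r (ex y)))"
      unfolding g_def factor_mean_def
      using bdd_meas_integrable[OF bdd_meas_continuous[OF cont]] bdd_meas_integrable[OF bdd_meas_continuous[OF cont2]]
        bdd_meas_integrable[OF bdd_meas_continuous[OF cont3]]
      by (simp add: integrable_Re del: times_complex.sel)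
    also have "(LINT y|unit_meas. 2 * Re (of_real (a ^ Suc k) * v * poly r (ex y))) =
       2 * Re (of_real (a ^ Suc k) * v * poly r 0)"
      using bdd_meas_integrable[OF bdd_meas_continuous[OF cont3]]
      by (simp add: integral_Re integral_poly_ex del: times_complex.sel)
    also have "\<dots> = p * (p/2 gchoose k) * a ^ (2 * k + 1) * cos (2 * pi * real n * t)"
    proof -
      have "a ^ Suc k * a ^ k = a ^ (2 * k + 1)" by (simp add: mult_2 flip: power_add)
      then have "of_real (a ^ Suc k) * v * poly r 0 = of_real (s * (s gchoose k) * a ^ (2 * k + 1)) * v"
        unfolding r0 by (metis (no_types, opaque_lifting) mult.commute mult.left_commute of_real_mult)
      moreover have "Re (of_real x * v) = x * Re v" for x by simp
      ultimately show ?thesis by (simp only:) (simp add: v_def Re_ex s_def mult.assoc)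
    qed
    finally have "factor_mean p n k a t - (LINT y|unit_meas. norm (1 + of_real a * ex y) powr p) -
      p * (p/2 gchoose k) * a ^ (2 * k + 1) * cos (2 * pi * real n * t) = (LINT y|unit_meas. g y)" by simp
    also have "\<bar>\<dots>\<bar> \<le> F * a ^ (2 * k + 2)"
    proof -
      have "continuous_on {0..1} g" unfolding g_def[abs_def]
        by (intro continuous_intros cont cont2)
      from norm_integral_unit_meas_le[OF bdd_meas_measurable[OF bdd_meas_continuous[OF this]], of "F * a ^ (2 * k + 2)"] g_le
      show ?thesis by simp
    qed
    finally show "\<bar>factor_mean p n k a t - (LINT y|unit_meas. norm (1 + of_real a * ex y) powr p) -
      p * (p/2 gchoose k) * a ^ (2 * k + 1) * cos (2 * pi * real n * t)\<bar> \<le> F * a ^ (2 * k + 2)" .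
  qed
qed


lemma gbinomial_Suc_quotient:
  fixes s :: real
  shows "s gchoose Suc k = (s gchoose k) * (s - real k) / (real k + 1)"
  by (simp add: gbinomial_prod_rev field_simps)

text \<open>No C(s,k) vanishes, and C(s,k+1) / C(s,k) = (s - k) / (k + 1) is negative once k > s, so
  two consecutive coefficients have opposite signs. Starting at m + 2 ensures that both indices are
  at least 2.\<close>

lemma gbinomial_both_signs:
  fixes s :: real
  assumes "\<And>n::nat. s \<noteq> real n"
  shows "\<exists>k\<ge>2. s gchoose k > 0" "\<exists>k\<ge>2. s gchoose k < 0"
proof -
  have nz: "s gchoose k \<noteq> 0" for k
    by (induction k) (use assms in \<open>simp_all add: gbinomial_Suc_quotient\<close>)
  obtain m where m: "s < real m" using reals_Archimedean2 by blast
  have "s - real (m + 2) < 0" using m by simp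
  then have flip: "(s gchoose Suc (m + 2)) * (s gchoose (m + 2)) < 0"
    using nz[of "m + 2"] unfolding gbinomial_Suc_quotient[of s "m + 2"]
    by (auto simp: divide_less_0_iff mult_less_0_iff zero_less_mult_iff linorder_neq_iff)
  then have "(s gchoose Suc (m + 2) > 0 \<and> s gchoose (m + 2) < 0) \<or> (s gchoose Suc (m + 2) < 0 \<and> s gchoose (m + 2) > 0)"
    by (auto simp: mult_less_0_iff)
  moreover have "Suc (m + 2) \<ge> 2" "m + 2 \<ge> 2" by auto
  ultimately show "\<exists>k\<ge>2. s gchoose k > 0" "\<exists>k\<ge>2. s gchoose k < 0" by blast+
qed

lemma unperturbed_mean_bounds:
  fixes p :: real
  assumes "p > 0" "0 < a" "a \<le> 1/8"
  shows "(1/2) powr p \<le> (LINT y|unit_meas. norm (1 + of_real a * ex y) powr p)"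
    "(LINT y|unit_meas. norm (1 + of_real a * ex y) powr p) \<le> 2 powr p"
proof -
  have b: "1/2 \<le> norm (1 + of_real a * ex y)" "norm (1 + of_real a * ex y) \<le> 2" for y
  proof -
    have "norm (of_real a * ex y) = a" using assms by (simp add: norm_mult)
    then show "1/2 \<le> norm (1 + of_real a * ex y)" "norm (1 + of_real a * ex y) \<le> 2"
      using norm_triangle_ineq[of 1 "of_real a * ex y"] norm_diff_ineq[of 1 "of_real a * ex y"] assms by auto
  qed
  have ne: "1 + of_real a * ex y \<noteq> 0" for y using b(1)[of y] by auto
  have int: "integrable unit_meas (\<lambda>y. norm (1 + of_real a * ex y) powr p)"
    by (intro bdd_meas_integrable bdd_meas_continuous continuous_intros) (simp_all add: ne)
  have "(LINT y|unit_meas. (1/2) powr p) \<le> (LINT y|unit_meas. norm (1 + of_real a * ex y) powr p)"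
    by (intro integral_mono int powr_mono2) (use assms b in auto)
  then show "(1/2) powr p \<le> (LINT y|unit_meas. norm (1 + of_real a * ex y) powr p)"
    by (simp add: measure_unit_meas)
  have "(LINT y|unit_meas. norm (1 + of_real a * ex y) powr p) \<le> (LINT y|unit_meas. 2 powr p)"
    by (intro integral_mono int powr_mono2) (use assms b in auto)
  then show "(LINT y|unit_meas. norm (1 + of_real a * ex y) powr p) \<le> 2 powr p"
    by (simp add: measure_unit_meas)
qed

lemma factor_mean_pos:
  assumes "0 < a" "a \<le> 1/8"
  shows "factor_mean p n k a t > 0"
proof -
  have cont: "continuous_on {0..1} (\<lambda>y. norm (1 + perturbation n k a t y) powr p)"
    by (rule continuous_on_section[OF continuous_on_perturbation_powr[OF assms]]) (intro continuous_intros)+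
  obtain y0 where y0: "\<forall>y\<in>{0..1}. norm (1 + perturbation n k a t y0) powr p \<le> norm (1 + perturbation n k a t y) powr p"
    using continuous_attains_inf[OF compact_Icc _ cont] by auto
  have "0 < norm (1 + perturbation n k a t y0) powr p"
    using one_plus_perturbation_nonzero[OF assms] by simp
  also have "\<dots> = (LINT y|unit_meas. norm (1 + perturbation n k a t y0) powr p)"
    by (simp add: measure_unit_meas)
  also have "\<dots> \<le> factor_mean p n k a t" unfolding factor_mean_def
    by (intro integral_mono bdd_meas_integrable bdd_meas_const bdd_meas_continuous cont) (use y0 in auto)
  finally show ?thesis .
qed

text \<open>The factor is repeated about tau A / (beta a^(2k+1)) times; each copy contributes an error
  O(a^(2k+2)), so the total error is O(a).\<close>

lemma log_factor_mean_approx_cos: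
  fixes p \<tau> \<eta> :: real
  assumes p: "p > 0" and ne: "p/2 gchoose k \<noteq> 0" and sgn: "\<tau> * (p/2 gchoose k) \<ge> 0" and \<eta>: "\<eta> > 0"
  obtains a c and N :: nat where "0 < a" "a \<le> 1/8"
    "\<And>t. \<bar>real N * ln (factor_mean p n k a t) - c - \<tau> * cos (2 * pi * real n * t)\<bar> \<le> \<eta>"
proof -
  define \<beta> where "\<beta> = p * (p/2 gchoose k)"
  have \<beta>0: "\<beta> \<noteq> 0" and \<tau>\<beta>: "\<tau> / \<beta> \<ge> 0"
    using p ne sgn by (auto simp: \<beta>_def zero_le_divide_iff zero_le_mult_iff mult_le_0_iff)
  define l u where "l = (1/2::real) powr p" and "u = (2::real) powr p"
  have l: "l > 0" and u: "u > 0" by (auto simp: l_def u_def)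
  obtain C where C: "C \<ge> 0" "\<And>a n t. 0 < a \<Longrightarrow> a \<le> 1/8 \<Longrightarrow>
    \<bar>factor_mean p n k a t - (LINT y|unit_meas. norm (1 + of_real a * ex y) powr p) -
      \<beta> * a ^ (2 * k + 1) * cos (2 * pi * real n * t)\<bar> \<le> C * a ^ (2 * k + 2)"
    unfolding \<beta>_def using factor_mean_expansion[of p k] by blast
  \<comment> \<open>With X = a^(2k+1) and y the relative deviation of the factor mean from A, these
    constants give |y| at most \<kappa> X, an error \<kappa>2 X a for the logarithm of one factor,
    and a total error \<kappa>3 a.\<close>
  define \<kappa> where "\<kappa> = (\<bar>\<beta>\<bar> + C) / l"
  define \<kappa>2 where "\<kappa>2 = C / l + 2 * \<kappa>\<^sup>2"
  define \<kappa>3 where "\<kappa>3 = \<tau> / \<beta> * u * \<kappa>2 + \<bar>\<beta>\<bar> / l"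
  have \<kappa>: "\<kappa> \<ge> 0" and \<kappa>2: "\<kappa>2 \<ge> 0" using C(1) l by (auto simp: \<kappa>_def \<kappa>2_def)
  have \<kappa>3: "\<kappa>3 \<ge> 0" unfolding \<kappa>3_def using \<tau>\<beta> u \<kappa>2 l
    by (intro add_nonneg_nonneg mult_nonneg_nonneg) auto
  \<comment> \<open>The three bounds keep the expansion valid, make the total error at most \<eta>,
    and force |y| to be at most 1/2 for the quadratic estimate of ln(1 + y).\<close>
  define a where "a = min (1/8) (min (\<eta> / (\<kappa>3 + 1)) (1 / (2 * \<kappa> + 1)))"
  have a: "0 < a" using \<eta> \<kappa> \<kappa>3 by (simp add: a_def)
  have a8: "a \<le> 1/8" unfolding a_def by (rule min.cobounded1)
  note a = a a8
  have a3: "\<kappa>3 * a \<le> \<eta>"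
  proof -
    have "a \<le> \<eta> / (\<kappa>3 + 1)" by (simp add: a_def)
    then have "a * (\<kappa>3 + 1) \<le> \<eta>" using \<kappa>3 by (simp add: pos_le_divide_eq)
    then show ?thesis using a by (simp add: algebra_simps)
  qed
  have a\<kappa>: "\<kappa> * a \<le> 1/2"
  proof -
    have "a \<le> 1 / (2 * \<kappa> + 1)" by (simp add: a_def)
    then have "a * (2 * \<kappa> + 1) \<le> 1" using \<kappa> by (simp add: pos_le_divide_eq)
    then show ?thesis using a by (simp add: algebra_simps)
  qed
  define X where "X = a ^ (2 * k + 1)"
  have X: "0 < X" "X \<le> a" using a power_decreasing[of 1 "2 * k + 1" a] by (auto simp: X_def)
  have X2: "a ^ (2 * k + 2) = X * a" by (simp add: X_def)
  define A where "A = (LINT y|unit_meas. norm (1 + of_real a * ex y) powr p)"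
  have A: "l \<le> A" "A \<le> u" using unperturbed_mean_bounds[OF p a] by (auto simp: A_def l_def u_def)
  have A0: "A > 0" using A l by linarith
  \<comment> \<open>The ideal real number of copies; it is nonnegative because \<tau> and the
    binomial coefficient agree in sign. Rounding down loses at most one copy, which contributes only
    O(X).\<close>
  define x where "x = \<tau> / \<beta> * A / X"
  have x: "x \<ge> 0" unfolding x_def
    by (rule divide_nonneg_pos[OF mult_nonneg_nonneg[OF \<tau>\<beta> less_imp_le[OF A0]] X(1)])
  define N where "N = nat \<lfloor>x\<rfloor>"
  have N: "real N \<le> x" "x - real N \<le> 1" using x by (auto simp: N_def) linarith+
  have "\<bar>real N * ln (factor_mean p n k a t) - real N * ln A - \<tau> * cos (2 * pi * real n * t)\<bar> \<le> \<eta>" for t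
  proof -
    define co where "co = cos (2 * pi * real n * t)"
    have co: "\<bar>co\<bar> \<le> 1" by (simp add: co_def)
    define y where "y = factor_mean p n k a t / A - 1"
    have Ay: "factor_mean p n k a t = A * (1 + y)" using A0 by (simp add: y_def)
    have "\<bar>A * y - \<beta> * X * co\<bar> \<le> C * (X * a)"
      using C(2)[OF a, of n t] unfolding Ay A_def[symmetric] X2 X_def[symmetric] co_def[symmetric]
      by (simp add: algebra_simps)
    then have "\<bar>A * (y - \<beta> / A * X * co)\<bar> \<le> C * (X * a)"
      using A0 by (simp add: algebra_simps)
    then have "A * \<bar>y - \<beta> / A * X * co\<bar> \<le> C * (X * a)"
      using A0 by (simp add: abs_mult)
    then have y1: "\<bar>y - \<beta> / A * X * co\<bar> \<le> C * (X * a) / A"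
      using A0 by (simp add: pos_le_divide_eq mult.commute)
    also have "\<dots> \<le> C * (X * a) / l"
      using A l C(1) X a by (intro divide_left_mono) auto
    finally have y1: "\<bar>y - \<beta> / A * X * co\<bar> \<le> C / l * X * a" by (simp add: mult.assoc)
    have y2: "\<bar>\<beta> / A * X * co\<bar> \<le> \<bar>\<beta>\<bar> / l * X"
    proof -
      have "\<bar>\<beta> / A * X * co\<bar> = \<bar>\<beta>\<bar> / A * X * \<bar>co\<bar>" using A0 X by (simp add: abs_mult)
      also have "\<dots> \<le> \<bar>\<beta>\<bar> / l * X * 1"
        using A l X co by (intro mult_mono divide_left_mono) auto
      finally show ?thesis by simp
    qed
    have "C / l * X * a \<le> C / l * X * 1" using a C(1) l X by (intro mult_left_mono) auto
    from order_trans[OF add_mono[OF y1 y2] add_right_mono[OF this]]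
    have "\<bar>y - \<beta> / A * X * co\<bar> + \<bar>\<beta> / A * X * co\<bar> \<le> \<kappa> * X"
      by (simp add: \<kappa>_def add_divide_distrib distrib_right)
    moreover have "\<bar>y\<bar> \<le> \<bar>y - b\<bar> + \<bar>b\<bar>" for b :: real by linarith
    ultimately have y3: "\<bar>y\<bar> \<le> \<kappa> * X" using order_trans by blast
    also have "\<dots> \<le> \<kappa> * a" using X \<kappa> by (intro mult_left_mono) auto
    finally have "\<bar>y\<bar> \<le> 1/2" using a\<kappa> by linarith
    from abs_ln_one_plus_x_minus_x_bound[OF this]
    have "\<bar>ln (1 + y) - y\<bar> \<le> 2 * y\<^sup>2" .
    also have "y\<^sup>2 \<le> (\<kappa> * X)\<^sup>2" using power_mono[OF y3, of 2] by simp
    also have "(\<kappa> * X)\<^sup>2 = \<kappa>\<^sup>2 * (X * X)" by (simp add: power2_eq_square)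
    also have "\<dots> \<le> \<kappa>\<^sup>2 * (X * a)" using X by (intro mult_left_mono) auto
    finally have l1: "\<bar>ln (1 + y) - y\<bar> \<le> 2 * \<kappa>\<^sup>2 * X * a" by simp
    have "1 + y > 0" using \<open>\<bar>y\<bar> \<le> 1/2\<close> by linarith
    then have lnf: "ln (factor_mean p n k a t) = ln A + ln (1 + y)" unfolding Ay using A0 by (simp add: ln_mult_pos)
    have l2: "\<bar>ln (1 + y) - \<beta> / A * X * co\<bar> \<le> \<kappa>2 * X * a"
      using l1 y1 unfolding \<kappa>2_def distrib_right by linarith
    have "\<bar>real N * (ln (1 + y) - \<beta> / A * X * co)\<bar> \<le> x * (\<kappa>2 * X * a)"
      unfolding abs_mult using N(1) x by (intro mult_mono l2) auto
    also have "\<dots> = \<tau> / \<beta> * A * \<kappa>2 * a" using X by (simp add: x_def)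
    also have "\<dots> \<le> \<tau> / \<beta> * u * \<kappa>2 * a"
      using \<tau>\<beta> A \<kappa>2 a by (intro mult_right_mono mult_left_mono) auto
    finally have e1: "\<bar>real N * (ln (1 + y) - \<beta> / A * X * co)\<bar> \<le> \<tau> / \<beta> * u * \<kappa>2 * a" .
    have "\<tau> = x * (\<beta> / A * X)" using X A0 \<beta>0 by (simp add: x_def)
    then have "\<tau> * co = x * (\<beta> / A * X * co)" by (simp only: mult.assoc)
    then have "real N * (\<beta> / A * X * co) - \<tau> * co = (real N - x) * (\<beta> / A * X * co)"
      by (simp only: left_diff_distrib)
    also have "\<bar>\<dots>\<bar> \<le> 1 * (\<bar>\<beta>\<bar> / l * X)"
      unfolding abs_mult[of "real N - x"] using N y2 by (intro mult_mono) auto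
    also have "\<dots> \<le> \<bar>\<beta>\<bar> / l * a" using X l by (simp add: divide_right_mono mult_left_mono)
    finally have e2: "\<bar>real N * (\<beta> / A * X * co) - \<tau> * co\<bar> \<le> \<bar>\<beta>\<bar> / l * a" .
    have "real N * ln (factor_mean p n k a t) - real N * ln A - \<tau> * co =
       real N * (ln (1 + y) - \<beta> / A * X * co) + (real N * (\<beta> / A * X * co) - \<tau> * co)"
      unfolding lnf by (simp add: algebra_simps)
    also have "\<bar>\<dots>\<bar> \<le> \<kappa>3 * a" 
      using order_trans[OF abs_triangle_ineq add_mono[OF e1 e2]] by (simp only: \<kappa>3_def distrib_right)
    finally show ?thesis using a3 unfolding co_def by linarith
  qed
  with a show thesis by (intro that)
qed

section \<open>Products of factors\<close>

definition gap_poly :: "nat \<Rightarrow> complex poly \<Rightarrow> bool" where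
  "gap_poly L f \<longleftrightarrow> (\<forall>i. coeff f i \<in> \<real>\<^sub>\<ge>\<^sub>0) \<and>
     (\<forall>i j. coeff f i \<noteq> 0 \<longrightarrow> coeff f j \<noteq> 0 \<longrightarrow> i < j \<longrightarrow> i + L \<le> j)"

lemma gap_poly_1: "gap_poly L 1"
  by (auto simp: gap_poly_def coeff_1 split: if_splits)

lemma gap_poly_smult:
  assumes "gap_poly L f" "c \<ge> 0"
  shows "gap_poly L (smult (of_real c) f)"
  using assms by (auto simp: gap_poly_def)

text \<open>The product consists of copies of F shifted by 0, m and n + km. As k is at least 2,
  different shifts are at least m apart, which exceeds the degree of F by L; so the copies do not
  overlap and keep the gap between them.\<close>

lemma gap_poly_mult_factor:
  assumes F: "gap_poly L F" and a: "a \<ge> 0" and k: "k \<ge> 2" and m: "m \<ge> degree F + L"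
  shows "gap_poly L (F * (1 + monom (of_real a) m + monom (of_real (a ^ Suc k)) (n + k * m)))"
    (is "gap_poly L ?G")
proof -
  define M where "M = n + k * m"
  have km: "2 * m \<le> k * m" using k by (rule mult_le_mono1)
  then have M: "M \<ge> m + m" unfolding M_def by linarith
  have co: "coeff ?G i = coeff F i + (if i < m then 0 else of_real a * coeff F (i - m)) +
      (if i < M then 0 else of_real (a ^ Suc k) * coeff F (i - M))" for i
    by (simp add: distrib_left mult.commute[of F] coeff_monom_mult M_def not_less)
  have nn: "coeff F i \<in> \<real>\<^sub>\<ge>\<^sub>0" for i using F by (simp add: gap_poly_def)
  have "coeff ?G i \<in> \<real>\<^sub>\<ge>\<^sub>0" for i
    unfolding co using nn a by (intro nonneg_Reals_add_I) (auto intro!: nonneg_Reals_mult_I nonneg_Reals_pow_I)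
  moreover have "i + L \<le> j" if ij: "coeff ?G i \<noteq> 0" "coeff ?G j \<noteq> 0" "i < j" for i j
  proof -
    have "\<exists>e\<in>{0, m, M}. e \<le> i \<and> coeff F (i - e) \<noteq> 0" if "coeff ?G i \<noteq> 0" for i
      using that unfolding co by (auto split: if_splits simp: not_less)
    then obtain e e' where e: "e \<in> {0, m, M}" "e \<le> i" "coeff F (i - e) \<noteq> 0"
      and e': "e' \<in> {0, m, M}" "e' \<le> j" "coeff F (j - e') \<noteq> 0" using ij(1,2) by metis
    have d: "i - e \<le> degree F" "j - e' \<le> degree F" using e(3) e'(3) by (auto intro: le_degree)
    consider "e = e'" | "e + m \<le> e'" | "e' + m \<le> e" using e(1) e'(1) M by auto
    then show ?thesis
    proof cases
      case 1
      then have "i - e < j - e'" using ij(3) e(2) by auto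
      then have "(i - e) + L \<le> j - e'" using F e(3) e'(3) by (auto simp: gap_poly_def)
      then show ?thesis using 1 e(2) e'(2) by auto
    next
      case 2
      then show ?thesis using d e(2) e'(2) m by auto
    next
      case 3
      then show ?thesis using d e(2) e'(2) m ij(3) by auto
    qed
  qed
  ultimately show ?thesis unfolding gap_poly_def by blast
qed

lemma poly_mult_factor_ex:
  "poly (F * (1 + monom (of_real a) m + monom (of_real (a ^ Suc k)) (n + k * m))) (ex t) =
     poly F (ex t) * (1 + perturbation n k a t (real m * t))"
proof -
  have "ex (real n * t + real k * (real m * t)) = ex t ^ (n + k * m)"
    using ex_of_nat_mult[of "n + k * m" t] by (simp add: algebra_simps)
  then show ?thesis
    by (simp add: poly_monom perturbation_def ex_of_nat_mult add.assoc)
qed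

type_synonym factor = "nat \<times> nat \<times> real"

definition admissible :: "factor list \<Rightarrow> bool" where
  "admissible fs \<longleftrightarrow> (\<forall>(n, k, a)\<in>set fs. k \<ge> 2 \<and> 0 < a \<and> a \<le> 1/8)"

text \<open>The p-th mean at t of the product of all factors when each has its own independent
  variable y.\<close>

definition factor_prod :: "real \<Rightarrow> factor list \<Rightarrow> real \<Rightarrow> real" where
  "factor_prod p fs t = (\<Prod>(n, k, a)\<leftarrow>fs. factor_mean p n k a t)"

definition factor_log :: "real \<Rightarrow> factor list \<Rightarrow> real \<Rightarrow> real" where
  "factor_log p fs t = (\<Sum>(n, k, a)\<leftarrow>fs. ln (factor_mean p n k a t))"

lemma factor_prod_eq_exp_factor_log: "admissible fs \<Longrightarrow> factor_prod p fs t = exp (factor_log p fs t)"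
  by (induction fs) (auto simp: admissible_def factor_prod_def factor_log_def exp_add factor_mean_pos)

lemma factor_log_append: "factor_log p (fs @ gs) t = factor_log p fs t + factor_log p gs t"
  by (simp add: factor_log_def)

lemma factor_log_replicate: "factor_log p (replicate N (n, k, a)) t = real N * ln (factor_mean p n k a t)"
  by (simp add: factor_log_def sum_list_replicate)

lemma continuous_on_factor_mean:
  assumes "0 < a" "a \<le> 1/8"
  shows "continuous_on S (factor_mean p n k a)"
  using continuous_on_mean[OF continuous_on_perturbation_powr[OF assms, of n k p], of S]
  unfolding factor_mean_def[abs_def] .

lemma continuous_on_factor_prod: "admissible fs \<Longrightarrow> continuous_on S (factor_prod p fs)"
proof (induction fs)
  case Nil
  then show ?case by (simp add: factor_prod_def[abs_def])
next
  case (Cons x fs)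
  obtain n k a where x: "x = (n, k, a)" by (cases x)
  have "continuous_on S (\<lambda>t. factor_mean p n k a t * factor_prod p fs t)"
    using Cons by (intro continuous_on_mult continuous_on_factor_mean) (auto simp: admissible_def x)
  then show ?case by (simp add: factor_prod_def[abs_def] x)
qed

lemma continuous_on_poly_powr:
  fixes p :: real
  assumes "p > 0"
  shows "continuous_on S (\<lambda>t. norm (poly F (ex t)) powr p)"
  using assms by (intro continuous_on_powr' continuous_intros) auto

text \<open>The mean of the new factor first joins the weight, and the induction hypothesis gives F
  for the remaining factors. Then |F|^p joins the weight, and a large m replaces the mean by the
  factor itself at y = mt. Each exchange costs \<eta>/2; the weight must therefore be arbitrary in
  the induction.\<close>

lemma realize_factor_prod:
  fixes p :: real and w :: "real \<Rightarrow> complex"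
  assumes p: "p > 0" and fs: "admissible fs" and w: "bdd_meas w" and \<eta>: "\<eta> > 0"
  shows "\<exists>F. gap_poly L F \<and>
    norm ((LINT t|unit_meas. w t * of_real (norm (poly F (ex t)) powr p)) -
          (LINT t|unit_meas. w t * of_real (factor_prod p fs t))) < \<eta>"
  using fs w \<eta>
proof (induction fs arbitrary: w \<eta>)
  case Nil
  then show ?case by (intro exI[of _ 1]) (simp add: gap_poly_1 factor_prod_def)
next
  case (Cons x fs)
  obtain n k a where x: "x = (n, k, a)" by (cases x)
  have a: "0 < a" "a \<le> 1/8" and k: "k \<ge> 2" and fs: "admissible fs"
    using Cons.prems by (auto simp: admissible_def x)
  have "bdd_meas (\<lambda>t. w t * of_real (factor_mean p n k a t))"
    by (intro bdd_meas_mult Cons.prems bdd_meas_of_real bdd_meas_continuous continuous_on_factor_mean a)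
  from Cons.IH[OF fs this, of "\<eta> / 2"] Cons.prems obtain F where F: "gap_poly L F"
    "norm ((LINT t|unit_meas. w t * of_real (factor_mean p n k a t) * of_real (norm (poly F (ex t)) powr p)) -
          (LINT t|unit_meas. w t * of_real (factor_mean p n k a t) * of_real (factor_prod p fs t))) < \<eta> / 2"
    by auto
  define v where "v t = w t * of_real (norm (poly F (ex t)) powr p)" for t
  have v: "bdd_meas v" unfolding v_def
    by (intro bdd_meas_mult Cons.prems bdd_meas_of_real bdd_meas_continuous continuous_on_poly_powr p)
  have "(\<lambda>m. LINT t|unit_meas. v t * of_real (norm (1 + perturbation n k a t (real m * t)) powr p)) \<longlonglongrightarrow>
     (LINT t|unit_meas. v t * (LINT y|unit_meas. of_real (norm (1 + perturbation n k a t y) powr p)))"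
    using equidistributed_perturbation[OF a, of n k p] v by (simp add: equidistributed_def)
  from LIMSEQ_D[OF this, of "\<eta> / 2"] Cons.prems obtain m0 where m0: "\<And>m. m \<ge> m0 \<Longrightarrow>
     norm ((LINT t|unit_meas. v t * of_real (norm (1 + perturbation n k a t (real m * t)) powr p)) -
     (LINT t|unit_meas. v t * (LINT y|unit_meas. of_real (norm (1 + perturbation n k a t y) powr p)))) < \<eta> / 2"
    by auto
  \<comment> \<open>Past m0 the equidistribution error is small; past degree F + L multiplication by
    the factor preserves the gaps.\<close>
  define m where "m = max m0 (degree F + L)"
  define G where "G = F * (1 + monom (of_real a) m + monom (of_real (a ^ Suc k)) (n + k * m))"
  have G: "gap_poly L G" unfolding G_def
    by (rule gap_poly_mult_factor[OF F(1) _ k]) (use a in \<open>auto simp: m_def\<close>)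
  have 1: "(LINT t|unit_meas. v t * of_real (norm (1 + perturbation n k a t (real m * t)) powr p)) =
     (LINT t|unit_meas. w t * of_real (norm (poly G (ex t)) powr p))"
    unfolding G_def poly_mult_factor_ex by (simp add: v_def norm_mult powr_mult mult.assoc)
  have 2: "(LINT t|unit_meas. v t * (LINT y|unit_meas. of_real (norm (1 + perturbation n k a t y) powr p))) =
     (LINT t|unit_meas. w t * of_real (factor_mean p n k a t) * of_real (norm (poly F (ex t)) powr p))"
    by (simp add: v_def factor_mean_def mult_ac)
  have 3: "(LINT t|unit_meas. w t * of_real (factor_mean p n k a t) * of_real (factor_prod p fs t)) =
     (LINT t|unit_meas. w t * of_real (factor_prod p (x # fs) t))"
    by (simp add: factor_prod_def x mult.assoc)
  have "norm ((LINT t|unit_meas. w t * of_real (norm (poly G (ex t)) powr p)) -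
     (LINT t|unit_meas. w t * of_real (factor_mean p n k a t) * of_real (norm (poly F (ex t)) powr p))) < \<eta> / 2"
    using m0[of m] unfolding 1 2 by (simp add: m_def)
  with F(2) have "norm ((LINT t|unit_meas. w t * of_real (norm (poly G (ex t)) powr p)) -
     (LINT t|unit_meas. w t * of_real (factor_prod p (x # fs) t))) < \<eta>"
    unfolding 3 by norm
  with G show ?case by blast
qed

text \<open>The constant c is free because it only multiplies the weight exp(T), and
  \<open>concentrating_poly\<close> normalises afterwards. The error is uniform in t.\<close>

definition log_realizable :: "real \<Rightarrow> (real \<Rightarrow> real) \<Rightarrow> bool" where
  "log_realizable p T \<longleftrightarrow> (\<forall>\<eta>>0. \<exists>fs c. admissible fs \<and> (\<forall>t. \<bar>factor_log p fs t - c - T t\<bar> \<le> \<eta>))"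

inductive_set cos_span :: "(real \<Rightarrow> real) set" where
  monomial: "(\<lambda>t. c * cos (2 * pi * real n * t)) \<in> cos_span"
| add: "f \<in> cos_span \<Longrightarrow> g \<in> cos_span \<Longrightarrow> (\<lambda>t. f t + g t) \<in> cos_span"

lemma cos_span_const: "(\<lambda>t. c) \<in> cos_span"
  using cos_span.monomial[of c 0] by simp

lemma cos_span_mult:
  assumes "f \<in> cos_span" "g \<in> cos_span"
  shows "(\<lambda>t. f t * g t) \<in> cos_span"
  using assms(1)
proof induction
  case (monomial c n)
  from assms(2) show ?case
  proof induction
    case (monomial d m)
    define l where "l = (if m \<le> n then n - m else m - n)"
    have l: "cos (2 * pi * real n * t - 2 * pi * real m * t) = cos (2 * pi * real l * t)" for t
    proof (cases "m \<le> n")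
      case True
      then show ?thesis by (simp add: l_def of_nat_diff algebra_simps)
    next
      case False
      then have "cos (2 * pi * real l * t) = cos (- (2 * pi * real n * t - 2 * pi * real m * t))"
        by (simp add: l_def of_nat_diff algebra_simps)
      then show ?thesis by (simp only: cos_minus)
    qed
    have s: "cos (2 * pi * real n * t + 2 * pi * real m * t) = cos (2 * pi * real (n + m) * t)" for t
      by (simp add: algebra_simps)
    have "(\<lambda>t. (c * cos (2 * pi * real n * t)) * (d * cos (2 * pi * real m * t))) =
       (\<lambda>t. c * d / 2 * cos (2 * pi * real l * t) + c * d / 2 * cos (2 * pi * real (n + m) * t))"
    proof
      fix t
      have "(c * cos (2 * pi * real n * t)) * (d * cos (2 * pi * real m * t)) =
         c * d * (cos (2 * pi * real n * t) * cos (2 * pi * real m * t))" by (simp add: mult_ac)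
      also have "\<dots> = c * d / 2 * cos (2 * pi * real l * t) + c * d / 2 * cos (2 * pi * real (n + m) * t)"
        unfolding cos_times_cos l s by (simp add: field_simps)
      finally show "(c * cos (2 * pi * real n * t)) * (d * cos (2 * pi * real m * t)) =
         c * d / 2 * cos (2 * pi * real l * t) + c * d / 2 * cos (2 * pi * real (n + m) * t)" .
    qed
    then show ?case by (simp only:) (intro cos_span.intros)
  next
    case (add f g)
    from cos_span.add[OF this(3,4)] show ?case by (simp add: distrib_left)
  qed
next
  case (add f g)
  from cos_span.add[OF this(3,4)] show ?case by (simp add: distrib_right)
qed

lemma cos_span_continuous: "f \<in> cos_span \<Longrightarrow> continuous_on S f"
  by (induction rule: cos_span.induct) (auto intro!: continuous_intros)

lemma cos_span_reflect: "f \<in> cos_span \<Longrightarrow> f (1 - t) = f t"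
proof (induction rule: cos_span.induct)
  case (monomial c n)
  have "cos (2 * pi * real n * (1 - t)) = cos (2 * pi * real n - 2 * pi * real n * t)"
    by (simp add: algebra_simps)
  also have "\<dots> = cos (2 * pi * real n * t)"
    unfolding cos_diff using cos_int_2pin[of "int n"] sin_int_2pin[of "int n"] by (simp add: mult_ac)
  finally show ?case by simp
qed simp

text \<open>Stone-Weierstrass on half of the circle: cos(2 pi x) is injective on [0, 1/2]. On the
  other half every element of the algebra is determined by \<open>cos_span_reflect\<close>.\<close>

lemma cos_span_dense:
  assumes "continuous_on {0..1/2} \<psi>" "e > 0"
  shows "\<exists>T\<in>cos_span. \<forall>x\<in>{0..1/2}. \<bar>\<psi> x - T x\<bar> < e"
proof -
  have "\<exists>T. T \<in> cos_span \<and> (\<forall>x\<in>{0..1/2}. \<bar>\<psi> x - T x\<bar> < e)"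
  proof (rule Stone_Weierstrass_HOL)
    fix x y :: real assume xy: "x \<in> {0..1/2} \<and> y \<in> {0..1/2} \<and> x \<noteq> y"
    have range: "0 \<le> 2 * pi * z \<and> 2 * pi * z \<le> pi" if "z \<in> {0..1/2}" for z
      using that mult_left_mono[of z "1/2" "2 * pi"] by simp
    have "cos (2 * pi * x) \<noteq> cos (2 * pi * y)"
    proof
      assume "cos (2 * pi * x) = cos (2 * pi * y)"
      with range[of x] range[of y] xy have "2 * pi * x = 2 * pi * y"
        using cos_inj_pi by blast
      then show False using xy by simp
    qed
    then show "\<exists>f. f \<in> cos_span \<and> f x \<noteq> f y"
      using cos_span.monomial[of 1 1] by (intro exI[of _ "\<lambda>t. 1 * cos (2 * pi * real 1 * t)"]) simp
  qed (use assms in \<open>auto intro: cos_span_const cos_span_continuous cos_span.add cos_span_mult\<close>)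
  then show ?thesis by blast
qed

lemma log_realizable_cos_span:
  fixes p :: real
  assumes p: "p > 0" "\<And>n::nat. p \<noteq> 2 * real n" and T: "T \<in> cos_span"
  shows "log_realizable p T"
  using T
proof induction
  case (monomial c n)
  have "p / 2 \<noteq> real n" for n using p(2)[of n] by linarith
  note signs = gbinomial_both_signs[OF this]
  \<comment> \<open>The sign of the binomial coefficient is matched to that of c, since the number
    of copies of a factor cannot be negative. Sums of exponents are handled below by concatenating
    lists.\<close>
  obtain k where k: "k \<ge> 2" "p/2 gchoose k \<noteq> 0" "c * (p/2 gchoose k) \<ge> 0"
  proof (cases "c \<ge> 0")
    case True
    then show thesis using signs(1) that by (metis less_irrefl less_imp_le mult_nonneg_nonneg)
  next
    case False
    then show thesis using signs(2) that by (metis less_irrefl less_imp_le mult_nonpos_nonpos linear)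
  qed
  show ?case unfolding log_realizable_def
  proof (intro allI impI)
    fix \<eta> :: real assume "\<eta> > 0"
    then obtain a d and N :: nat where
      a: "0 < a" "a \<le> 1/8" "\<And>t. \<bar>real N * ln (factor_mean p n k a t) - d - c * cos (2 * pi * real n * t)\<bar> \<le> \<eta>"
      by (rule log_factor_mean_approx_cos[OF p(1) k(2,3)]) (rule that)
    show "\<exists>fs d. admissible fs \<and> (\<forall>t. \<bar>factor_log p fs t - d - c * cos (2 * pi * real n * t)\<bar> \<le> \<eta>)"
      by (intro exI[of _ "replicate N (n, k, a)"] exI[of _ d])
         (use a k in \<open>auto simp: admissible_def factor_log_replicate\<close>)
  qed
next
  case (add f g)
  show ?case unfolding log_realizable_def
  proof (intro allI impI)
    fix \<eta> :: real assume "\<eta> > 0"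
    then have "\<eta> / 2 > 0" by simp
    with add(3,4) obtain fs c gs d where fg: "admissible fs" "\<And>t. \<bar>factor_log p fs t - c - f t\<bar> \<le> \<eta> / 2"
      "admissible gs" "\<And>t. \<bar>factor_log p gs t - d - g t\<bar> \<le> \<eta> / 2"
      unfolding log_realizable_def by blast
    have "\<bar>factor_log p (fs @ gs) t - (c + d) - (f t + g t)\<bar> \<le> \<eta>" for t
      using fg(2)[of t] fg(4)[of t] unfolding factor_log_append by linarith
    moreover have "admissible (fs @ gs)" using fg by (auto simp: admissible_def)
    ultimately show "\<exists>fs c. admissible fs \<and> (\<forall>t. \<bar>factor_log p fs t - c - (f t + g t)\<bar> \<le> \<eta>)" by blast
  qed
qed

section \<open>Concentration on a symmetric set\<close>

text \<open>The reflection t to -t of the circle reads 1 - t on the parameter interval; K will lie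
  in the fundamental domain [0, 1/2].\<close>

definition symm :: "real set \<Rightarrow> real set" where
  "symm K = {t. t \<in> K \<or> 1 - t \<in> K}"

lemma symm_eq: "symm K = K \<union> (\<lambda>t. 1 - t) -` K"
  by (auto simp: symm_def)

lemma symm_borel: "K \<in> sets borel \<Longrightarrow> symm K \<in> sets borel"
  using measurable_sets[of "\<lambda>t::real. 1 - t" borel borel K] by (auto simp: symm_eq)

lemma emeasure_symm_le:
  assumes K: "K \<in> sets borel"
  shows "emeasure lebesgue (symm K) \<le> 2 * emeasure lebesgue K"
proof -
  have R: "(\<lambda>t. 1 - t) -` K \<in> sets borel"
    using measurable_sets[of "\<lambda>t::real. 1 - t" borel borel K] K by simp
  have "lborel = density (distr lborel borel (\<lambda>x::real. 1 + (-1) * x)) (\<lambda>_. ennreal (abs (-1)))"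
    by (rule lborel_real_affine) simp
  then have L: "lborel = distr lborel borel (\<lambda>x::real. 1 - x)" by (simp add: density_1)
  have "emeasure lborel K = emeasure (distr lborel borel (\<lambda>x::real. 1 - x)) K" using L by simp
  also have "\<dots> = emeasure lborel ((\<lambda>t. 1 - t) -` K)"
    using K by (subst emeasure_distr) auto
  finally have eq: "emeasure lborel ((\<lambda>t. 1 - t) -` K) = emeasure lborel K" by simp
  have "emeasure lborel (symm K) \<le> emeasure lborel K + emeasure lborel ((\<lambda>t. 1 - t) -` K)"
    unfolding symm_eq using K R by (intro emeasure_subadditive) auto
  then show ?thesis using K symm_borel[OF K] by (simp add: eq mult_2)
qed

lemma integral_indicator_unit_meas:
  assumes "B \<in> sets lebesgue"
  shows "(LINT t|unit_meas. indicator B t) = measure lebesgue (B \<inter> {0..1})"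
  using assms by (simp add: measure_restrict_space)

lemma bdd_meas_indicator:
  assumes "B \<in> sets lebesgue"
  shows "bdd_meas (indicator B :: real \<Rightarrow> real)"
  unfolding bdd_meas_def
proof
  show "indicator B \<in> borel_measurable unit_meas"
    using assms by (intro borel_measurable_indicator') (auto simp: sets_restrict_space space_restrict_space)
  show "\<exists>b. \<forall>t\<in>{0..1}. norm (indicator B t :: real) \<le> b"
    by (intro exI[of _ 1]) (auto simp: indicator_def)
qed

lemma emeasure_less_imp_measure_less:
  assumes "emeasure M A < ennreal e"
  shows "measure M A < e"
proof -
  have "0 < e" using assms by (metis ennreal_neg le_less_linear not_less_zero)
  then show ?thesis using assms unfolding measure_def
    by (cases "emeasure M A") (auto simp: ennreal_less_iff)
qed

text \<open>The weight is exp(T) with T close to M on K and to 0 off a neighbourhood of K, where M is large.\<close>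

lemma concentrating_weight:
  fixes K :: "real set" and p \<theta> :: real
  assumes p: "p > 0" "\<And>n::nat. p \<noteq> 2 * real n"
    and K: "closed K" "K \<subseteq> {0..1/2}" "measure lebesgue K > 0" and \<theta>: "\<theta> > 0"
  obtains fs where "admissible fs"
    "(LINT t|unit_meas. indicator (symm K) t * factor_prod p fs t) > 0"
    "(LINT t|unit_meas. indicator (- symm K) t * factor_prod p fs t) \<le>
       \<theta> * (LINT t|unit_meas. indicator (symm K) t * factor_prod p fs t)"
proof -
  define \<mu> where "\<mu> = measure lebesgue K"
  have \<mu>: "\<mu> > 0" using K by (simp add: \<mu>_def)
  have Kb: "K \<in> sets borel" using K(1) by simp
  have KL: "K \<in> sets lebesgue" using K(1) by (simp add: borel_closed)
  \<comment> \<open>Chosen so that the background exp(c + 1) off the neighbourhood is at most half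
    of \<theta> times the mass on K. The absolute value in \<open>M\<close> keeps the height
    nonnegative, as needed for M \<psi> \<le> M.\<close>
  define N where "N = 1 + ln (2 * exp 1 / (\<theta> * \<mu>))"
  define M where "M = \<bar>N\<bar>"
  have M0: "M \<ge> 0" by (simp add: M_def)
  have M: "2 * exp 1 \<le> \<theta> * \<mu> * exp (M - 1)"
  proof -
    have "2 * exp 1 = \<theta> * \<mu> * exp (N - 1)" using \<theta> \<mu> by (simp add: N_def)
    also have "\<dots> \<le> \<theta> * \<mu> * exp (M - 1)" using \<theta> \<mu> by (simp add: M_def)
    finally show ?thesis .
  qed
  \<comment> \<open>On the thin layer U - K the weight is bounded only by exp(c + M + 1), against
    the lower bound exp(c + M - 1) on K. The factor exp(-2) makes up for this, so the layer
    contributes the other half and \<eta> does not depend on M.\<close>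
  define \<eta> where "\<eta> = \<theta> * \<mu> * exp (- 2) / 4"
  have \<eta>: "\<eta> > 0" using \<theta> \<mu> by (simp add: \<eta>_def)
  obtain U where U: "open U" "K \<subseteq> U" "emeasure lebesgue (U - K) < ennreal \<eta>"
    using sets_lebesgue_outer_open[OF KL \<eta>] by metis
  have "K \<inter> (- U) = {}" using U by auto
  then obtain \<psi> :: "real \<Rightarrow> real" where \<psi>: "continuous_on UNIV \<psi>" "\<And>x. \<psi> x \<in> closed_segment 1 0"
    "\<And>x. x \<in> K \<Longrightarrow> \<psi> x = 1" "\<And>x. x \<in> - U \<Longrightarrow> \<psi> x = 0"
    using Urysohn[of K "- U" 1 0] K(1) U(1) by (auto simp: closed_Compl)
  have \<psi>1: "\<psi> x \<le> 1" for x using \<psi>(2)[of x] by (auto simp: closed_segment_eq_real_ivl)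
  have "continuous_on {0..1/2} (\<lambda>x. M * \<psi> x)"
    by (intro continuous_intros continuous_on_subset[OF \<psi>(1)]) auto
  from cos_span_dense[OF this, of "1/2"] obtain T where T: "T \<in> cos_span"
    "\<And>x. x \<in> {0..1/2} \<Longrightarrow> \<bar>M * \<psi> x - T x\<bar> < 1/2" by auto
  have "log_realizable p T" by (rule log_realizable_cos_span[OF p T(1)])
  then have "\<exists>fs c. admissible fs \<and> (\<forall>t. \<bar>factor_log p fs t - c - T t\<bar> \<le> 1/2)"
    unfolding log_realizable_def by (rule allE[of _ "1/2"]) simp
  then obtain fs c where fs: "admissible fs" "\<And>t. \<bar>factor_log p fs t - c - T t\<bar> \<le> 1/2" by blast
  have near: "\<bar>factor_log p fs t - c - M * \<psi> t\<bar> \<le> 1" if "t \<in> {0..1/2}" for t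
    using fs(2)[of t] T(2)[OF that] by linarith
  have near': "\<bar>factor_log p fs t - c - M * \<psi> (1 - t)\<bar> \<le> 1" if "1 - t \<in> {0..1/2}" for t
    using fs(2)[of t] T(2)[OF that] cos_span_reflect[OF T(1), of t] by linarith
  define V where "V = symm (U - K)"
  have UKb: "U - K \<in> sets borel" using U(1) K(1) by auto
  have VL: "V \<in> sets lebesgue" using symm_borel[OF UKb] by (simp add: V_def)
  have SL: "symm K \<in> sets lebesgue" using symm_borel[OF Kb] by simp
  have V: "measure lebesgue (V \<inter> {0..1}) \<le> 2 * \<eta>"
  proof -
    have "emeasure lebesgue (V \<inter> {0..1}) \<le> emeasure lebesgue V"
      using VL by (intro emeasure_mono) auto
    also have "\<dots> \<le> 2 * emeasure lebesgue (U - K)" unfolding V_def by (rule emeasure_symm_le[OF UKb])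
    also have "\<dots> \<le> 2 * ennreal \<eta>" using U(3) by (intro mult_left_mono) auto
    also have "\<dots> = ennreal (2 * \<eta>)" using \<eta> by (simp add: ennreal_mult)
    finally show ?thesis using \<eta> unfolding measure_def by (simp add: enn2real_leI)
  qed
  have contP: "bdd_meas (factor_prod p fs)" by (intro bdd_meas_continuous continuous_on_factor_prod fs)
  have int1: "integrable unit_meas (\<lambda>t. indicator (symm K) t * factor_prod p fs t)"
    by (intro bdd_meas_integrable bdd_meas_mult bdd_meas_indicator SL contP)
  have int2: "integrable unit_meas (\<lambda>t. indicator (- symm K) t * factor_prod p fs t)"
    using SL by (intro bdd_meas_integrable bdd_meas_mult bdd_meas_indicator contP) (simp add: Compl_in_sets_lebesgue)
  have low: "exp c * \<mu> * exp (M - 1) \<le> (LINT t|unit_meas. indicator (symm K) t * factor_prod p fs t)"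
  proof -
    have "exp c * \<mu> * exp (M - 1) = (LINT t|unit_meas. exp (c + M - 1) * indicator K t)"
    proof -
      have "K \<inter> {0..1} = K" using K(2) by auto
      then show ?thesis
        using integral_indicator_unit_meas[OF KL] by (simp add: \<mu>_def exp_add exp_diff)
    qed
    also have "\<dots> \<le> (LINT t|unit_meas. indicator (symm K) t * factor_prod p fs t)"
    proof (intro integral_mono int1 bdd_meas_integrable bdd_meas_mult bdd_meas_const bdd_meas_indicator KL)
      fix t assume "t \<in> space unit_meas"
      show "exp (c + M - 1) * indicator K t \<le> indicator (symm K) t * factor_prod p fs t"
      proof (cases "t \<in> K")
        case True
        then have "\<bar>factor_log p fs t - c - M\<bar> \<le> 1" using near[of t] \<psi>(3)[of t] K(2) by auto
        then have "exp (c + M - 1) \<le> factor_prod p fs t" by (simp add: factor_prod_eq_exp_factor_log[OF fs(1)])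
        then show ?thesis using True by (simp add: symm_def indicator_def)
      qed (simp add: factor_prod_eq_exp_factor_log[OF fs(1)])
    qed
    finally show ?thesis .
  qed
  have up: "(LINT t|unit_meas. indicator (- symm K) t * factor_prod p fs t) \<le> exp c * (exp 1 + exp (M + 1) * (2 * \<eta>))"
  proof -
    have "(LINT t|unit_meas. indicator (- symm K) t * factor_prod p fs t) \<le>
       (LINT t|unit_meas. exp (c + 1) + exp (c + M + 1) * indicator V t)"
    proof (intro integral_mono int2 Bochner_Integration.integrable_add bdd_meas_integrable bdd_meas_mult bdd_meas_const bdd_meas_indicator VL)
      fix t assume "t \<in> space unit_meas"
      then have t: "0 \<le> t" "t \<le> 1" by auto
      show "indicator (- symm K) t * factor_prod p fs t \<le> exp (c + 1) + exp (c + M + 1) * indicator V t"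
      proof (cases "t \<in> symm K")
        case False
        \<comment> \<open>The representative of t in [0, 1/2] under reflection, where T is known to
          be close to M \<psi>.\<close>
        define s where "s = (if t \<le> 1/2 then t else 1 - t)"
        have s: "s \<in> {0..1/2}" "s \<notin> K" "\<bar>factor_log p fs t - c - M * \<psi> s\<bar> \<le> 1"
          using False near[of t] near'[of t] t by (auto simp: s_def symm_def)
        show ?thesis
        proof (cases "s \<in> U")
          case True
          then have "t \<in> V" using s by (auto simp: V_def symm_def s_def split: if_splits)
          moreover have "M * \<psi> s \<le> M" using M0 \<psi>1[of s] by (simp add: mult_left_le)
          then have "factor_prod p fs t \<le> exp (c + M + 1)" using s by (simp add: factor_prod_eq_exp_factor_log[OF fs(1)])
          ultimately show ?thesis using False by simp (metis add_increasing exp_ge_zero)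
        next
          case False
          then have "factor_prod p fs t \<le> exp (c + 1)" using s \<psi>(4)[of s] by (simp add: factor_prod_eq_exp_factor_log[OF fs(1)])
          then show ?thesis using \<open>t \<notin> symm K\<close> by (simp add: add_increasing2)
        qed
      qed simp
    qed
    also have "\<dots> = exp (c + 1) + exp (c + M + 1) * measure lebesgue (V \<inter> {0..1})"
      by (subst Bochner_Integration.integral_add)
        (use VL in \<open>auto simp: measure_restrict_space
           intro!: bdd_meas_integrable bdd_meas_mult bdd_meas_const bdd_meas_indicator\<close>)
    also have "\<dots> \<le> exp (c + 1) + exp (c + M + 1) * (2 * \<eta>)"
      using V by simp
    also have "\<dots> = exp c * (exp 1 + exp (M + 1) * (2 * \<eta>))"
      by (simp add: exp_add algebra_simps)
    finally show ?thesis .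
  qed
  have "exp (M + 1) * (2 * \<eta>) = \<theta> * \<mu> * exp (M - 1) / 2"
  proof -
    have "exp (M + 1) * exp (- 2) = exp (M - 1)" by (simp flip: exp_add)
    then show ?thesis by (simp add: \<eta>_def mult_ac)
  qed
  then have "exp 1 + exp (M + 1) * (2 * \<eta>) \<le> \<theta> * \<mu> * exp (M - 1)" using M by linarith
  then have "exp c * (exp 1 + exp (M + 1) * (2 * \<eta>)) \<le> exp c * (\<theta> * \<mu> * exp (M - 1))" by simp
  also have "\<dots> = \<theta> * (exp c * \<mu> * exp (M - 1))" by simp
  also have "\<dots> \<le> \<theta> * (LINT t|unit_meas. indicator (symm K) t * factor_prod p fs t)"
    using \<theta> low by simp
  finally have "(LINT t|unit_meas. indicator (- symm K) t * factor_prod p fs t) \<le>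
       \<theta> * (LINT t|unit_meas. indicator (symm K) t * factor_prod p fs t)" using up by linarith
  moreover have "0 < exp c * \<mu> * exp (M - 1)" using \<mu> by simp
  then have "(LINT t|unit_meas. indicator (symm K) t * factor_prod p fs t) > 0" using low by linarith
  ultimately show thesis using that fs(1) by blast
qed

text \<open>The weak limit transfers the two masses I and J of the weight to |F|^p with error
  \<theta> I. The mass on the set is then within a factor 3/2 of I or at least I/2, and the mass
  outside is at most 2 \<theta> I.\<close>

lemma concentrating_poly:
  fixes K :: "real set" and p \<theta> :: real
  assumes p: "p > 0" "\<And>n::nat. p \<noteq> 2 * real n"
    and K: "closed K" "K \<subseteq> {0..1/2}" "measure lebesgue K > 0" and \<theta>: "\<theta> > 0" "\<theta> \<le> 1/2"
  obtains f where "gap_poly L f"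
    "(LINT t|unit_meas. indicator (symm K) t * norm (poly f (ex t)) powr p) \<ge> 1"
    "(LINT t|unit_meas. indicator (symm K) t * norm (poly f (ex t)) powr p) \<le> 3"
    "(LINT t|unit_meas. indicator (- symm K) t * norm (poly f (ex t)) powr p) \<le> 4 * \<theta>"
proof -
  obtain fs where fs: "admissible fs"
    "(LINT t|unit_meas. indicator (symm K) t * factor_prod p fs t) > 0"
    "(LINT t|unit_meas. indicator (- symm K) t * factor_prod p fs t) \<le>
       \<theta> * (LINT t|unit_meas. indicator (symm K) t * factor_prod p fs t)"
    using concentrating_weight[OF p K \<theta>(1)] by blast
  define I where "I = (LINT t|unit_meas. indicator (symm K) t * factor_prod p fs t)"
  define J where "J = (LINT t|unit_meas. indicator (- symm K) t * factor_prod p fs t)"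
  have I: "I > 0" "J \<le> \<theta> * I" using fs by (auto simp: I_def J_def)
  have SL: "symm K \<in> sets lebesgue" "- symm K \<in> sets lebesgue"
    using symm_borel[of K] K(1) by (auto simp: Compl_in_sets_lebesgue)
  \<comment> \<open>One complex weight controls the integrals over both sets at once.\<close>
  define w where "w t = Complex (indicator (symm K) t) (indicator (- symm K) t)" for t
  have w: "bdd_meas w"
  proof -
    have "w = (\<lambda>t. of_real (indicator (symm K) t) - (- \<i>) * of_real (indicator (- symm K) t))"
      by (intro ext) (simp add: w_def Complex_eq)
    moreover have "bdd_meas \<dots>"
      by (intro bdd_meas_diff bdd_meas_mult bdd_meas_const bdd_meas_of_real bdd_meas_indicator SL)
    ultimately show ?thesis by simp
  qed
  have parts: "Re (LINT t|unit_meas. w t * of_real (g t)) = (LINT t|unit_meas. indicator (symm K) t * g t)"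
    "Im (LINT t|unit_meas. w t * of_real (g t)) = (LINT t|unit_meas. indicator (- symm K) t * g t)"
    if "bdd_meas g" for g
  proof -
    have "integrable unit_meas (\<lambda>t. w t * of_real (g t))"
      by (intro bdd_meas_integrable bdd_meas_mult w bdd_meas_of_real that)
    from integral_Re[OF this] integral_Im[OF this]
    show "Re (LINT t|unit_meas. w t * of_real (g t)) = (LINT t|unit_meas. indicator (symm K) t * g t)"
      "Im (LINT t|unit_meas. w t * of_real (g t)) = (LINT t|unit_meas. indicator (- symm K) t * g t)"
      by (simp_all add: w_def)
  qed
  have "\<theta> * I > 0" using \<theta> I by simp
  from realize_factor_prod[OF p(1) fs(1) w this, of L] obtain F where F: "gap_poly L F"
    "norm ((LINT t|unit_meas. w t * of_real (norm (poly F (ex t)) powr p)) -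
          (LINT t|unit_meas. w t * of_real (factor_prod p fs t))) < \<theta> * I" by blast
  define I' where "I' = (LINT t|unit_meas. indicator (symm K) t * norm (poly F (ex t)) powr p)"
  define J' where "J' = (LINT t|unit_meas. indicator (- symm K) t * norm (poly F (ex t)) powr p)"
  have bF: "bdd_meas (\<lambda>t. norm (poly F (ex t)) powr p)" by (intro bdd_meas_continuous continuous_on_poly_powr p)
  have bP: "bdd_meas (factor_prod p fs)" by (intro bdd_meas_continuous continuous_on_factor_prod fs)
  have "\<bar>I' - I\<bar> < \<theta> * I" "\<bar>J' - J\<bar> < \<theta> * I"
    using abs_Re_le_cmod[of "(LINT t|unit_meas. w t * of_real (norm (poly F (ex t)) powr p)) -
          (LINT t|unit_meas. w t * of_real (factor_prod p fs t))"]
      abs_Im_le_cmod[of "(LINT t|unit_meas. w t * of_real (norm (poly F (ex t)) powr p)) -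
          (LINT t|unit_meas. w t * of_real (factor_prod p fs t))"] F(2)
    unfolding minus_complex.sel parts[OF bF] parts[OF bP] I_def I'_def J_def J'_def by linarith+
  moreover have "\<theta> * I \<le> I / 2" using \<theta> I by (simp add: field_simps)
  ultimately have I': "I / 2 \<le> I'" "I' \<le> 3 / 2 * I" "J' \<le> 2 * (\<theta> * I)" using I by linarith+
  \<comment> \<open>Scaling multiplies the p-th power by 2/I, which turns the bounds I/2, 3I/2 and 2
    \<theta> I into 1, 3 and 4 \<theta>.\<close>
  define c where "c = (2 / I) powr (1 / p)"
  have c: "c \<ge> 0" "c powr p = 2 / I" using p(1) I by (auto simp: c_def powr_powr)
  define f where "f = smult (of_real c) F"
  have pf: "norm (poly f (ex t)) powr p = 2 / I * norm (poly F (ex t)) powr p" for t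
    using c by (simp add: f_def norm_mult powr_mult)
  have scale: "(LINT t|unit_meas. indicator B t * norm (poly f (ex t)) powr p) =
      2 / I * (LINT t|unit_meas. indicator B t * norm (poly F (ex t)) powr p)" for B
    unfolding pf by (simp add: mult.left_commute[of "indicator B _"] del: times_divide_eq_left)
  show thesis
  proof
    show "gap_poly L f" unfolding f_def by (intro gap_poly_smult F c)
    show "(LINT t|unit_meas. indicator (symm K) t * norm (poly f (ex t)) powr p) \<ge> 1"
      "(LINT t|unit_meas. indicator (symm K) t * norm (poly f (ex t)) powr p) \<le> 3"
      "(LINT t|unit_meas. indicator (- symm K) t * norm (poly f (ex t)) powr p) \<le> 4 * \<theta>"
      unfolding scale I'_def[symmetric] J'_def[symmetric] using I' I by (auto simp: field_simps)
  qed
qed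

section \<open>Cutting a set of positive measure into pieces\<close>

lemma measure_split_atMost:
  fixes A :: "real set"
  assumes A: "A \<in> lmeasurable" and st: "s \<le> t"
  shows "measure lebesgue (A \<inter> {..t}) = measure lebesgue (A \<inter> {..s}) + measure lebesgue (A \<inter> {s<..t})"
proof -
  have "A \<inter> {..s} \<in> lmeasurable" "A \<inter> {s<..t} \<in> lmeasurable"
    using A by (auto intro!: fmeasurable_Int_fmeasurable)
  moreover have "A \<inter> {..t} = (A \<inter> {..s}) \<union> (A \<inter> {s<..t})" "(A \<inter> {..s}) \<inter> (A \<inter> {s<..t}) = {}"
    using st by auto
  ultimately show ?thesis
    using measure_Union[of lebesgue "A \<inter> {..s}" "A \<inter> {s<..t}"] by (auto simp: fmeasurable_def)
qed

text \<open>The distribution function of A is 1-Lipschitz, so it takes every intermediate value. It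
  is followed from -1, where it vanishes because A lies in [0, 1].\<close>

lemma measure_atMost_IVT:
  fixes A :: "real set"
  assumes A: "A \<in> lmeasurable" and sub: "A \<subseteq> {0..1}" and v: "0 \<le> v" "v \<le> measure lebesgue A"
  shows "\<exists>t. measure lebesgue (A \<inter> {..t}) = v"
proof -
  define h where "h t = measure lebesgue (A \<inter> {..t})" for t
  have lip: "\<bar>h t - h s\<bar> \<le> \<bar>t - s\<bar>" for s t
  proof -
    have *: "h t - h s \<le> t - s \<and> h s \<le> h t" if "s \<le> t" for s t
    proof -
      have "measure lebesgue (A \<inter> {s<..t}) \<le> measure lebesgue {s..t}"
        using A by (intro measure_mono_fmeasurable) auto
      then show ?thesis
        using measure_split_atMost[OF A that] that by (simp add: h_def)
    qed
    show ?thesis using *[of s t] *[of t s] by (cases "s \<le> t") auto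
  qed
  have "continuous_on {-1..1} h"
  proof (rule continuous_onI)
    fix x e :: real assume "e > 0"
    then show "\<exists>d>0. \<forall>x'\<in>{-1..1}. dist x' x < d \<longrightarrow> dist (h x') (h x) \<le> e"
      by (intro exI[of _ e]) (auto simp: dist_real_def intro: order_trans[OF lip])
  qed
  moreover have "A \<inter> {..-1} = {}" "A \<inter> {..1} = A" using sub by auto
  then have "h (-1) = 0" "h 1 = measure lebesgue A" by (simp_all add: h_def)
  ultimately show ?thesis using IVT'[of h "-1" v 1] v by (auto simp: h_def)
qed

text \<open>Cut A at the points where its distribution function equals \<mu> / 2^k; the k-th slice
  has measure \<mu> / 2^(k+1).\<close>

lemma disjoint_positive_subsets:
  fixes A :: "real set"
  assumes A: "A \<in> lmeasurable" and sub: "A \<subseteq> {0..1}" and pos: "measure lebesgue A > 0"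
  obtains B :: "nat \<Rightarrow> real set" where "\<And>k. B k \<in> lmeasurable" "\<And>k. B k \<subseteq> A"
    "\<And>k. measure lebesgue (B k) > 0" "\<And>i j. i \<noteq> j \<Longrightarrow> B i \<inter> B j = {}"
proof -
  define \<mu> where "\<mu> = measure lebesgue A"
  have "\<exists>t. measure lebesgue (A \<inter> {..t}) = \<mu> / 2 ^ k" for k
    using pos by (intro measure_atMost_IVT[OF A sub]) (auto simp: \<mu>_def field_simps)
  then obtain t where t: "\<And>k. measure lebesgue (A \<inter> {..t k}) = \<mu> / 2 ^ k" by metis
  have dec: "t (Suc k) < t k" for k
  proof (rule ccontr)
    assume "\<not> t (Suc k) < t k"
    then have "measure lebesgue (A \<inter> {..t k}) \<le> measure lebesgue (A \<inter> {..t (Suc k)})"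
      using A by (intro measure_mono_fmeasurable) (auto intro!: fmeasurable_Int_fmeasurable)
    then show False using pos by (simp add: t \<mu>_def field_simps)
  qed
  have dec': "t j \<le> t i" if "i \<le> j" for i j
    using lift_Suc_antimono_le[of t, OF less_imp_le[OF dec] that] .
  define B where "B k = A \<inter> {t (Suc k)<..t k}" for k
  show thesis
  proof
    show "B k \<in> lmeasurable" for k using A by (auto simp: B_def intro!: fmeasurable_Int_fmeasurable)
    show "B k \<subseteq> A" for k by (auto simp: B_def)
    show "measure lebesgue (B k) > 0" for k
      using measure_split_atMost[OF A less_imp_le[OF dec[of k]]] pos by (simp add: t B_def \<mu>_def field_simps zero_less_mult_iff)
    have "B i \<inter> B j = {}" if "i < j" for i j
      using dec'[of "Suc i" j] that by (auto simp: B_def)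
    then show "B i \<inter> B j = {}" if "i \<noteq> j" for i j using that by (metis Int_commute linorder_neqE_nat)
  qed
qed

text \<open>A threshold split: below l the power is at most l^q, and above l each x^(q-p) is at most
  l^(q-p).\<close>

lemma powr_interpolation:
  fixes x l p q :: real
  assumes "x \<ge> 0" "l > 0" "0 < q" "q < p"
  shows "x powr q \<le> l powr (q - p) * x powr p + l powr q"
proof (cases "x < l")
  case True
  then have "x powr q \<le> l powr q" using assms by (intro powr_mono2) auto
  then show ?thesis by (simp add: add_increasing)
next
  case False
  then have "x powr (q - p) \<le> l powr (q - p)" using assms by (intro powr_mono2') auto
  then have "x powr (q - p) * x powr p \<le> l powr (q - p) * x powr p" by (intro mult_right_mono) auto
  moreover have "x powr (q - p) * x powr p = x powr q" using False assms by (simp flip: powr_add)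
  ultimately show ?thesis by (simp add: add_increasing2)
qed

text \<open>The L^q mass is small for two different reasons: on \<open>symm K\<close> the p-mass is
  bounded and the set is tiny, while elsewhere the p-mass itself is tiny. Each region gets its own
  threshold in \<open>powr_interpolation\<close>.\<close>

lemma concentrating_poly_small_norm:
  fixes A :: "real set" and p q \<epsilon> :: real
  assumes p: "p > 0" "\<And>n::nat. p \<noteq> 2 * real n" and q: "0 < q" "q < p"
    and A: "A \<in> lmeasurable" "A \<subseteq> {0..1/2}" "measure lebesgue A > 0" and \<epsilon>: "\<epsilon> > 0"
  obtains K f where "closed K" "K \<subseteq> A" "gap_poly L f"
    "(LINT t|unit_meas. indicator (symm K) t * norm (poly f (ex t)) powr p) \<ge> 1"
    "(LINT t|unit_meas. indicator (- symm K) t * norm (poly f (ex t)) powr p) \<le> \<epsilon>"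
    "(LINT t|unit_meas. norm (poly f (ex t)) powr q) \<le> \<epsilon>"
proof -
  \<comment> \<open>Each of the four contributions gets \<epsilon>/4: 3 l1^(q-p) and 2 \<eta> l1^q
    on the set, 4 \<theta> l2^(q-p) and l2^q off it. These requirements determine l1, \<eta> and l2,
    and bound \<theta>.\<close>
  define l1 where "l1 = (\<epsilon> / 12) powr (1 / (q - p))"
  define l2 where "l2 = (\<epsilon> / 4) powr (1 / q)"
  have l1: "l1 > 0" "l1 powr (q - p) = \<epsilon> / 12" using \<epsilon> q by (auto simp: l1_def powr_powr)
  have l2: "l2 > 0" "l2 powr q = \<epsilon> / 4" using \<epsilon> q by (auto simp: l2_def powr_powr)
  define \<eta> where "\<eta> = \<epsilon> / (8 * l1 powr q)"
  have \<eta>: "\<eta> > 0" using \<epsilon> l1 by (simp add: \<eta>_def)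
  define \<theta> where "\<theta> = min (1/2) (min (\<epsilon> / 4) (\<epsilon> / (16 * l2 powr (q - p))))"
  have \<theta>: "\<theta> > 0" "\<theta> \<le> 1/2" using \<epsilon> l2 by (auto simp: \<theta>_def)
  have \<theta>1: "4 * \<theta> \<le> \<epsilon>" using \<theta>_def by linarith
  have \<theta>2: "l2 powr (q - p) * (4 * \<theta>) \<le> \<epsilon> / 4"
  proof -
    have "\<theta> \<le> \<epsilon> / (16 * l2 powr (q - p))" by (simp add: \<theta>_def)
    then have "\<theta> * (16 * l2 powr (q - p)) \<le> \<epsilon>" using l2 by (simp add: pos_le_divide_eq)
    then show ?thesis by (simp add: mult_ac)
  qed
  have A01: "A \<subseteq> {0..1}" using A(2) by auto
  \<comment> \<open>A is first trimmed to measure at most \<eta>; a closed subset then keeps more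
    than half of it, hence has positive measure.\<close>
  define v where "v = min \<eta> (measure lebesgue A)"
  have v: "0 < v" "v \<le> measure lebesgue A" "v \<le> \<eta>" using \<eta> A(3) by (auto simp: v_def)
  obtain t where t: "measure lebesgue (A \<inter> {..t}) = v"
    using measure_atMost_IVT[OF A(1) A01 less_imp_le[OF v(1)] v(2)] by blast
  define A' where "A' = A \<inter> {..t}"
  have A': "A' \<in> lmeasurable" "measure lebesgue A' = v"
    using A t by (auto simp: A'_def intro!: fmeasurable_Int_fmeasurable)
  obtain K where K: "closed K" "K \<subseteq> A'" "A' - K \<in> lmeasurable" "emeasure lebesgue (A' - K) < ennreal (v / 2)"
    using sets_lebesgue_inner_closed[of A' "v / 2"] A'(1) v(1) by (auto simp: fmeasurableD)
  have Km: "K \<in> lmeasurable" using K(1,2) A'(1) by (intro fmeasurableI2[OF A'(1)]) auto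
  have "measure lebesgue (A' - K) = v - measure lebesgue K"
    using measure_Diff[of lebesgue A' K] A' K(2) Km by (auto simp: fmeasurable_def)
  then have Kpos: "measure lebesgue K > 0" and Kle: "measure lebesgue K \<le> \<eta>"
    using emeasure_less_imp_measure_less[OF K(4)] v measure_nonneg[of lebesgue "A' - K"] by linarith+
  have Ksub: "K \<subseteq> {0..1/2}" using K(2) A(2) by (auto simp: A'_def)
  obtain f where f: "gap_poly L f"
    "(LINT t|unit_meas. indicator (symm K) t * norm (poly f (ex t)) powr p) \<ge> 1"
    "(LINT t|unit_meas. indicator (symm K) t * norm (poly f (ex t)) powr p) \<le> 3"
    "(LINT t|unit_meas. indicator (- symm K) t * norm (poly f (ex t)) powr p) \<le> 4 * \<theta>"
    using concentrating_poly[OF p K(1) Ksub Kpos \<theta>] by blast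
  have SL: "symm K \<in> sets lebesgue" "- symm K \<in> sets lebesgue"
    using symm_borel[of K] K(1) by (auto simp: Compl_in_sets_lebesgue)
  have mS: "measure lebesgue (symm K \<inter> {0..1}) \<le> 2 * \<eta>"
  proof -
    have "emeasure lebesgue (symm K \<inter> {0..1}) \<le> emeasure lebesgue (symm K)"
      using SL by (intro emeasure_mono) auto
    also have "\<dots> \<le> 2 * emeasure lebesgue K" using K(1) by (intro emeasure_symm_le) auto
    also have "\<dots> = ennreal (2 * measure lebesgue K)"
      using Km by (simp add: emeasure_eq_measure2 ennreal_mult)
    also have "\<dots> \<le> ennreal (2 * \<eta>)" using Kle by (intro ennreal_leI) simp
    finally show ?thesis using \<eta> unfolding measure_def by (simp add: enn2real_leI)
  qed
  define N where "N t = norm (poly f (ex t))" for t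
  have bN: "bdd_meas (\<lambda>t. N t powr p)" "bdd_meas (\<lambda>t. N t powr q)"
    unfolding N_def using p q by (intro bdd_meas_continuous continuous_on_poly_powr, simp)+
  note ints = bdd_meas_integrable[OF bdd_meas_mult[OF bdd_meas_const bdd_meas_mult[OF bdd_meas_indicator[OF SL(1)] bN(1)]]]
    bdd_meas_integrable[OF bdd_meas_mult[OF bdd_meas_const bdd_meas_indicator[OF SL(1)]]]
    bdd_meas_integrable[OF bdd_meas_mult[OF bdd_meas_const bdd_meas_mult[OF bdd_meas_indicator[OF SL(2)] bN(1)]]]
    bdd_meas_integrable[OF bdd_meas_const]
  have "(LINT t|unit_meas. N t powr q) \<le>
     (LINT t|unit_meas. (l1 powr (q - p) * (indicator (symm K) t * N t powr p) + l1 powr q * indicator (symm K) t) +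
         (l2 powr (q - p) * (indicator (- symm K) t * N t powr p) + l2 powr q))"
  proof (intro integral_mono bdd_meas_integrable[OF bN(2)] Bochner_Integration.integrable_add ints)
    fix t
    have "N t \<ge> 0" by (simp add: N_def)
    from powr_interpolation[OF this l1(1) q] powr_interpolation[OF this l2(1) q]
    show "N t powr q \<le> (l1 powr (q - p) * (indicator (symm K) t * N t powr p) + l1 powr q * indicator (symm K) t) +
         (l2 powr (q - p) * (indicator (- symm K) t * N t powr p) + l2 powr q)"
      by (cases "t \<in> symm K") (auto intro: add_increasing2)
  qed
  also have "\<dots> = (l1 powr (q - p) * (LINT t|unit_meas. indicator (symm K) t * N t powr p) +
      l1 powr q * measure lebesgue (symm K \<inter> {0..1})) +
      (l2 powr (q - p) * (LINT t|unit_meas. indicator (- symm K) t * N t powr p) + l2 powr q)"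
    using ints integral_indicator_unit_meas[OF SL(1)]
    by (simp add: measure_unit_meas)
  also have "\<dots> \<le> (l1 powr (q - p) * 3 + l1 powr q * (2 * \<eta>)) + (l2 powr (q - p) * (4 * \<theta>) + l2 powr q)"
    using f mS unfolding N_def by (intro add_mono mult_left_mono) auto
  also have "\<dots> \<le> \<epsilon>"
  proof -
    have "l1 powr q * (2 * \<eta>) = \<epsilon> / 4" using l1 by (simp add: \<eta>_def)
    then show ?thesis using \<theta>2 unfolding l1(2) l2(2) by linarith
  qed
  finally have "(LINT t|unit_meas. norm (poly f (ex t)) powr q) \<le> \<epsilon>" unfolding N_def .
  moreover have "K \<subseteq> A" using K(2) by (auto simp: A'_def)
  ultimately show thesis using that[OF K(1) _ f(1,2)] f(4) \<theta>1 by linarith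
qed

text \<open>A substitute for the triangle inequality in L^q that is valid for all q > 0: the weights 2^j
  are harmless because the block norms decay as fast as we please.\<close>

lemma suminf_powr_le:
  fixes a :: "nat \<Rightarrow> real"
  assumes a: "\<And>j. a j \<ge> 0" and q: "q > 0" and sm: "summable (\<lambda>j. (2 ^ j * a j) powr q)"
  shows "summable a" "(\<Sum>j. a j) powr q \<le> 2 powr q * (\<Sum>j. (2 ^ j * a j) powr q)"
proof -
  define S where "S = (\<Sum>j. (2 ^ j * a j) powr q)"
  have S: "S \<ge> 0" unfolding S_def by (intro suminf_nonneg sm) auto
  \<comment> \<open>A single term is at most the whole sum, so a j is at most S^(1/q) 2^(-j). The
    geometric series then sums to 2 S^(1/q).\<close>
  have le: "a j \<le> S powr (1 / q) * (1/2) ^ j" for j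
  proof -
    have "(2 ^ j * a j) powr q \<le> S"
      unfolding S_def using sum_le_suminf[OF sm, of "{j}"] by simp
    then have "((2 ^ j * a j) powr q) powr (1 / q) \<le> S powr (1 / q)"
      using q by (intro powr_mono2) auto
    then have "2 ^ j * a j \<le> S powr (1 / q)" using q a[of j] by (simp add: powr_powr)
    then show ?thesis by (simp add: power_one_over field_simps)
  qed
  have geo: "(\<lambda>j. S powr (1 / q) * (1/2) ^ j) sums (S powr (1 / q) * 2)"
    using sums_mult[OF geometric_sums[of "1/2::real"], of "S powr (1 / q)"] by simp
  show sa: "summable a"
    by (rule summable_comparison_test'[OF sums_summable[OF geo]]) (use le a in auto)
  have "(\<Sum>j. a j) \<le> S powr (1 / q) * 2"
    using suminf_le[OF le sa sums_summable[OF geo]] sums_unique[OF geo] by simp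
  then have "(\<Sum>j. a j) powr q \<le> (S powr (1 / q) * 2) powr q"
    using q by (intro powr_mono2 suminf_nonneg sa a) auto
  also have "\<dots> = 2 powr q * S" using q S by (simp add: powr_mult powr_powr mult.commute)
  finally show "(\<Sum>j. a j) powr q \<le> 2 powr q * (\<Sum>j. (2 ^ j * a j) powr q)" unfolding S_def .
qed

lemma ennreal_suminf_powr_le:
  fixes a :: "nat \<Rightarrow> real"
  assumes a: "\<And>j. a j \<ge> 0" and q: "q > 0"
  shows "ennreal ((\<Sum>j. a j) powr q) \<le> ennreal (2 powr q) * (\<Sum>j. ennreal ((2 ^ j * a j) powr q))"
proof (cases "summable (\<lambda>j. (2 ^ j * a j) powr q)")
  case True
  then have "(\<Sum>j. ennreal ((2 ^ j * a j) powr q)) = ennreal (\<Sum>j. (2 ^ j * a j) powr q)"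
    by (intro suminf_ennreal2) auto
  then have "ennreal (2 powr q) * (\<Sum>j. ennreal ((2 ^ j * a j) powr q)) =
     ennreal (2 powr q * (\<Sum>j. (2 ^ j * a j) powr q))"
    using True by (simp add: ennreal_mult suminf_nonneg)
  then show ?thesis using suminf_powr_le(2)[OF a q True] by (simp add: ennreal_leI)
next
  case False
  \<comment> \<open>When the weighted series diverges the right-hand side is infinite, whatever
    value the real \<open>suminf\<close> on the left takes.\<close>
  then have "(\<Sum>j. ennreal ((2 ^ j * a j) powr q)) = \<infinity>"
    using summable_suminf_not_top[of "\<lambda>j. (2 ^ j * a j) powr q"] powr_ge_zero
    unfolding infinity_ennreal_def by blast
  then show ?thesis by (simp add: ennreal_mult_top)
qed

section \<open>Series of shifted blocks\<close>

text \<open>For r away from 1 the power r^N is small; for r near 1 the polynomial is close to its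
  boundary value.\<close>

lemma poly_radial_bound:
  fixes f :: "complex poly" and e :: real
  assumes e: "e > 0"
  shows "\<exists>R. \<forall>N\<ge>R. \<forall>r\<in>{0<..1}. \<forall>t.
    norm ((of_real r * ex t) ^ N * poly f (of_real r * ex t)) \<le> norm (poly f (ex t)) + e"
proof -
  have "uniformly_continuous_on (cball 0 1) (poly f)"
    by (intro compact_uniformly_continuous continuous_intros) auto
  then obtain d where d: "d > 0" "\<And>z z'. norm z \<le> 1 \<Longrightarrow> norm z' \<le> 1 \<Longrightarrow> dist z' z < d \<Longrightarrow>
      dist (poly f z') (poly f z) < e"
    using e unfolding uniformly_continuous_on_def by (metis mem_cball_0)
  \<comment> \<open>Radii up to 1 - d are covered by b^N E; the maximum with 1/2 keeps b strictly
    between 0 and 1 also when d is at least 1.\<close>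
  define b where "b = max (1 - d) (1/2)"
  have b: "0 < b" "b < 1" using d(1) by (auto simp: b_def)
  obtain E where E: "E \<ge> 0" "\<And>z. norm z \<le> 1 \<Longrightarrow> norm (poly f z) \<le> E"
    using poly_bounded_unit_disc[of f] by blast
  have "(\<lambda>N. b ^ N * E) \<longlonglongrightarrow> 0 * E"
    using b by (intro tendsto_mult LIMSEQ_power_zero tendsto_const) auto
  then have "\<forall>\<^sub>F N in sequentially. b ^ N * E < e"
    using e by (intro order_tendstoD(2)) auto
  then obtain R where R: "\<And>N. N \<ge> R \<Longrightarrow> b ^ N * E < e" by (auto simp: eventually_sequentially)
  show ?thesis
  proof (intro exI[of _ R] allI impI ballI)
    fix N t and r :: real assume N: "N \<ge> R" and r: "r \<in> {0<..1}"
    define z where "z = of_real r * ex t"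
    have nz: "norm z = r" using r by (simp add: z_def norm_mult)
    have "norm (z ^ N * poly f z) \<le> norm (poly f (ex t)) + e"
    proof (cases "r > 1 - d")
      case True
      have "z - ex t = of_real (r - 1) * ex t" by (simp add: z_def algebra_simps)
      then have "norm (z - ex t) = 1 - r" using r by (simp add: norm_mult del: of_real_diff)
      then have "dist z (ex t) < d" using True by (simp add: dist_norm)
      then have "dist (poly f z) (poly f (ex t)) < e" using r nz by (intro d(2)) auto
      then have "norm (poly f z) \<le> norm (poly f (ex t)) + e" unfolding dist_norm by norm
      moreover have "norm (z ^ N * poly f z) \<le> 1 * norm (poly f z)"
        unfolding norm_mult norm_power nz using r by (intro mult_right_mono power_le_one) auto
      ultimately show ?thesis by linarith
    next
      case False
      then have "norm (z ^ N * poly f z) \<le> b ^ N * E"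
        unfolding norm_mult norm_power nz using r nz b by (intro mult_mono power_mono E) (auto simp: b_def)
      also have "\<dots> \<le> e" using R[OF N] by simp
      finally show ?thesis by (simp add: add_increasing)
    qed
    then show "norm ((of_real r * ex t) ^ N * poly f (of_real r * ex t)) \<le> norm (poly f (ex t)) + e"
      unfolding z_def .
  qed
qed

lemma sum_lessThan_add:
  fixes g :: "nat \<Rightarrow> 'a::comm_monoid_add"
  shows "(\<Sum>n<a + b. g n) = (\<Sum>n<a. g n) + (\<Sum>i<b. g (a + i))"
  by (induction b) (simp_all add: add.assoc)

text \<open>The coefficients of the formal series of shifted blocks. The finite range of k suffices
  because N k is at least k when N is strictly increasing.\<close>

definition block_coeff :: "(nat \<Rightarrow> nat) \<Rightarrow> (nat \<Rightarrow> complex poly) \<Rightarrow> nat \<Rightarrow> complex" where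
  "block_coeff N f n = (\<Sum>k\<le>n. if N k \<le> n then coeff (f k) (n - N k) else 0)"

context
  fixes N :: "nat \<Rightarrow> nat" and f :: "nat \<Rightarrow> complex poly"
  assumes N_step: "\<And>k. N k + degree (f k) + k < N (Suc k)"
begin

lemma block_strict_mono: "strict_mono N"
  using N_step by (intro strict_monoI_Suc) (metis add_lessD1)

lemma block_mono: "i \<le> j \<Longrightarrow> N i \<le> N j"
  using strict_mono_mono[OF block_strict_mono] by (simp add: monoD)

lemma block_ge: "k \<le> N k"
  by (rule strict_mono_imp_increasing[OF block_strict_mono])

lemma block_coeff_eq:
  assumes n: "N k \<le> n" "n < N (Suc k)"
  shows "block_coeff N f n = coeff (f k) (n - N k)"
proof -
  have "block_coeff N f n = (\<Sum>j\<le>n. if j = k then coeff (f k) (n - N k) else 0)"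
    unfolding block_coeff_def
  proof (intro sum.cong refl)
    fix j
    consider "j < k" | "j = k" | "j > k" by linarith
    then show "(if N j \<le> n then coeff (f j) (n - N j) else 0) = (if j = k then coeff (f k) (n - N k) else 0)"
    proof cases
      case 1
      then have "N (Suc j) \<le> N k" by (intro block_mono) auto
      then have "degree (f j) < n - N j" using N_step[of j] n by linarith
      then show ?thesis using 1 by (simp add: coeff_eq_0)
    next
      case 3
      then have "N (Suc k) \<le> N j" by (intro block_mono) auto
      then show ?thesis using 3 n by auto
    qed (use n in auto)
  qed
  also have "\<dots> = coeff (f k) (n - N k)" using block_ge[of k] n by simp
  finally show ?thesis .
qed

lemma block_coeff_before:
  assumes "n < N 0"
  shows "block_coeff N f n = 0"
proof -
  have "\<not> N k \<le> n" for k using block_mono[of 0 k] assms by simp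
  then show ?thesis by (simp add: block_coeff_def)
qed

lemma block_exists:
  assumes "N 0 \<le> n"
  obtains k where "N k \<le> n" "n < N (Suc k)"
proof -
  have ex: "\<exists>k. n < N k" using block_ge[of "Suc n"] by (intro exI[of _ "Suc n"]) auto
  define j where "j = (LEAST k. n < N k)"
  have j: "n < N j" unfolding j_def using ex by (rule LeastI_ex)
  then obtain k where k: "j = Suc k" using assms by (cases j) auto
  have "\<not> n < N k" using not_less_Least[of k "\<lambda>k. n < N k"] k by (simp add: j_def)
  then show thesis using j k that[of k] by auto
qed

lemma block_coeff_nonzero_cases:
  assumes "block_coeff N f n \<noteq> 0"
  obtains k where "N k \<le> n" "n < N (Suc k)" "coeff (f k) (n - N k) \<noteq> 0"
  using assms block_coeff_before block_exists block_coeff_eq by (metis not_le)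

lemma block_partial_sum:
  "(\<Sum>n<N K. block_coeff N f n * z ^ n) = (\<Sum>k<K. z ^ N k * poly (f k) z)"
proof (induction K)
  case 0
  then show ?case by (simp add: block_coeff_before)
next
  case (Suc K)
  define d where "d = N (Suc K) - N K"
  have d: "N (Suc K) = N K + d" "degree (f K) < d" using N_step[of K] by (auto simp: d_def)
  have "(\<Sum>n<N (Suc K). block_coeff N f n * z ^ n) =
     (\<Sum>n<N K. block_coeff N f n * z ^ n) + (\<Sum>i<d. block_coeff N f (N K + i) * z ^ (N K + i))"
    unfolding d(1) by (rule sum_lessThan_add)
  also have "(\<Sum>i<d. block_coeff N f (N K + i) * z ^ (N K + i)) = (\<Sum>i<d. z ^ N K * (coeff (f K) i * z ^ i))"
    using d(1) by (intro sum.cong) (auto simp: block_coeff_eq[of K] power_add)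
  also have "\<dots> = z ^ N K * poly (f K) z"
    unfolding poly_altdef sum_distrib_left[symmetric]
    using d(2) by (intro arg_cong[where f = "\<lambda>x. z ^ N K * x"] sum.mono_neutral_right) (auto simp: coeff_eq_0)
  finally show ?case using Suc by simp
qed

text \<open>Exponents beyond \<open>N L\<close> lie in blocks of index a at least L. Inside such a
  block they are at least a apart by \<open>gap_poly\<close>, and the summand k in
  \<open>N_step\<close> leaves more than a between the end of the block and the start of the
  next.\<close>

lemma block_gaps:
  assumes gap: "\<And>k. gap_poly k (f k)" and ne: "\<And>k. f k \<noteq> 0"
  shows "gaps_to_infinity (block_coeff N f)"
proof -
  define S where "S = {n. block_coeff N f n \<noteq> 0}"
  have inf: "infinite S"
    unfolding infinite_nat_iff_unbounded_le
  proof
    fix k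
    define n where "n = N k + degree (f k)"
    have "block_coeff N f n = coeff (f k) (degree (f k))"
      using N_step[of k] block_coeff_eq[of k n] by (simp add: n_def)
    then have "n \<in> S" using ne[of k] by (simp add: S_def)
    moreover have "k \<le> n" using block_ge[of k] by (simp add: n_def)
    ultimately show "\<exists>n\<ge>k. n \<in> S" by blast
  qed
  have sep: "i + L \<le> j" if ij: "i \<in> S" "j \<in> S" "i < j" "N L \<le> i" for i j L
  proof -
    obtain a where a: "N a \<le> i" "i < N (Suc a)" "coeff (f a) (i - N a) \<noteq> 0"
      using ij(1) block_coeff_nonzero_cases by (auto simp: S_def)
    obtain b where b: "N b \<le> j" "j < N (Suc b)" "coeff (f b) (j - N b) \<noteq> 0"
      using ij(2) block_coeff_nonzero_cases by (auto simp: S_def)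
    have "N L < N (Suc a)" using a ij(4) by linarith
    then have L: "L \<le> a" using strict_mono_less[OF block_strict_mono] by simp
    have "N a < N (Suc b)" using a b ij(3) by linarith
    then have "a \<le> b" using strict_mono_less[OF block_strict_mono] by simp
    then consider "a = b" | "a < b" by linarith
    then show ?thesis
    proof cases
      case 1
      then have b': "N a \<le> j" "coeff (f a) (j - N a) \<noteq> 0" using b by simp_all
      have "i - N a < j - N a" using a(1) ij(3) by linarith
      then have "(i - N a) + a \<le> j - N a" using gap[of a] a(3) b'(2) by (auto simp: gap_poly_def)
      then show ?thesis using a(1) b'(1) L by linarith
    next
      case 2
      then have "N (Suc a) \<le> N b" by (intro block_mono) auto
      moreover have "i - N a \<le> degree (f a)" using a(3) by (rule le_degree)
      ultimately show ?thesis using N_step[of a] a(1) b(1) L by linarith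
    qed
  qed
  have "filterlim (\<lambda>k. enumerate S (Suc k) - enumerate S k) at_top sequentially"
    unfolding filterlim_at_top
  proof
    fix Z :: nat
    show "\<forall>\<^sub>F k in sequentially. Z \<le> enumerate S (Suc k) - enumerate S k"
      using eventually_ge_at_top[of "N Z"]
    proof eventually_elim
      case (elim k)
      have "N Z \<le> enumerate S k" using le_enumerate[OF inf, of k] elim by linarith
      then have "enumerate S k + Z \<le> enumerate S (Suc k)"
        by (intro sep enumerate_in_set inf enumerate_step)
      then show ?case by linarith
    qed
  qed
  then show ?thesis using inf unfolding gaps_to_infinity_def S_def by blast
qed

lemma block_nonneg:
  assumes "\<And>k. gap_poly k (f k)"
  shows "Im (block_coeff N f n) = 0 \<and> Re (block_coeff N f n) \<ge> 0"
proof -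
  have "coeff (f k) i \<in> \<real>\<^sub>\<ge>\<^sub>0" for k i using assms by (auto simp: gap_poly_def)
  then have "block_coeff N f n \<in> \<real>\<^sub>\<ge>\<^sub>0"
    using block_coeff_before[of n] block_exists[of n] block_coeff_eq by (metis not_le nonneg_Reals_zero_I)
  then show ?thesis by (simp add: complex_nonneg_Reals_iff)
qed

context
  assumes N_coeff: "\<And>k i. norm (coeff (f k) i) \<le> real (N k)"
begin

text \<open>The coefficients of block k are bounded by its starting index, so growth is at most
  linear however large the polynomials are.\<close>

lemma block_coeff_norm_le: "norm (block_coeff N f n) \<le> real n + 1"
proof (cases "N 0 \<le> n")
  case True
  then obtain k where k: "N k \<le> n" "n < N (Suc k)" by (rule block_exists)
  have "norm (block_coeff N f n) \<le> real (N k)" unfolding block_coeff_eq[OF k] by (rule N_coeff)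
  also have "\<dots> \<le> real n + 1" using k(1) by simp
  finally show ?thesis .
qed (simp add: block_coeff_before)

lemma block_poly_growth: "poly_growth (block_coeff N f)"
  unfolding poly_growth_def
  by (intro exI[of _ 1] exI[of _ "1::nat"]) (use block_coeff_norm_le in auto)

lemma abel_term_eq: "c n * of_real (r ^ n) * cis (2 * pi * real n * t) = c n * (of_real r * ex t) ^ n"
proof -
  have "cis (2 * pi * real n * t) = ex (real n * t)" by (simp add: ex_def mult.assoc)
  also have "\<dots> = ex t ^ n" by (rule ex_of_nat_mult)
  finally show ?thesis by (simp add: power_mult_distrib)
qed

lemma block_summable:
  assumes r: "r \<in> {0<..<1}"
  shows "summable (\<lambda>n. block_coeff N f n * of_real (r ^ n) * cis (2 * pi * real n * t))"
proof -
  have "(\<lambda>n. of_nat (Suc n) * r ^ n) sums (1 / (1 - r)\<^sup>2)"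
    using r by (intro geometric_deriv_sums) auto
  then have "summable (\<lambda>n. real (Suc n) * r ^ n)" by (rule sums_summable)
  then show ?thesis
  proof (rule summable_comparison_test')
    fix n
    show "norm (block_coeff N f n * of_real (r ^ n) * cis (2 * pi * real n * t)) \<le> real (Suc n) * r ^ n"
      using r block_coeff_norm_le[of n] by (auto simp: norm_mult norm_power intro!: mult_right_mono)
  qed
qed

text \<open>The power series converges absolutely for r < 1, and its partial sums at the cuts
  \<open>N K\<close> are the partial sums over whole blocks; the limit along this subsequence is the
  Abel mean.\<close>

lemma block_abel_sums:
  assumes r: "r \<in> {0<..<1}"
  shows "(\<lambda>k. (of_real r * ex t) ^ N k * poly (f k) (of_real r * ex t)) sums abel_mean (block_coeff N f) r t"
proof -
  define z where "z = of_real r * ex t"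
  have "(\<lambda>n. block_coeff N f n * z ^ n) sums abel_mean (block_coeff N f) r t"
    using summable_sums[OF block_summable[OF r, of t]] unfolding abel_mean_def abel_term_eq z_def .
  then have "(\<lambda>m. \<Sum>n<m. block_coeff N f n * z ^ n) \<longlonglongrightarrow> abel_mean (block_coeff N f) r t"
    by (simp add: sums_def)
  from LIMSEQ_subseq_LIMSEQ[OF this block_strict_mono]
  show ?thesis by (simp add: sums_def o_def block_partial_sum z_def)
qed

end

end

section \<open>Integral bounds and radial limits for the block series\<close>

lemma powr_add_le:
  fixes x y q :: real
  assumes "x \<ge> 0" "y \<ge> 0" "q > 0"
  shows "(x + y) powr q \<le> 2 powr q * (x powr q + y powr q)"
proof -
  have "(x + y) powr q \<le> (2 * max x y) powr q" using assms by (intro powr_mono2) auto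
  also have "\<dots> = 2 powr q * max x y powr q" using assms by (simp add: powr_mult)
  also have "\<dots> \<le> 2 powr q * (x powr q + y powr q)"
    by (intro mult_left_mono) (auto simp: max_def)
  finally show ?thesis .
qed

lemma nn_integral_unit_meas_le:
  fixes h :: "real \<Rightarrow> real"
  assumes "bdd_meas h" "\<And>t. h t \<ge> 0" "(LINT t|unit_meas. h t) \<le> x"
  shows "(\<integral>\<^sup>+ t. ennreal (h t) \<partial>unit_meas) \<le> ennreal x"
  using assms by (simp add: nn_integral_eq_integral bdd_meas_integrable ennreal_leI)

text \<open>The integrated form of \<open>ennreal_suminf_powr_le\<close>. The set S varies: the
  whole interval for the Hardy bound, the complement of E for finiteness, and a single
  \<open>symm (K k)\<close> for the lower bound.\<close>

lemma nn_integral_suminf_powr_le: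
  fixes a :: "nat \<Rightarrow> real \<Rightarrow> real"
  assumes a: "\<And>j t. a j t \<ge> 0" and p: "p > 0"
    and meas: "\<And>j. a j \<in> borel_measurable M" and S: "S \<inter> space M \<in> sets M"
    and bound: "\<And>j. (\<integral>\<^sup>+ t. ennreal ((2 ^ j * a j t) powr p) * indicator S t \<partial>M) \<le> ennreal (d j)"
    and d: "\<And>j. d j \<ge> 0" "summable d"
  shows "(\<integral>\<^sup>+ t. (\<Sum>j. ennreal ((2 ^ j * a j t) powr p)) * indicator S t \<partial>M) \<le> ennreal (\<Sum>j. d j)"
    and "(\<integral>\<^sup>+ t. ennreal ((\<Sum>j. a j t) powr p) * indicator S t \<partial>M) \<le> ennreal (2 powr p * (\<Sum>j. d j))"
proof -
  have [measurable]: "a j \<in> borel_measurable M" for j by (rule meas)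
  have [measurable]: "(indicator S :: real \<Rightarrow> ennreal) \<in> borel_measurable M" using S by (simp add: borel_measurable_indicator_iff)
  have "(\<integral>\<^sup>+ t. (\<Sum>j. ennreal ((2 ^ j * a j t) powr p)) * indicator S t \<partial>M) =
     (\<integral>\<^sup>+ t. (\<Sum>j. ennreal ((2 ^ j * a j t) powr p) * indicator S t) \<partial>M)"
    by (simp add: ennreal_suminf_multc)
  also have "\<dots> = (\<Sum>j. \<integral>\<^sup>+ t. ennreal ((2 ^ j * a j t) powr p) * indicator S t \<partial>M)"
    by (rule nn_integral_suminf) measurable
  also have "\<dots> \<le> (\<Sum>j. ennreal (d j))" by (intro suminf_le bound) auto
  also have "\<dots> = ennreal (\<Sum>j. d j)" using d by (intro suminf_ennreal2) auto
  finally show 1: "(\<integral>\<^sup>+ t. (\<Sum>j. ennreal ((2 ^ j * a j t) powr p)) * indicator S t \<partial>M) \<le> ennreal (\<Sum>j. d j)" .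
  have "(\<integral>\<^sup>+ t. ennreal ((\<Sum>j. a j t) powr p) * indicator S t \<partial>M) \<le>
      (\<integral>\<^sup>+ t. ennreal (2 powr p) * ((\<Sum>j. ennreal ((2 ^ j * a j t) powr p)) * indicator S t) \<partial>M)"
    using ennreal_suminf_powr_le[OF a p]
    by (intro nn_integral_mono) (auto simp: mult.assoc[symmetric] intro!: mult_right_mono)
  also have "\<dots> = ennreal (2 powr p) * (\<integral>\<^sup>+ t. (\<Sum>j. ennreal ((2 ^ j * a j t) powr p)) * indicator S t \<partial>M)"
    by (rule nn_integral_cmult) measurable
  also have "\<dots> \<le> ennreal (2 powr p) * ennreal (\<Sum>j. d j)" by (intro mult_left_mono 1) auto
  also have "\<dots> = ennreal (2 powr p * (\<Sum>j. d j))" using d by (simp add: ennreal_mult suminf_nonneg)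
  finally show "(\<integral>\<^sup>+ t. ennreal ((\<Sum>j. a j t) powr p) * indicator S t \<partial>M) \<le> ennreal (2 powr p * (\<Sum>j. d j))" .
qed

lemma borel_measurable_lebesgue_continuous:
  fixes h :: "real \<Rightarrow> 'a::topological_space"
  assumes "continuous_on UNIV h"
  shows "h \<in> borel_measurable lebesgue"
  using borel_measurable_continuous_onI[OF assms] by (intro measurable_completion) simp

text \<open>The sum at radius 1. It is meaningful only where the series converges, which will be
  almost everywhere.\<close>

definition block_boundary :: "(nat \<Rightarrow> nat) \<Rightarrow> (nat \<Rightarrow> complex poly) \<Rightarrow> real \<Rightarrow> complex" where
  "block_boundary N f t = (\<Sum>k. ex t ^ N k * poly (f k) (ex t))"

lemma block_boundary_measurable: "block_boundary N f \<in> borel_measurable lebesgue"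
  unfolding block_boundary_def
  by (intro borel_measurable_suminf borel_measurable_lebesgue_continuous continuous_intros)

context
  fixes N :: "nat \<Rightarrow> nat" and f :: "nat \<Rightarrow> complex poly" and q \<tau> :: real
  assumes N_step: "\<And>k. N k + degree (f k) + k < N (Suc k)"
    and N_coeff: "\<And>k i. norm (coeff (f k) i) \<le> real (N k)"
    and radial: "\<And>k r t. r \<in> {0<..1} \<Longrightarrow>
      norm ((of_real r * ex t) ^ N k * poly (f k) (of_real r * ex t)) \<le> norm (poly (f k) (ex t)) + (1/4) ^ k"
    and q: "q > 0" and \<tau>: "\<tau> \<ge> 0"
    and q_norm: "\<And>k. (2 ^ k) powr q * (LINT t|unit_meas. norm (poly (f k) (ex t)) powr q) \<le> \<tau> * (1/2) ^ k"
begin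

text \<open>Dominates block k on the whole radius through t, hence plays the part of its radial
  maximal function. The term (1/4)^k still decays like (1/2)^k after multiplication by the weight
  2^k.\<close>

definition "majorant k t = norm (poly (f k) (ex t)) + (1/4) ^ k"

lemma majorant_nonneg: "majorant k t \<ge> 0"
  by (simp add: majorant_def)

lemma majorant_continuous: "continuous_on S (majorant k)"
  unfolding majorant_def[abs_def] by (intro continuous_intros)

lemma majorant_bound:
  "(\<integral>\<^sup>+ t. ennreal ((2 ^ k * majorant k t) powr q) * indicator UNIV t \<partial>unit_meas) \<le>
     ennreal (2 powr q * (\<tau> * (1/2) ^ k + ((1/2) powr q) ^ k))"
proof -
  define u where "u t = norm (poly (f k) (ex t))" for t
  have le: "(2 ^ k * majorant k t) powr q \<le> 2 powr q * ((2 ^ k) powr q * u t powr q + ((1/2) powr q) ^ k)" for t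
  proof -
    have "2 ^ k * majorant k t = 2 ^ k * u t + (1/2) ^ k"
      by (simp add: majorant_def u_def distrib_left flip: power_mult_distrib)
    then have "(2 ^ k * majorant k t) powr q \<le> 2 powr q * ((2 ^ k * u t) powr q + ((1/2) ^ k) powr q)"
      using powr_add_le[of "2 ^ k * u t" "(1/2) ^ k" q] q by (simp add: u_def)
    also have "(2 ^ k * u t) powr q = (2 ^ k) powr q * u t powr q" by (simp add: powr_mult u_def)
    also have "((1/2) ^ k) powr q = ((1/2) powr q) ^ k"
      by (simp add: powr_powr mult.commute flip: powr_realpow)
    finally show ?thesis .
  qed
  have u: "bdd_meas (\<lambda>t. u t powr q)"
    unfolding u_def by (intro bdd_meas_continuous continuous_on_poly_powr q)
  \<comment> \<open>The double minus writes a sum as a difference, so that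
    \<open>bdd_meas_diff\<close> applies.\<close>
  have b: "bdd_meas (\<lambda>t. 2 powr q * ((2 ^ k) powr q * u t powr q - (- (((1/2) powr q) ^ k))))"
    by (intro bdd_meas_mult bdd_meas_diff bdd_meas_const u)
  have "(LINT t|unit_meas. 2 powr q * ((2 ^ k) powr q * u t powr q - (- (((1/2) powr q) ^ k)))) =
     2 powr q * ((2 ^ k) powr q * (LINT t|unit_meas. u t powr q) + ((1/2) powr q) ^ k)"
    using bdd_meas_integrable[OF u] by (simp add: measure_unit_meas)
  also have "\<dots> \<le> 2 powr q * (\<tau> * (1/2) ^ k + ((1/2) powr q) ^ k)"
    using q_norm[of k] unfolding u_def by (intro mult_left_mono add_right_mono) auto
  finally have "(\<integral>\<^sup>+ t. ennreal (2 powr q * ((2 ^ k) powr q * u t powr q - (- (((1/2) powr q) ^ k)))) \<partial>unit_meas) \<le>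
     ennreal (2 powr q * (\<tau> * (1/2) ^ k + ((1/2) powr q) ^ k))"
    by (intro nn_integral_unit_meas_le b) auto
  moreover have "(\<integral>\<^sup>+ t. ennreal ((2 ^ k * majorant k t) powr q) * indicator UNIV t \<partial>unit_meas) \<le>
    (\<integral>\<^sup>+ t. ennreal (2 powr q * ((2 ^ k) powr q * u t powr q - (- (((1/2) powr q) ^ k)))) \<partial>unit_meas)"
    using le by (intro nn_integral_mono) (auto intro!: ennreal_leI)
  ultimately show ?thesis by (rule order_trans[rotated])
qed

definition "majorant_total = (\<Sum>k. 2 powr q * (\<tau> * (1/2) ^ k + ((1/2) powr q) ^ k))"

lemma majorant_integrals:
  shows "(\<integral>\<^sup>+ t. (\<Sum>k. ennreal ((2 ^ k * majorant k t) powr q)) * indicator UNIV t \<partial>unit_meas) \<le> ennreal majorant_total"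
    and "(\<integral>\<^sup>+ t. ennreal ((\<Sum>k. majorant k t) powr q) * indicator UNIV t \<partial>unit_meas) \<le> ennreal (2 powr q * majorant_total)"
proof -
  have "(1/2::real) powr q < 1 powr q" using q by (intro powr_less_mono2) auto
  then have s: "summable (\<lambda>k. 2 powr q * (\<tau> * (1/2) ^ k + ((1/2) powr q) ^ k))"
    by (intro summable_mult summable_add summable_geometric) auto
  have m: "majorant k \<in> borel_measurable unit_meas" for k
    by (intro bdd_meas_measurable bdd_meas_continuous majorant_continuous)
  show "(\<integral>\<^sup>+ t. (\<Sum>k. ennreal ((2 ^ k * majorant k t) powr q)) * indicator UNIV t \<partial>unit_meas) \<le> ennreal majorant_total"
    "(\<integral>\<^sup>+ t. ennreal ((\<Sum>k. majorant k t) powr q) * indicator UNIV t \<partial>unit_meas) \<le> ennreal (2 powr q * majorant_total)"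
    unfolding majorant_total_def
    by (intro nn_integral_suminf_powr_le majorant_nonneg q m majorant_bound s; use \<tau> in \<open>simp add: sets.Int_space_eq1\<close>)+
qed

lemma AE_summable_majorant: "AE t in unit_meas. summable (\<lambda>k. majorant k t)"
proof -
  have [measurable]: "majorant k \<in> borel_measurable unit_meas" for k
    by (intro bdd_meas_measurable bdd_meas_continuous majorant_continuous)
  have "(\<integral>\<^sup>+ t. (\<Sum>k. ennreal ((2 ^ k * majorant k t) powr q)) \<partial>unit_meas) \<noteq> \<infinity>"
    using majorant_integrals(1) by (auto simp: top_unique)
  then have "AE t in unit_meas. (\<Sum>k. ennreal ((2 ^ k * majorant k t) powr q)) \<noteq> \<infinity>"
    by (intro nn_integral_PInf_AE) measurable
  then show ?thesis
  proof eventually_elim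
    case (elim t)
    then have "summable (\<lambda>k. (2 ^ k * majorant k t) powr q)"
      by (intro summable_suminf_not_top) auto
    then show ?case by (rule suminf_powr_le(1)[OF majorant_nonneg q])
  qed
qed

text \<open>For almost every t all Abel means are dominated by the sum of the majorants, which does
  not depend on r and has finite q-mass.\<close>

lemma block_hardy: "hardy q (block_coeff N f)"
  unfolding hardy_def
proof (intro conjI ballI allI exI)
  show "poly_growth (block_coeff N f)" by (rule block_poly_growth[OF N_step N_coeff])
  fix r :: real assume r: "r \<in> {0<..<1}"
  show "summable (\<lambda>n. block_coeff N f n * of_real (r ^ n) * cis (2 * pi * real n * t))" for t
    by (rule block_summable[OF N_step N_coeff r])
  show "abel_mean (block_coeff N f) r \<in> borel_measurable lebesgue"
    unfolding abel_mean_def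
    by (intro borel_measurable_suminf borel_measurable_lebesgue_continuous continuous_intros)
  have "(\<integral>\<^sup>+ t\<in>{0..1}. ennreal (norm (abel_mean (block_coeff N f) r t) powr q) \<partial>lebesgue) =
      (\<integral>\<^sup>+ t. ennreal (norm (abel_mean (block_coeff N f) r t) powr q) \<partial>unit_meas)"
    by (simp add: nn_integral_restrict_space)
  also have "\<dots> \<le> (\<integral>\<^sup>+ t. ennreal ((\<Sum>k. majorant k t) powr q) * indicator UNIV t \<partial>unit_meas)"
  proof (rule nn_integral_mono_AE, use AE_summable_majorant in eventually_elim)
    case (elim t)
    have "norm (abel_mean (block_coeff N f) r t) \<le> (\<Sum>k. majorant k t)"
      unfolding sums_unique[OF block_abel_sums[OF N_step N_coeff r]]
      by (rule norm_suminf_le[OF _ elim]) (use radial[of r] r in \<open>auto simp: majorant_def\<close>)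
    then show ?case using q by (auto intro!: ennreal_leI powr_mono2)
  qed
  also have "\<dots> \<le> ennreal (2 powr q * majorant_total)" by (rule majorant_integrals)
  finally show "(\<integral>\<^sup>+ t\<in>{0..1}. ennreal (norm (abel_mean (block_coeff N f) r t) powr q) \<partial>lebesgue)
     \<le> ennreal (2 powr q * majorant_total)" .
qed

text \<open>Where the majorants are summable, the Weierstrass test on (0, 1] gives uniform
  convergence up to and including r = 1, so the sum is continuous there and its left limit is the
  sum of the boundary values.\<close>

lemma block_boundary_value: "boundary_value (block_coeff N f) (block_boundary N f)"
  unfolding boundary_value_def
proof
  show "block_boundary N f \<in> borel_measurable lebesgue" by (rule block_boundary_measurable)
  have "AE t in unit_meas. ((\<lambda>r. abel_mean (block_coeff N f) r t) \<longlongrightarrow> block_boundary N f t) (at_left 1)"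
    using AE_summable_majorant
  proof eventually_elim
    case (elim t)
    define h where "h k r = (of_real r * ex t) ^ N k * poly (f k) (of_real r * ex t)" for k r
    have "uniform_limit {0<..1} (\<lambda>n r. \<Sum>k<n. h k r) (\<lambda>r. \<Sum>k. h k r) sequentially"
      by (rule Weierstrass_m_test[OF _ elim]) (use radial in \<open>auto simp: h_def majorant_def\<close>)
    then have "continuous_on {0<..1} (\<lambda>r. \<Sum>k. h k r)"
      by (rule uniform_limit_theorem[rotated])
         (auto simp: h_def intro!: always_eventually continuous_intros)
    then have "((\<lambda>r. \<Sum>k. h k r) \<longlongrightarrow> (\<Sum>k. h k 1)) (at 1 within {0<..1})"
      by (auto simp: continuous_on_def)
    then have "((\<lambda>r. \<Sum>k. h k r) \<longlongrightarrow> (\<Sum>k. h k 1)) (at 1 within {0<..<1})"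
      by (rule tendsto_within_subset) auto
    moreover have "at 1 within {0<..<1} = at_left (1::real)"
      by (rule at_within_nhd[of _ "{0<..}"]) auto
    ultimately have lim: "((\<lambda>r. \<Sum>k. h k r) \<longlongrightarrow> block_boundary N f t) (at_left 1)"
      by (simp add: block_boundary_def h_def)
    have "\<forall>\<^sub>F r in at_left (1::real). r \<in> {0<..<1}"
      by (rule eventually_at_leftI[of 0]) auto
    then have "\<forall>\<^sub>F r in at_left (1::real). (\<Sum>k. h k r) = abel_mean (block_coeff N f) r t"
    proof eventually_elim
      case (elim r)
      from sums_unique[OF block_abel_sums[OF N_step N_coeff elim]] show ?case by (simp add: h_def)
    qed
    then show ?case using lim by (rule Lim_transform_eventually[rotated])
  qed
  then show "AE t in lebesgue. t \<in> {0..1} \<longrightarrow>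
      ((\<lambda>r. abel_mean (block_coeff N f) r t) \<longlongrightarrow> block_boundary N f t) (at_left 1)"
    by (simp add: AE_restrict_space_iff)
qed

lemma AE_summable_blocks: "AE t in unit_meas. summable (\<lambda>k. norm (poly (f k) (ex t)))"
  using AE_summable_majorant
  by eventually_elim (auto intro: summable_comparison_test' simp: majorant_def)

end

section \<open>The counterexample\<close>

lemma half_set_positive:
  assumes E: "circle_set E" "symmetric_set E" and pos: "measure lebesgue (E \<inter> {0..1}) > 0"
  shows "measure lebesgue (E \<inter> {0..1/2}) > 0"
proof (rule ccontr)
  assume "\<not> measure lebesgue (E \<inter> {0..1/2}) > 0"
  then have z: "measure lebesgue (E \<inter> {0..1/2}) = 0" using measure_nonneg[of lebesgue "E \<inter> {0..1/2}"] by linarith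
  have EL: "E \<in> sets lebesgue" using E by (simp add: circle_set_def)
  have refl: "1 - x \<in> E" if "x \<in> E" for x
  proof -
    have "- x \<in> E" using E(2) that unfolding symmetric_set_def by blast
    then have "- x + 1 \<in> E" using E(1) unfolding circle_set_def by blast
    then show ?thesis by (simp add: add.commute)
  qed
  have "E \<inter> {0..1/2} \<in> lmeasurable" using EL by (intro bounded_set_imp_lmeasurable bounded_Int) auto
  then have "E \<inter> {0..1/2} \<in> null_sets lebesgue"
    using z by (auto simp: null_sets_def emeasure_eq_measure2 fmeasurableD)
  \<comment> \<open>\<open>emeasure_symm_le\<close> concerns Borel sets, so the Lebesgue null set is
    enlarged to a Borel null set before it is reflected.\<close>
  then obtain Z where Z: "Z \<in> null_sets lborel" "E \<inter> {0..1/2} \<subseteq> Z"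
    by (auto simp: null_sets_completion_iff2)
  then have Zb: "Z \<in> sets borel" by auto
  have "E \<inter> {0..1} \<subseteq> symm Z"
  proof
    fix x assume x: "x \<in> E \<inter> {0..1}"
    then show "x \<in> symm Z" using Z(2) refl[of x] by (cases "x \<le> 1/2") (auto simp: symm_def)
  qed
  then have "emeasure lebesgue (E \<inter> {0..1}) \<le> emeasure lebesgue (symm Z)"
    using symm_borel[OF Zb] by (intro emeasure_mono) auto
  also have "\<dots> \<le> 2 * emeasure lebesgue Z" by (rule emeasure_symm_le[OF Zb])
  also have "\<dots> = 0" using Z(1) by (simp add: null_sets_def)
  finally show False using pos by (simp add: measure_def)
qed

lemma symm_subset_circle_set:
  assumes E: "circle_set E" "symmetric_set E" and K: "K \<subseteq> E"
  shows "symm K \<subseteq> E"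
proof
  fix t assume "t \<in> symm K"
  then have "t \<in> E \<or> 1 - t \<in> E" using K by (auto simp: symm_def)
  moreover have "t \<in> E" if "1 - t \<in> E"
  proof -
    have "- (1 - t) \<in> E" using E(2) that unfolding symmetric_set_def by blast
    then have "- (1 - t) + 1 \<in> E" using E(1) unfolding circle_set_def by blast
    then show ?thesis by simp
  qed
  ultimately show "t \<in> E" by blast
qed

text \<open>[0, 1/2] is a fundamental domain of the reflection: t and 1 - t both lie in it only for
  t = 1/2, where they coincide.\<close>

lemma symm_disjoint:
  assumes "K \<inter> K' = {}" "K \<subseteq> {0..1/2}" "K' \<subseteq> {0..1/2}"
  shows "symm K \<inter> symm K' = {}"
proof -
  have False if t: "t \<in> symm K" "t \<in> symm K'" for t
  proof -
    obtain x where x: "x \<in> K" "x = t \<or> x = 1 - t" using t(1) by (auto simp: symm_def)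
    obtain y where y: "y \<in> K'" "y = t \<or> y = 1 - t" using t(2) by (auto simp: symm_def)
    have "0 \<le> x" "x \<le> 1/2" "0 \<le> y" "y \<le> 1/2" using x(1) y(1) assms(2,3) by auto
    then have "x = y" using x(2) y(2) by linarith
    then show False using x(1) y(1) assms(1) by blast
  qed
  then show ?thesis by blast
qed

lemma block_boundary_minus_block:
  assumes sm: "summable (\<lambda>j. norm (poly (f j) (ex t)))"
  shows "norm (poly (f k) (ex t)) \<le> norm (block_boundary N f t) + (\<Sum>j. if j = k then 0 else norm (poly (f j) (ex t)))"
proof -
  define b where "b j = ex t ^ N j * poly (f j) (ex t)" for j
  define b' where "b' j = (if j = k then 0 else b j)" for j
  have nb: "norm (b j) = norm (poly (f j) (ex t))" for j by (simp add: b_def norm_mult norm_power)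
  have sb': "summable (\<lambda>j. if j = k then 0 else norm (poly (f j) (ex t)))"
    by (rule summable_comparison_test'[OF sm]) auto
  have nb': "norm (b' j) \<le> (if j = k then 0 else norm (poly (f j) (ex t)))" for j by (simp add: b'_def nb)
  have "summable b'" by (rule summable_comparison_test'[OF sb' nb'])
  moreover have "(\<lambda>j. if j = k then b j else 0) sums b k" by (rule sums_single)
  ultimately have "(\<lambda>j. b' j + (if j = k then b j else 0)) sums (suminf b' + b k)"
    by (intro sums_add summable_sums)
  moreover have "(\<lambda>j. b' j + (if j = k then b j else 0)) = b" by (auto simp: b'_def)
  moreover have "block_boundary N f t = suminf b" unfolding block_boundary_def b_def[abs_def] ..
  ultimately have "suminf b' + b k = block_boundary N f t"
    by (simp add: sums_iff)
  then have "b k = block_boundary N f t - suminf b'" by (simp add: algebra_simps)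
  then have "norm (b k) \<le> norm (block_boundary N f t) + norm (suminf b')" by (simp add: norm_triangle_ineq4)
  also have "norm (suminf b') \<le> (\<Sum>j. if j = k then 0 else norm (poly (f j) (ex t)))"
    by (rule norm_suminf_le[OF nb' sb'])
  finally show ?thesis by (simp add: nb)
qed

lemma nn_integral_infinite_of_disjoint:
  fixes h :: "'a \<Rightarrow> ennreal"
  assumes h: "h \<in> borel_measurable M" and S: "\<And>k::nat. S k \<in> sets M"
    and dis: "disjoint_family S" and c: "c > 0"
    and low: "\<And>k. c \<le> (\<integral>\<^sup>+ t. h t * indicator (S k) t \<partial>M)"
  shows "(\<integral>\<^sup>+ t. h t \<partial>M) = \<infinity>"
proof (rule ccontr)
  assume fin: "(\<integral>\<^sup>+ t. h t \<partial>M) \<noteq> \<infinity>"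
  have [measurable]: "h \<in> borel_measurable M" "\<And>k. S k \<in> sets M" by fact+
  have "of_nat n * c \<le> (\<integral>\<^sup>+ t. h t \<partial>M)" for n
  proof -
    have "of_nat n * c = (\<Sum>k<n. c)" by simp
    also have "\<dots> \<le> (\<Sum>k<n. \<integral>\<^sup>+ t. h t * indicator (S k) t \<partial>M)" by (intro sum_mono low)
    also have "\<dots> = (\<integral>\<^sup>+ t. (\<Sum>k<n. h t * indicator (S k) t) \<partial>M)"
      by (rule nn_integral_sum[symmetric]) measurable
    also have "\<dots> \<le> (\<integral>\<^sup>+ t. h t \<partial>M)"
    proof (rule nn_integral_mono)
      fix t
      have "(\<Sum>k<n. h t * indicator (S k) t) = h t * indicator (\<Union>k\<in>{..<n}. S k) t"
        using dis by (subst indicator_UN_disjoint)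
          (auto simp: sum_distrib_left disjoint_family_on_def)
      also have "\<dots> \<le> h t" by (auto simp: indicator_def)
      finally show "(\<Sum>k<n. h t * indicator (S k) t) \<le> h t" .
    qed
    finally show ?thesis .
  qed
  then have "(SUP n::nat. of_nat n * c) \<le> (\<integral>\<^sup>+ t. h t \<partial>M)" by (intro SUP_least)
  moreover have "(SUP n::nat. of_nat n * c) = \<infinity>"
    using c by (simp add: SUP_mult_right_ennreal[symmetric] ennreal_SUP_of_nat_eq_top ennreal_top_mult)
  ultimately show False using fin by (simp add: top_unique)
qed

theorem theorem4:
  fixes p :: real
  assumes "0 < p" and "\<not> (\<exists>n::nat. p = 2 * real n)"
  shows "\<forall>E q. circle_set E \<and> symmetric_set E \<and> measure lebesgue (E \<inter> {0..1}) > 0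
            \<and> 0 < q \<and> q < p \<longrightarrow>
          (\<exists>c g. hardy q c \<and> (\<forall>n. Im (c n) = 0 \<and> Re (c n) \<ge> 0) \<and> gaps_to_infinity c
             \<and> boundary_value c g
             \<and> (\<integral>\<^sup>+ t\<in>{0..1} - E. ennreal (norm (g t) powr p) \<partial>lebesgue) < \<infinity>
             \<and> (\<integral>\<^sup>+ t\<in>{0..1}. ennreal (norm (g t) powr p) \<partial>lebesgue) = \<infinity>)"
proof (intro allI impI, elim conjE)
  fix E :: "real set" and q :: real
  assume E: "circle_set E" "symmetric_set E" "measure lebesgue (E \<inter> {0..1}) > 0" and q: "0 < q" "q < p"
  have p: "p > 0" "\<And>n::nat. p \<noteq> 2 * real n" using assms by auto
  have EL: "E \<in> sets lebesgue" using E by (simp add: circle_set_def)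
  define A where "A = E \<inter> {0..1/2}"
  have A: "A \<in> lmeasurable" unfolding A_def using EL by (intro bounded_set_imp_lmeasurable bounded_Int) auto
  have A01: "A \<subseteq> {0..1}" and Apos: "measure lebesgue A > 0"
    using half_set_positive[OF E] by (auto simp: A_def)
  obtain B :: "nat \<Rightarrow> real set" where B: "\<And>k. B k \<in> lmeasurable" "\<And>k. B k \<subseteq> A"
    "\<And>k. measure lebesgue (B k) > 0" "\<And>i j. i \<noteq> j \<Longrightarrow> B i \<inter> B j = {}"
    by (rule disjoint_positive_subsets[OF A A01 Apos]) (rule that)
  \<comment> \<open>The factor 2^p is lost twice on \<open>symm (K k)\<close>: in separating block k
    from the rest, and in summing the rest, whose weighted masses total at most 2 \<tau>. This value
    makes the loss 1/2, while block k alone has mass at least 1.\<close>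
  define \<tau> where "\<tau> = 1 / (4 * (2 powr p * 2 powr p))"
  have \<tau>: "\<tau> > 0" by (simp add: \<tau>_def)
  \<comment> \<open>Dividing by (2^k)^p cancels the weight 2^k of the summation lemma and leaves a
    geometric series; since q < p, the same choice also serves the exponent q.\<close>
  define \<epsilon> where "\<epsilon> k = \<tau> * (1/2) ^ k / (2 ^ k) powr p" for k :: nat
  have \<epsilon>: "\<epsilon> k > 0" for k using \<tau> by (simp add: \<epsilon>_def)
  define good where "good k K f \<longleftrightarrow> closed K \<and> K \<subseteq> B k \<and> gap_poly k f \<and>
    (LINT t|unit_meas. indicator (symm K) t * norm (poly f (ex t)) powr p) \<ge> 1 \<and>
    (LINT t|unit_meas. indicator (- symm K) t * norm (poly f (ex t)) powr p) \<le> \<epsilon> k \<and>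
    (LINT t|unit_meas. norm (poly f (ex t)) powr q) \<le> \<epsilon> k" for k K f
  have "\<exists>K f. good k K f" for k
  proof -
    have "B k \<subseteq> {0..1/2}" using B(2)[of k] by (auto simp: A_def)
    then show ?thesis unfolding good_def
      by (rule concentrating_poly_small_norm[OF p q B(1) _ B(3) \<epsilon>]) blast
  qed
  then obtain K f where "\<And>k. good k (K k) (f k)" by metis
  then have K: "\<And>k. closed (K k)" "\<And>k. K k \<subseteq> B k" and f: "\<And>k. gap_poly k (f k)"
    "\<And>k. (LINT t|unit_meas. indicator (symm (K k)) t * norm (poly (f k) (ex t)) powr p) \<ge> 1"
    "\<And>k. (LINT t|unit_meas. indicator (- symm (K k)) t * norm (poly (f k) (ex t)) powr p) \<le> \<epsilon> k"
    "\<And>k. (LINT t|unit_meas. norm (poly (f k) (ex t)) powr q) \<le> \<epsilon> k"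
    unfolding good_def by blast+
  have f0: "f k \<noteq> 0" for k using f(2)[of k] p(1) by auto
  have "\<exists>R. \<forall>M\<ge>R. \<forall>r\<in>{0<..1}. \<forall>t.
    norm ((of_real r * ex t) ^ M * poly (f k) (of_real r * ex t)) \<le> norm (poly (f k) (ex t)) + (1/4) ^ k" for k
    by (rule poly_radial_bound) simp
  then obtain R where R: "\<And>k M r t. M \<ge> R k \<Longrightarrow> r \<in> {0<..1} \<Longrightarrow>
    norm ((of_real r * ex t) ^ M * poly (f k) (of_real r * ex t)) \<le> norm (poly (f k) (ex t)) + (1/4) ^ k"
    by metis
  have "\<exists>C::nat. \<forall>i. norm (coeff (f k) i) \<le> real C" for k
  proof -
    obtain C :: nat where C: "(\<Sum>i\<le>degree (f k). norm (coeff (f k) i)) \<le> real C" using real_arch_simple by blast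
    have "norm (coeff (f k) i) \<le> real C" for i
    proof (cases "i \<le> degree (f k)")
      case True
      then have "norm (coeff (f k) i) \<le> (\<Sum>i\<le>degree (f k). norm (coeff (f k) i))"
        by (intro member_le_sum) auto
      then show ?thesis using C by linarith
    qed (simp add: coeff_eq_0)
    then show ?thesis by blast
  qed
  then obtain C :: "nat \<Rightarrow> nat" where C: "\<And>k i. norm (coeff (f k) i) \<le> real (C k)" by metis
  \<comment> \<open>The first sum lifts N k above the radial threshold R k and the coefficient bound
    C k. The second makes room for the preceding blocks and their margins, its 1 making
    \<open>N_step\<close> strict.\<close>
  define N where "N k = (\<Sum>j\<le>k. R j + C j) + (\<Sum>j<k. degree (f j) + j + 1)" for k
  have N_step: "N k + degree (f k) + k < N (Suc k)" for k by (simp add: N_def)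
  have "R k + C k \<le> N k" for k
    using member_le_sum[of k "{..k}" "\<lambda>j. R j + C j"] by (simp add: N_def)
  then have N_RC: "R k \<le> N k" "C k \<le> N k" for k using add_leE by blast+
  have N_coeff: "norm (coeff (f k) i) \<le> real (N k)" for k i
    using C[of k i] N_RC(2)[of k] by linarith
  have q_norm: "(2 ^ k) powr q * (LINT t|unit_meas. norm (poly (f k) (ex t)) powr q) \<le> \<tau> * (1/2) ^ k" for k
  proof -
    have "(2 ^ k) powr q * (LINT t|unit_meas. norm (poly (f k) (ex t)) powr q) \<le> (2 ^ k) powr p * \<epsilon> k"
      using q by (intro mult_mono f(4) powr_mono) auto
    then show ?thesis by (simp add: \<epsilon>_def)
  qed
  note ctx = N_step N_coeff R[OF N_RC(1)] q(1) less_imp_le[OF \<tau>] q_norm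
  define c where "c = block_coeff N f"
  define g where "g = block_boundary N f"
  define u where "u k t = norm (poly (f k) (ex t))" for k t
  have u0: "u k t \<ge> 0" for k t by (simp add: u_def)
  have AEu: "AE t in unit_meas. summable (\<lambda>k. u k t)"
    unfolding u_def by (rule AE_summable_blocks[OF ctx])
  have um: "u k \<in> borel_measurable unit_meas" for k
    unfolding u_def[abs_def] by (intro bdd_meas_measurable bdd_meas_continuous continuous_intros)
  have gm: "g \<in> borel_measurable unit_meas"
    unfolding g_def by (rule measurable_restrict_space1[OF block_boundary_measurable])
  have SL: "symm (K k) \<in> sets lebesgue" "- symm (K k) \<in> sets lebesgue" for k
    using symm_borel[of "K k"] K(1) by (auto simp: Compl_in_sets_lebesgue)
  have unit_sets: "S \<inter> space unit_meas \<in> sets unit_meas" if "S \<in> sets lebesgue" for S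
    using that by (auto simp: sets_restrict_space space_restrict_space)
  \<comment> \<open>Used twice: with S the complement of E, which avoids every
    \<open>symm (K k)\<close>, and with S the concentration set of another block.\<close>
  have out: "(\<integral>\<^sup>+ t. ennreal ((2 ^ k * u k t) powr p) * indicator S t \<partial>unit_meas) \<le> ennreal (\<tau> * (1/2) ^ k)"
    if S: "S \<inter> {0..1} \<subseteq> - symm (K k)" for k S
  proof -
    have "(\<integral>\<^sup>+ t. ennreal ((2 ^ k * u k t) powr p) * indicator S t \<partial>unit_meas) \<le>
        (\<integral>\<^sup>+ t. ennreal ((2 ^ k) powr p * (indicator (- symm (K k)) t * u k t powr p)) \<partial>unit_meas)"
      using S by (intro nn_integral_mono) (auto simp: indicator_def powr_mult u0)
    also have "\<dots> \<le> ennreal ((2 ^ k) powr p * \<epsilon> k)"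
    proof (rule nn_integral_unit_meas_le)
      have b: "bdd_meas (\<lambda>t. u k t powr p)" unfolding u_def by (intro bdd_meas_continuous continuous_on_poly_powr p)
      show "bdd_meas (\<lambda>t. (2 ^ k) powr p * (indicator (- symm (K k)) t * u k t powr p))"
        by (intro bdd_meas_mult bdd_meas_const bdd_meas_indicator SL b)
      show "(LINT t|unit_meas. (2 ^ k) powr p * (indicator (- symm (K k)) t * u k t powr p)) \<le> (2 ^ k) powr p * \<epsilon> k"
        using f(3)[of k] by (simp add: u_def mult_left_mono)
    qed simp
    also have "(2 ^ k) powr p * \<epsilon> k = \<tau> * (1/2) ^ k" by (simp add: \<epsilon>_def)
    finally show ?thesis .
  qed
  have sm\<tau>: "summable (\<lambda>k. \<tau> * (1/2) ^ k)" "(\<Sum>k. \<tau> * (1/2) ^ k) = 2 * \<tau>"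
    using sums_mult[OF geometric_sums[of "1/2::real"], of \<tau>] by (auto simp: sums_iff)
  have finite_part: "(\<integral>\<^sup>+ t. ennreal (norm (g t) powr p) * indicator (- E) t \<partial>unit_meas) < \<infinity>"
  proof -
    have "(\<integral>\<^sup>+ t. ennreal (norm (g t) powr p) * indicator (- E) t \<partial>unit_meas) \<le>
       (\<integral>\<^sup>+ t. ennreal ((\<Sum>k. u k t) powr p) * indicator (- E) t \<partial>unit_meas)"
    proof (rule nn_integral_mono_AE, use AEu in eventually_elim)
      case (elim t)
      have "norm (g t) \<le> (\<Sum>k. u k t)" unfolding g_def block_boundary_def
        by (rule norm_suminf_le[OF _ elim]) (simp add: u_def norm_mult norm_power)
      then show ?case using p(1) by (intro mult_right_mono ennreal_leI powr_mono2) auto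
    qed
    also have "\<dots> \<le> ennreal (2 powr p * (\<Sum>k. \<tau> * (1/2) ^ k))"
    proof (rule nn_integral_suminf_powr_le(2)[OF u0 p(1) um _ out _ sm\<tau>(1)])
      show "- E \<inter> space unit_meas \<in> sets unit_meas"
        using EL by (intro unit_sets) (simp add: Compl_in_sets_lebesgue)
      show "- E \<inter> {0..1} \<subseteq> - symm (K k)" for k
        using symm_subset_circle_set[OF E(1,2), of "K k"] K(2)[of k] B(2)[of k] by (auto simp: A_def)
    qed (use \<tau> in simp)
    also have "\<dots> < \<infinity>" by simp
    finally show ?thesis .
  qed
  have Ksub: "K k \<subseteq> {0..1/2}" for k using K(2)[of k] B(2)[of k] by (auto simp: A_def)
  have Kdis: "symm (K i) \<inter> symm (K j) = {}" if "i \<noteq> j" for i j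
    by (rule symm_disjoint[OF _ Ksub Ksub]) (use B(4)[OF that] K(2)[of i] K(2)[of j] in blast)
  \<comment> \<open>On \<open>symm (K k)\<close> every other block is outside its own concentration
    set, so together they cannot cancel block k. What remains for g is at least 1/2 after
    multiplication by 2^p, a bound independent of k.\<close>
  have low: "ennreal (1 / (2 * 2 powr p)) \<le> (\<integral>\<^sup>+ t. ennreal (norm (g t) powr p) * indicator (symm (K k)) t \<partial>unit_meas)" for k
  proof -
    define S where "S = symm (K k)"
    define R' where "R' t = (\<Sum>j. if j = k then 0 else u j t)" for t
    define X where "X = (\<integral>\<^sup>+ t. ennreal (norm (g t) powr p) * indicator S t \<partial>unit_meas)"
    have Ss: "S \<inter> space unit_meas \<in> sets unit_meas" unfolding S_def by (intro unit_sets SL)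
    have [measurable]: "(indicator S :: real \<Rightarrow> ennreal) \<in> borel_measurable unit_meas"
      using Ss by (simp only: borel_measurable_indicator_iff)
    have [measurable]: "u j \<in> borel_measurable unit_meas" for j by (rule um)
    have [measurable]: "g \<in> borel_measurable unit_meas" by (rule gm)
    have R'm[measurable]: "R' \<in> borel_measurable unit_meas"
      unfolding R'_def by measurable
    have rest: "(\<integral>\<^sup>+ t. ennreal (R' t powr p) * indicator S t \<partial>unit_meas) \<le> ennreal (2 powr p * (\<Sum>k. \<tau> * (1/2) ^ k))"
      unfolding R'_def
    proof (rule nn_integral_suminf_powr_le(2)[OF _ p(1) _ _ _ _ sm\<tau>(1)])
      fix j
      show "(\<integral>\<^sup>+ t. ennreal ((2 ^ j * (if j = k then 0 else u j t)) powr p) * indicator S t \<partial>unit_meas) \<le> ennreal (\<tau> * (1/2) ^ j)"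
      proof (cases "j = k")
        case False
        have "(\<integral>\<^sup>+ t. ennreal ((2 ^ j * u j t) powr p) * indicator S t \<partial>unit_meas) \<le> ennreal (\<tau> * (1/2) ^ j)"
          by (rule out) (use Kdis[OF False] in \<open>auto simp: S_def\<close>)
        then show ?thesis using False by simp
      qed simp
    next
      show "S \<inter> space unit_meas \<in> sets unit_meas" by (rule Ss)
    qed (use \<tau> u0 in auto)
    have "1 \<le> ennreal (LINT t|unit_meas. indicator S t * u k t powr p)"
      using f(2)[of k] by (simp add: S_def u_def)
    also have "\<dots> = (\<integral>\<^sup>+ t. ennreal (indicator S t * u k t powr p) \<partial>unit_meas)"
      unfolding S_def u_def
      by (intro nn_integral_eq_integral[symmetric] bdd_meas_integrable bdd_meas_mult bdd_meas_indicator SL bdd_meas_continuous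
            continuous_on_poly_powr p) auto
    also have "\<dots> \<le> (\<integral>\<^sup>+ t. ennreal (2 powr p) * (ennreal (norm (g t) powr p) * indicator S t + ennreal (R' t powr p) * indicator S t) \<partial>unit_meas)"
    proof (rule nn_integral_mono_AE, use AEu in eventually_elim)
      case (elim t)
      have R'0: "R' t \<ge> 0" unfolding R'_def
        by (rule suminf_nonneg) (use u0 in \<open>auto intro: summable_comparison_test'[OF elim]\<close>)
      have "u k t \<le> norm (g t) + R' t"
        unfolding u_def g_def R'_def
        by (rule block_boundary_minus_block) (use elim in \<open>simp add: u_def\<close>)
      then have "u k t powr p \<le> (norm (g t) + R' t) powr p" using p(1) u0 by (intro powr_mono2) auto
      also have "\<dots> \<le> 2 powr p * (norm (g t) powr p + R' t powr p)" using p(1) R'0 by (intro powr_add_le) auto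
      finally have "ennreal (u k t powr p) \<le> ennreal (2 powr p) * (ennreal (norm (g t) powr p) + ennreal (R' t powr p))"
        by (simp add: ennreal_leI flip: ennreal_plus ennreal_mult)
      then show ?case by (auto simp: indicator_def)
    qed
    also have "\<dots> = ennreal (2 powr p) * (X + (\<integral>\<^sup>+ t. ennreal (R' t powr p) * indicator S t \<partial>unit_meas))"
      unfolding X_def by (subst nn_integral_cmult, measurable) (subst nn_integral_add, measurable)
    also have "\<dots> \<le> ennreal (2 powr p) * (X + ennreal (2 powr p * (2 * \<tau>)))"
      using rest unfolding sm\<tau>(2) by (intro mult_left_mono add_left_mono) auto
    finally have le: "1 \<le> ennreal (2 powr p) * (X + ennreal (2 powr p * (2 * \<tau>)))" .
    show ?thesis
    proof (cases X)
      case (real x)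
      have "ennreal (2 powr p) * (X + ennreal y) = ennreal (2 powr p * (x + y))" if "y \<ge> 0" for y
        using real that by (simp add: ennreal_mult flip: ennreal_plus)
      from this[of "2 powr p * (2 * \<tau>)"] le \<tau>
      have "ennreal 1 \<le> ennreal (2 powr p * (x + 2 powr p * (2 * \<tau>)))" by simp
      then have "1 \<le> 2 powr p * (x + 2 powr p * (2 * \<tau>))"
        using real \<tau> by (subst (asm) ennreal_le_iff) auto
      then have "1 \<le> 2 powr p * x + 2 * (2 powr p * 2 powr p * \<tau>)" by (simp add: algebra_simps)
      moreover have "2 powr p * 2 powr p * \<tau> = 1 / 4" by (simp add: \<tau>_def)
      ultimately have "1 / 2 \<le> 2 powr p * x" by linarith
      then have "1 / (2 * 2 powr p) \<le> x" by (simp add: field_simps)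
      then show ?thesis using real unfolding X_def S_def by (simp add: ennreal_leI)
    next
      case top
      then show ?thesis unfolding X_def S_def by simp
    qed
  qed
  have infinite_part: "(\<integral>\<^sup>+ t. ennreal (norm (g t) powr p) \<partial>unit_meas) = \<infinity>"
  proof (rule nn_integral_infinite_of_disjoint[where S = "\<lambda>k. symm (K k) \<inter> {0..1}"])
    show "(\<lambda>t. ennreal (norm (g t) powr p)) \<in> borel_measurable unit_meas" using gm by measurable
    show "symm (K k) \<inter> {0..1} \<in> sets unit_meas" for k
      using unit_sets[OF SL(1)[of k]] by simp
    show "disjoint_family (\<lambda>k. symm (K k) \<inter> {0..1})"
      using Kdis by (auto simp: disjoint_family_on_def)
    show "0 < ennreal (1 / (2 * 2 powr p))" by simp
    show "ennreal (1 / (2 * 2 powr p)) \<le>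
       (\<integral>\<^sup>+ t. ennreal (norm (g t) powr p) * indicator (symm (K k) \<inter> {0..1}) t \<partial>unit_meas)" for k
    proof -
      have "(\<integral>\<^sup>+ t. ennreal (norm (g t) powr p) * indicator (symm (K k) \<inter> {0..1}) t \<partial>unit_meas) =
        (\<integral>\<^sup>+ t. ennreal (norm (g t) powr p) * indicator (symm (K k)) t \<partial>unit_meas)"
        by (intro nn_integral_cong) (auto simp: indicator_def)
      then show ?thesis using low[of k] by simp
    qed
  qed
  show "\<exists>c g. hardy q c \<and> (\<forall>n. Im (c n) = 0 \<and> Re (c n) \<ge> 0) \<and> gaps_to_infinity c
             \<and> boundary_value c g
             \<and> (\<integral>\<^sup>+ t\<in>{0..1} - E. ennreal (norm (g t) powr p) \<partial>lebesgue) < \<infinity>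
             \<and> (\<integral>\<^sup>+ t\<in>{0..1}. ennreal (norm (g t) powr p) \<partial>lebesgue) = \<infinity>"
  proof (intro exI conjI)
    show "hardy q c" unfolding c_def by (rule block_hardy[OF ctx])
    show "\<forall>n. Im (c n) = 0 \<and> Re (c n) \<ge> 0"
      unfolding c_def using block_nonneg[OF N_step f(1)] by blast
    show "gaps_to_infinity c" unfolding c_def by (rule block_gaps[OF N_step f(1) f0])
    show "boundary_value c g" unfolding c_def g_def by (rule block_boundary_value[OF ctx])
    have "(\<integral>\<^sup>+ t\<in>{0..1} - E. ennreal (norm (g t) powr p) \<partial>lebesgue) =
      (\<integral>\<^sup>+ t. ennreal (norm (g t) powr p) * indicator (- E) t \<partial>unit_meas)"
      by (subst nn_integral_restrict_space) (auto intro!: nn_integral_cong simp: indicator_def)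
    then show "(\<integral>\<^sup>+ t\<in>{0..1} - E. ennreal (norm (g t) powr p) \<partial>lebesgue) < \<infinity>"
      using finite_part by simp
    show "(\<integral>\<^sup>+ t\<in>{0..1}. ennreal (norm (g t) powr p) \<partial>lebesgue) = \<infinity>"
      using infinite_part by (simp add: nn_integral_restrict_space)
  qed
qed

end
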